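(* On simple graphs (no parallel edges), there is a $2^{O(p)}n^{O(1)}$ time algorithm for $(\mathrm{size},p,q)$-Partition, for $(\mathrm{nonedge},p,q)$-Partition, and for $(\mathrm{nondeg},p,q)$-Partition, where $n$ is the number of vertices of the input graph (and both $p$ and $q$ are part of the input).
   Context: For an undirected graph $G$ and $X\subseteq V(G)$: $d(X)$ is the number of edges between $X$ and $V(G)\setminus X$; $\mathrm{size}(X)=|X|$; $\mathrm{nonedge}(X)$ is the number of nonedges induced by $X$ (unordered pairs of distinct nonadjacent vertices in $X$); $\mathrm{nondeg}(X)$ is the maximum degree of the complement of the graph induced by $X$ (i.e., the maximum over $x\in X$ of the number of vertices of $X\setminus\{x\}$ not adjacent to $x$). For a set function $\mu$ on vertex sets, a set $C\subseteq V(G)$ is a $(\mu,p,q)$-cluster if $\mu(C)\le p$ and $d(C)\le q$. A $(\mu,p,q)$-partition of $G$ is a partition of $V(G)$ into $(\mu,p,q)$-clusters. The $(\mu,p,q)$-Partition problem: given a graph $G$ and integers $p,q$, find a $(\mu,p,q)$-partition of $G$ (or report that none exists). *)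

theory Defs
  imports "Graph_Theory.Pair_Digraph" "HOL-Library.Disjoint_Sets"
begin

section \<open>Graph clustering\<close>

text \<open>
  A simple undirected graph is a \<^locale>\<open>pair_graph\<close>: a finite, loop-free, symmetric digraph
  without parallel arcs. An undirected edge is the two-element set of its ends, so that the two
  arcs representing it are counted once.
\<close>

definition boundary :: "'a pair_pre_digraph \<Rightarrow> 'a set \<Rightarrow> nat" where
  "boundary G X = card {{x, y} | x y. x \<in> X \<and> y \<in> pverts G - X \<and> (x, y) \<in> parcs G}"

definition size_of :: "'a pair_pre_digraph \<Rightarrow> 'a set \<Rightarrow> nat" where
  "size_of G X = card X"

definition nonedge :: "'a pair_pre_digraph \<Rightarrow> 'a set \<Rightarrow> nat" where
  "nonedge G X = card {{x, y} | x y. x \<in> X \<and> y \<in> X \<and> x \<noteq> y \<and> (x, y) \<notin> parcs G}"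

text \<open>The inserted \<open>0\<close> only matters for empty \<open>X\<close>.\<close>

definition nondeg :: "'a pair_pre_digraph \<Rightarrow> 'a set \<Rightarrow> nat" where
  "nondeg G X = Max (insert 0 ((\<lambda>x. card {y \<in> X - {x}. (x, y) \<notin> parcs G}) ` X))"

definition is_cluster ::
    "('a pair_pre_digraph \<Rightarrow> 'a set \<Rightarrow> nat) \<Rightarrow> int \<Rightarrow> int \<Rightarrow> 'a pair_pre_digraph \<Rightarrow> 'a set \<Rightarrow> bool" where
  "is_cluster \<mu> p q G C \<longleftrightarrow>
     C \<subseteq> pverts G \<and> int (\<mu> G C) \<le> p \<and> int (boundary G C) \<le> q"

definition is_cluster_partition ::
    "('a pair_pre_digraph \<Rightarrow> 'a set \<Rightarrow> nat) \<Rightarrow> int \<Rightarrow> int \<Rightarrow> 'a pair_pre_digraph \<Rightarrow> 'a set set \<Rightarrow> bool" where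
  "is_cluster_partition \<mu> p q G P \<longleftrightarrow>
     partition_on (pverts G) P \<and> (\<forall>C\<in>P. is_cluster \<mu> p q G C)"


section \<open>Model of computation\<close>

text \<open>
  A deterministic unit-cost random access machine on integers, programmed with structured control.
  A program uses finitely many named arrays, indexed by integers; a scalar is cell \<open>0\<close> of its array.
  The only arithmetic operations are addition and subtraction: unit-cost multiplication would allow
  numbers of exponential length to be produced in polynomial time.
\<close>

type_synonym vname = string
type_synonym state = "vname \<Rightarrow> int \<Rightarrow> int"

datatype aexp = N int | Read vname aexp | Plus aexp aexp | Minus aexp aexp

datatype bexp = Less aexp aexp | Not bexp | And bexp bexp

datatype com =
    Skip
  | Write vname aexp aexp  \<comment> \<open>array, index, value\<close>
  | Seq com com
  | If bexp com com
  | While bexp com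

primrec aval :: "aexp \<Rightarrow> state \<Rightarrow> int" where
  "aval (N k) s = k"
| "aval (Read x i) s = s x (aval i s)"
| "aval (Plus a b) s = aval a s + aval b s"
| "aval (Minus a b) s = aval a s - aval b s"

primrec bval :: "bexp \<Rightarrow> state \<Rightarrow> bool" where
  "bval (Less a b) s \<longleftrightarrow> aval a s < aval b s"
| "bval (Not b) s \<longleftrightarrow> \<not> bval b s"
| "bval (And b c) s \<longleftrightarrow> bval b s \<and> bval c s"

primrec acost :: "aexp \<Rightarrow> nat" where
  "acost (N k) = 1"
| "acost (Read x i) = 1 + acost i"
| "acost (Plus a b) = 1 + acost a + acost b"
| "acost (Minus a b) = 1 + acost a + acost b"

primrec bcost :: "bexp \<Rightarrow> nat" where
  "bcost (Less a b) = 1 + acost a + acost b"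
| "bcost (Not b) = 1 + bcost b"
| "bcost (And b c) = 1 + bcost b + bcost c"

text \<open>\<open>exec c s t s'\<close>: started in \<open>s\<close>, the program \<open>c\<close> halts in \<open>s'\<close> after exactly \<open>t\<close> steps.\<close>

inductive exec :: "com \<Rightarrow> state \<Rightarrow> nat \<Rightarrow> state \<Rightarrow> bool" where
  exec_Skip: "exec Skip s 1 s"
| exec_Write:
    "exec (Write x i a) s (1 + acost i + acost a) (s(x := (s x)(aval i s := aval a s)))"
| exec_Seq: "exec c1 s1 t1 s2 \<Longrightarrow> exec c2 s2 t2 s3 \<Longrightarrow> exec (Seq c1 c2) s1 (t1 + t2) s3"
| exec_IfTrue: "bval b s \<Longrightarrow> exec c1 s t s' \<Longrightarrow> exec (If b c1 c2) s (1 + bcost b + t) s'"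
| exec_IfFalse: "\<not> bval b s \<Longrightarrow> exec c2 s t s' \<Longrightarrow> exec (If b c1 c2) s (1 + bcost b + t) s'"
| exec_WhileFalse: "\<not> bval b s \<Longrightarrow> exec (While b c) s (1 + bcost b) s"
| exec_WhileTrue:
    "bval b s1 \<Longrightarrow> exec c s1 t1 s2 \<Longrightarrow> exec (While b c) s2 t2 s3 \<Longrightarrow>
     exec (While b c) s1 (1 + bcost b + t1 + t2) s3"

inductive_cases exec_SkipE: "exec Skip s t s'"
inductive_cases exec_WriteE: "exec (Write x i a) s t s'"
inductive_cases exec_SeqE: "exec (Seq c1 c2) s t s'"
inductive_cases exec_IfE: "exec (If b c1 c2) s t s'"
inductive_cases exec_WhileE: "exec (While b c) s t s'"

lemma exec_deterministic:
  "exec c s t s' \<Longrightarrow> exec c s u s'' \<Longrightarrow> t = u \<and> s' = s''"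
proof (induction arbitrary: u s'' rule: exec.induct)
  case (exec_Skip s)
  then show ?case by (rule exec_SkipE) simp
next
  case (exec_Write x i a s)
  then show ?case by (rule exec_WriteE) simp
next
  case (exec_Seq c1 s1 t1 s2 c2 t2 s3)
  from exec_Seq.prems show ?case
    by (rule exec_SeqE) (auto dest: exec_Seq.IH)
next
  case (exec_IfTrue b s c1 t s' c2)
  from exec_IfTrue.prems show ?case
    by (rule exec_IfE) (auto dest: exec_IfTrue.IH simp: exec_IfTrue.hyps(1))
next
  case (exec_IfFalse b s c2 t s' c1)
  from exec_IfFalse.prems show ?case
    by (rule exec_IfE) (auto dest: exec_IfFalse.IH simp: exec_IfFalse.hyps(1))
next
  case (exec_WhileFalse b s c)
  from exec_WhileFalse.prems show ?case
    by (rule exec_WhileE) (simp_all add: exec_WhileFalse.hyps)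
next
  case (exec_WhileTrue b s1 c t1 s2 t2 s3)
  from exec_WhileTrue.prems show ?case
    by (rule exec_WhileE) (auto dest: exec_WhileTrue.IH simp: exec_WhileTrue.hyps(1))
qed


section \<open>Algorithms for the partition problem\<close>

text \<open>
  An instance has vertex set \<open>{..<n}\<close>; \<open>adj\<close> holds the adjacency matrix in row-major order, the
  entry for \<open>(u, v)\<close> at index \<open>u * n + v\<close>.
\<close>

definition input_state :: "nat pair_pre_digraph \<Rightarrow> int \<Rightarrow> int \<Rightarrow> state" where
  "input_state G p q =
     (let n = card (pverts G) in
      (\<lambda>_ _. 0)
        (''n'' := (\<lambda>_. 0)(0 := int n),
         ''p'' := (\<lambda>_. 0)(0 := p),
         ''q'' := (\<lambda>_. 0)(0 := q),
         ''adj'' := (\<lambda>i. if 0 \<le> i \<and> (nat i div n, nat i mod n) \<in> parcs G then 1 else 0)))"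

lemma input_state_adj:
  assumes "pverts G = {..<n}" "v < n"
  shows "input_state G p q ''adj'' (int (u * n + v)) = (if (u, v) \<in> parcs G then 1 else 0)"
  using assms by (simp add: input_state_def flip: of_nat_mult of_nat_add)

text \<open>
  The program answers in the scalar \<open>found\<close>. A partition is returned in the array \<open>cluster\<close>, which
  assigns a label to each vertex; the blocks are the sets of equally labelled vertices.
\<close>

definition output_partition :: "nat pair_pre_digraph \<Rightarrow> state \<Rightarrow> nat set set" where
  "output_partition G s =
     (\<lambda>v. {u \<in> pverts G. s ''cluster'' (int u) = s ''cluster'' (int v)}) ` pverts G"

definition correct_output ::
    "(nat pair_pre_digraph \<Rightarrow> nat set \<Rightarrow> nat) \<Rightarrow> int \<Rightarrow> int \<Rightarrow> nat pair_pre_digraph \<Rightarrow> state \<Rightarrow> bool" where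
  "correct_output \<mu> p q G s \<longleftrightarrow>
     (if \<exists>P. is_cluster_partition \<mu> p q G P
      then s ''found'' 0 = 1 \<and> is_cluster_partition \<mu> p q G (output_partition G s)
      else s ''found'' 0 = 0)"

definition solves_partition_in_time ::
    "(nat pair_pre_digraph \<Rightarrow> nat set \<Rightarrow> nat) \<Rightarrow> com \<Rightarrow> (nat \<Rightarrow> int \<Rightarrow> nat) \<Rightarrow> bool" where
  "solves_partition_in_time \<mu> c T \<longleftrightarrow>
     (\<forall>G n p q. pair_graph G \<and> pverts G = {..<n} \<longrightarrow>
        (\<exists>t s. exec c (input_state G p q) t s \<and> t \<le> T n p \<and> correct_output \<mu> p q G s))"

text \<open>
  The bound \<open>2\<^bsup>O(p)\<^esup> n\<^bsup>O(1)\<^esup>\<close>. For \<open>n = 0\<close>, \<open>p = 0\<close> and negative \<open>p\<close> it has to leave room for the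
  constant number of steps any program takes, hence \<open>n + 1\<close> and the truncation of \<open>p\<close>.
\<close>

definition single_exp_bound :: "nat \<Rightarrow> nat \<Rightarrow> int \<Rightarrow> nat" where
  "single_exp_bound k n p = k * 2 ^ (k * nat p) * (n + 1) ^ k"

end

theory Submission
  imports Defs "HOL-Algebra.Algebraic_Closure_Type" "HOL-Library.Z2"
begin

text \<open>
  All three measures are monotone, so by posimodularity of the boundary a family of clusters covering
  the vertices can be made disjoint, one pair at a time; hence it suffices to find for each vertex \<open>v\<close>
  some cluster \<open>C\<close> containing it. If \<open>{v}\<close> is not a cluster, then fewer than \<open>card (C - {v})\<close> edges
  lead from \<open>C - {v}\<close> out of \<open>C\<close>, because in a simple graph \<open>v\<close> sends at most that many edges into \<open>C\<close>.

  If \<open>C\<close> has at most \<open>4 * p\<close> vertices, then \<open>C - {v}\<close> and its outer neighbourhood together have at most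
  \<open>8 * p\<close> vertices. In a \<open>0\<close>-\<open>1\<close>-colouring separating the two sets, \<open>C - {v}\<close> is a union of components
  of the vertices coloured \<open>1\<close>, and a subset sum computation finds a union of components with
  the same size, edge counts and degree threshold. If \<open>C\<close> is larger, some \<open>u\<close> in \<open>C\<close> has no neighbours
  outside \<open>C\<close>, and apart from at most one vertex those adjacent to all but \<open>p\<close> vertices of
  the closed neighbourhood of \<open>u\<close> belong to \<open>C\<close>; again a colouring singles out the right ones.

  It remains to enumerate colourings that show every pattern on every set of \<open>8 * p + 2\<close> vertices.
  The \<open>2\<^bsup>O(p)\<^esup> n\<^bsup>O(1)\<^esup>\<close> binary sequences given by all linear recurrences of order
  \<open>t\<close> with \<open>2 ^ (8 * p + 2) * n < 2 ^ t\<close> have this property.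
\<close>

section \<open>Universal colourings from linear recurrences\<close>

text \<open>Deciding which vertices belong to \<open>C\<close> cannot be left to random colours, so
  a deterministic list of colourings is needed whose length is single exponential in
  \<open>p\<close>. Linear recurrences give one that the machine can produce: a seed consists of
  \<open>t\<close> initial bits and \<open>t\<close> feedback bits, and the sequence needs only
  additions modulo 2. Finite fields occur in the existence argument alone; the program never
  computes in them. As \<open>2 ^ t\<close> is of the order of \<open>2 ^ (8 * p) * n\<close>, the
  number \<open>2 ^ (2 * t)\<close> of seeds stays within the bound. The vertex \<open>v\<close> is
  kept out of the colouring because its own edges out of \<open>C\<close> are not controlled; only
  those of \<open>C - {v}\<close> are few. The subset sum computation usually returns a set
  different from \<open>C\<close>. This is harmless for size and number of nonedges, which are
  determined by additive counts. A bound on the nonneighbours of every single vertex is not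
  additive; it is imposed by guessing the minimum degree inside \<open>C\<close> and discarding
  every component that violates it.\<close>

lemma linear_functional_exists:
  fixes z :: "nat \<Rightarrow> 'a::field" and \<pi> :: "nat \<Rightarrow> bit"
  assumes char: "(1::'a) + 1 = 0"
    and fin: "finite S"
    and indep: "\<And>T. T \<subseteq> S \<Longrightarrow> T \<noteq> {} \<Longrightarrow> (\<Sum>i\<in>T. z i) \<noteq> 0"
  obtains \<phi> :: "'a \<Rightarrow> bit"
  where "\<And>x y. \<phi> (x + y) = \<phi> x + \<phi> y" "\<And>i. i \<in> S \<Longrightarrow> \<phi> (z i) = \<pi> i"
proof -
  have dbl: "x + x = 0" for x :: 'a
    using char by (metis distrib_left mult.right_neutral mult_zero_right)
  \<comment> \<open>In characteristic two \<open>bit\<close> acts on the field by scalars;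
    additivity in the scalar, in the case \<open>1 + 1\<close>, is exactly
    \<open>dbl\<close>.\<close>
  define sc where "sc = (\<lambda>(b::bit) (x::'a). if b = 1 then x else 0)"
  interpret V: vector_space_pair sc "(*) :: bit \<Rightarrow> bit \<Rightarrow> bit"
  proof unfold_locales
    fix a b :: bit and x y :: 'a
    show "sc a (x + y) = sc a x + sc a y" by (simp add: sc_def)
    show "sc (a + b) x = sc a x + sc b x" by (cases a; cases b) (simp_all add: sc_def dbl)
    show "sc a (sc b x) = sc (a * b) x" by (cases a; cases b) (simp_all add: sc_def)
    show "sc 1 x = x" by (simp add: sc_def)
    show "a * (x + y) = a * x + a * y" "(a + b) * x = a * x + b * x" "a * (b * x) = (a * b) * x" "1 * x = x" for x y :: bit
      by (rule distrib_left distrib_right mult.assoc[symmetric] mult_1_left)+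
  qed
  have inj: "inj_on z S"
  proof (rule inj_onI, rule ccontr)
    fix i j assume ij: "i \<in> S" "j \<in> S" "z i = z j" "i \<noteq> j"
    then have "(\<Sum>i\<in>{i, j}. z i) = 0" using dbl by simp
    with indep[of "{i, j}"] ij show False by auto
  qed
  \<comment> \<open>Coefficients in \<open>bit\<close> merely select a subset, so independence
    amounts to the absence of vanishing nonempty subset sums.\<close>
  have "V.vs1.independent (z ` S)"
  proof (rule V.vs1.independent_if_scalars_zero)
    show "finite (z ` S)" using fin by simp
    fix f x assume s0: "(\<Sum>x\<in>z ` S. sc (f x) x) = 0" and x: "x \<in> z ` S"
    let ?T = "{i \<in> S. f (z i) = 1}"
    have "0 = (\<Sum>i\<in>S. sc (f (z i)) (z i))"
      using s0 inj by (simp add: sum.reindex)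
    also have "\<dots> = (\<Sum>i\<in>?T. z i)"
      unfolding sum.inter_filter[OF fin] by (simp add: sc_def)
    finally have "?T = {}" using indep[of ?T] by (metis (no_types, lifting) mem_Collect_eq subsetI)
    with x show "f x = 0" by auto
  qed
  then obtain g where g: "Vector_Spaces.linear sc (*) g" "\<forall>x\<in>z ` S. g x = \<pi> (inv_into S z x)"
    using V.linear_independent_extend[of "z ` S" "\<lambda>x. \<pi> (inv_into S z x)"] by blast
  show ?thesis
  proof (rule that[of g])
    show "g (x + y) = g x + g y" for x y
      using g(1) by (simp add: V.linear_add)
    show "g (z i) = \<pi> i" if "i \<in> S" for i
      using g(2) that inj by simp
  qed
qed

text \<open>The witness is the sequence of the powers of an element of the field of order \<open>2 ^ t\<close> under
  a linear functional; the roots of at most \<open>2 ^ card S\<close> polynomials have to be avoided.\<close>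

theorem linear_recurrence_universal:
  fixes \<pi> :: "nat \<Rightarrow> bit"
  assumes S: "S \<subseteq> {..<n}" and t0: "0 < t" and t: "2 ^ card S * n < 2 ^ t"
  obtains f r :: "nat \<Rightarrow> bit"
  where "\<And>i. r (i + t) = (\<Sum>j<t. f j * r (i + j))" "\<And>i. i \<in> S \<Longrightarrow> r i = \<pi> i"
proof -
  have finS: "finite S" using S finite_subset by auto
  have char: "(1::bit alg_closure) + 1 = 0"
    by (metis to_ac_1 to_ac_add to_ac_0 bit_2_eq_0 one_add_one)
  have dbl: "x + x = 0" for x :: "bit alg_closure"
    using char by (metis distrib_left mult.right_neutral mult_zero_right)
  have sq: "(x + y)\<^sup>2 = x\<^sup>2 + y\<^sup>2" for x y :: "bit alg_closure"
  proof -
    have "(x + y)\<^sup>2 = x\<^sup>2 + y\<^sup>2 + (x * y + x * y)"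
      unfolding power2_eq_square by (simp only: distrib_left distrib_right mult.commute[of y x] add_ac)
    then show ?thesis by (simp only: dbl add_0_right)
  qed
  have frob: "(x + y) ^ 2 ^ m = x ^ 2 ^ m + y ^ 2 ^ m" for x y :: "bit alg_closure" and m
  proof (induction m)
    case (Suc m)
    have "(x + y) ^ 2 ^ Suc m = ((x + y) ^ 2 ^ m)\<^sup>2"
      by (simp only: power_mult[symmetric] power_Suc2)
    also have "\<dots> = (x ^ 2 ^ m)\<^sup>2 + (y ^ 2 ^ m)\<^sup>2"
      by (simp only: Suc.IH sq)
    finally show ?case by (simp only: power_mult[symmetric] power_Suc2)
  qed simp
  \<comment> \<open>The fixed points of the \<open>t\<close>-fold Frobenius map in the algebraic
    closure; \<open>frob\<close> makes them closed under addition.\<close>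
  define F where "F = {x :: bit alg_closure. x ^ 2 ^ t = x}"
  have "finite F" and cardF: "card F = 2 ^ t"
  proof -
    \<comment> \<open>The derivative of \<open>P\<close> is a nonzero constant, so \<open>P\<close>
      has no multiple roots and as many distinct roots as its degree.\<close>
    define P where "P = monom 1 (2 ^ t) - [:0, 1 :: bit alg_closure:]"
    have two: "(2::nat) \<le> 2 ^ t" using t0 by (cases t) auto
    have deg: "Polynomial.degree P = 2 ^ t"
    proof -
      have "Polynomial.degree [:0, 1 :: bit alg_closure:] < Polynomial.degree (monom (1::bit alg_closure) (2 ^ t))"
        using two by (simp add: degree_monom_eq)
      then show ?thesis
        using degree_add_eq_left[of "- [:0, 1 :: bit alg_closure:]" "monom 1 (2 ^ t)"]
        unfolding P_def diff_conv_add_uminus by (simp only: degree_minus degree_monom_eq[OF one_neq_zero])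
    qed
    have P0: "P \<noteq> 0" using deg two by auto
    have F: "F = {x. poly P x = 0}" by (simp add: F_def P_def poly_monom)
    show "finite F" unfolding F by (rule poly_roots_finite[OF P0])
    have "of_nat (2 ^ t) = (0 :: bit alg_closure)"
    proof -
      have "(2 :: bit alg_closure) = 0" using dbl[of 1] by (simp only: one_add_one)
      then show ?thesis using t0 by (simp only: of_nat_power of_nat_numeral power_0_left) simp
    qed
    then have dP: "pderiv P = [:-1:]"
      by (simp add: P_def pderiv_diff pderiv_monom pderiv_pCons del: of_nat_power)
    have order: "order a P \<le> 1" for a
    proof (rule ccontr)
      assume "\<not> order a P \<le> 1"
      then have "[:-a, 1:] ^ 2 dvd P" using P0 by (simp add: order_divides)
      then obtain q where "P = [:-a, 1:] * ([:-a, 1:] * q)"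
        unfolding power2_eq_square mult.assoc dvd_def by blast
      then have "poly (pderiv P) a = 0" by (simp add: pderiv_mult del: mult_pCons_left)
      then show False by (simp add: dP)
    qed
    obtain A where A: "size A = Polynomial.degree P" "P = smult (lead_coeff P) (\<Prod>x\<in>#A. [:-x, 1:])"
      using alg_closed_imp_factorization[OF P0] by blast
    have "proots (\<Prod>x\<in>#A. [:-x, 1:]) = A"
    proof (induction A)
      case (add x A)
      have "(\<Prod>x\<in>#A. [:-x, 1:]) \<noteq> 0" by (auto simp: prod_mset_zero_iff)
      then show ?case using add by (simp add: proots_mult del: mult_pCons_left)
    qed simp
    then have pA: "proots P = A" using P0 by (subst A(2)) simp
    have "proots P = mset_set (set_mset (proots P))"
    proof (rule multiset_eqI)
      fix a
      have "order a P = 0 \<or> order a P = 1" using order[of a] by linarith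
      then show "count (proots P) a = count (mset_set (set_mset (proots P))) a"
        by (metis P0 count_mset_set(1,3) count_proots finite_set_mset count_eq_zero_iff zero_neq_one)
    qed
    then have "size (proots P) = card {x. poly P x = 0}"
      using P0 by (metis set_count_proots size_mset_set)
    then show "card F = 2 ^ t" using A(1) pA deg F by simp
  qed
  define h where "h T = (\<Sum>i\<in>T. monom 1 i :: bit alg_closure poly)" for T
  have coeff_h: "Polynomial.coeff (h T) i = (if i \<in> T then 1 else 0)" if "finite T" for T i
    using that by (simp add: h_def coeff_sum)
  \<comment> \<open>Union bound: each nonempty \<open>T\<close> excludes at most \<open>n\<close>
    elements, the roots of \<open>h T\<close>, and \<open>2 ^ card S * n < 2 ^ t\<close> leaves one
    over.\<close>
  have "\<exists>x\<in>F. \<forall>T. T \<subseteq> S \<longrightarrow> T \<noteq> {} \<longrightarrow> (\<Sum>i\<in>T. x ^ i) \<noteq> 0"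
  proof (rule ccontr)
    assume "\<not> ?thesis"
    then have cover: "F \<subseteq> (\<Union>T\<in>Pow S - {{}}. {x. poly (h T) x = 0})"
      by (force simp: h_def poly_sum poly_monom)
    have roots: "finite {x. poly (h T) x = 0}" "card {x. poly (h T) x = 0} \<le> n" if T: "T \<subseteq> S" "T \<noteq> {}" for T
    proof -
      have finT: "finite T" using T(1) finS finite_subset by blast
      have "h T \<noteq> 0"
        using coeff_h[OF finT] T(2) by (metis coeff_0 ex_in_conv zero_neq_one)
      moreover have "Polynomial.degree (h T) \<le> n"
        using T(1) S by (intro degree_le) (auto simp: coeff_h[OF finT])
      ultimately show "finite {x. poly (h T) x = 0}" "card {x. poly (h T) x = 0} \<le> n"
        using poly_roots_finite[of "h T"] card_poly_roots_bound[of "h T"] by auto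
    qed
    have "2 ^ t \<le> card (\<Union>T\<in>Pow S - {{}}. {x. poly (h T) x = 0})"
      unfolding cardF[symmetric] using cover finS roots by (intro card_mono) auto
    also have "\<dots> \<le> (\<Sum>T\<in>Pow S - {{}}. card {x. poly (h T) x = 0})"
      using finS by (intro card_UN_le) auto
    also have "\<dots> \<le> (\<Sum>T\<in>Pow S - {{}}. n)"
      using roots by (intro sum_mono) auto
    also have "\<dots> \<le> 2 ^ card S * n"
      using finS by (auto simp: card_Diff_subset card_Pow intro!: mult_right_mono)
    finally show False using t by simp
  qed
  then obtain x where x: "x \<in> F" "\<And>T. T \<subseteq> S \<Longrightarrow> T \<noteq> {} \<Longrightarrow> (\<Sum>i\<in>T. x ^ i) \<noteq> 0" by blast
  \<comment> \<open>Pigeonhole: the \<open>t + 1\<close> powers up to exponent \<open>t\<close> have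
    \<open>2 ^ (t + 1)\<close> subset sums in \<open>F\<close>. Two equal ones differ by a relation
    among the powers, supported on the symmetric difference \<open>D\<close>.\<close>
  have "\<exists>f::nat \<Rightarrow> bit. x ^ t = (\<Sum>j<t. if f j = 1 then x ^ j else 0)"
  proof -
    have F_add: "a + b \<in> F" if "a \<in> F" "b \<in> F" for a b
      using that by (simp add: F_def frob)
    have F_pow: "x ^ i \<in> F" for i
      using x(1) unfolding F_def by (simp add: mult.commute[of i] flip: power_mult) (simp add: power_mult)
    have "0 \<in> F" by (simp add: F_def)
    have F_sum: "(\<Sum>j\<in>J. x ^ j) \<in> F" if "finite J" for J
      using that by induction (auto intro: F_add F_pow \<open>0 \<in> F\<close>)
    have "\<not> inj_on (\<lambda>J. \<Sum>j\<in>J. x ^ j) (Pow {..t})"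
    proof
      assume "inj_on (\<lambda>J. \<Sum>j\<in>J. x ^ j) (Pow {..t})"
      then have "card (Pow {..t}) \<le> card F"
      proof (rule card_inj_on_le[OF _ _ \<open>finite F\<close>])
        show "(\<lambda>J. \<Sum>j\<in>J. x ^ j) ` Pow {..t} \<subseteq> F"
          using F_sum finite_subset[of _ "{..t}"] by blast
      qed
      then show False by (simp add: cardF card_Pow)
    qed
    then obtain J J' where J: "J \<subseteq> {..t}" "J' \<subseteq> {..t}" "J \<noteq> J'" "(\<Sum>j\<in>J. x ^ j) = (\<Sum>j\<in>J'. x ^ j)"
      by (auto simp: inj_on_def)
    define D where "D = sym_diff J J'"
    have fin: "finite J" "finite J'" using J finite_subset by blast+
    have "(\<Sum>j\<in>J. x ^ j) = (\<Sum>j\<in>J \<inter> J'. x ^ j) + (\<Sum>j\<in>J - J'. x ^ j)"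
      by (rule sum.Int_Diff[OF fin(1)])
    moreover have "(\<Sum>j\<in>J'. x ^ j) = (\<Sum>j\<in>J \<inter> J'. x ^ j) + (\<Sum>j\<in>J' - J. x ^ j)"
      using sum.Int_Diff[OF fin(2), of _ J] by (simp add: Int_commute)
    moreover have "(\<Sum>j\<in>D. x ^ j) = (\<Sum>j\<in>J - J'. x ^ j) + (\<Sum>j\<in>J' - J. x ^ j)"
      unfolding D_def using fin by (intro sum.union_disjoint) auto
    ultimately have "(\<Sum>j\<in>D. x ^ j) = (\<Sum>j\<in>J' - J. x ^ j) + (\<Sum>j\<in>J' - J. x ^ j)"
      using J(4) by simp
    then have D0: "(\<Sum>j\<in>D. x ^ j) = 0" by (simp only: dbl)
    have D: "D \<noteq> {}" "D \<subseteq> {..t}" "finite D" using J fin by (auto simp: D_def)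
    define d where "d = Max D"
    have d: "d \<in> D" "d \<le> t" "\<And>j. j \<in> D \<Longrightarrow> j \<le> d"
      using D by (auto simp: d_def)
    have xd: "x ^ d = (\<Sum>j\<in>D - {d}. x ^ j)"
      using D0 dbl[of "x ^ d"] by (metis add_left_cancel sum.remove[OF D(3) d(1)])
    \<comment> \<open>The relation may have a leading exponent \<open>d\<close> below
      \<open>t\<close>; multiplying it by \<open>x ^ (t - d)\<close> yields a recurrence of order
      exactly \<open>t\<close>.\<close>
    define E where "E = (\<lambda>j. j + (t - d)) ` (D - {d})"
    have E: "E \<subseteq> {..<t}" using d by (fastforce simp: E_def)
    have "x ^ t = x ^ d * x ^ (t - d)" using d(2) by (simp flip: power_add)
    also have "\<dots> = (\<Sum>j\<in>D - {d}. x ^ (j + (t - d)))"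
      by (simp add: xd sum_distrib_right power_add)
    also have "\<dots> = (\<Sum>j\<in>E. x ^ j)"
      unfolding E_def by (subst sum.reindex) (auto simp: inj_on_def)
    also have "\<dots> = (\<Sum>j<t. if (if j \<in> E then 1 else 0 :: bit) = 1 then x ^ j else 0)"
      using E by (simp add: sum.If_cases Int_absorb1)
    finally show ?thesis by (intro exI[of _ "\<lambda>j. if j \<in> E then 1 else 0"])
  qed
  then obtain f :: "nat \<Rightarrow> bit" where f: "x ^ t = (\<Sum>j<t. if f j = 1 then x ^ j else 0)" by blast
  obtain \<phi> :: "bit alg_closure \<Rightarrow> bit" where \<phi>: "\<And>x y. \<phi> (x + y) = \<phi> x + \<phi> y" "\<And>i. i \<in> S \<Longrightarrow> \<phi> (x ^ i) = \<pi> i"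
    using linear_functional_exists[OF char finS x(2)] by metis
  have \<phi>0: "\<phi> 0 = 0" using \<phi>(1)[of 0 0] by (cases "\<phi> 0") auto
  have \<phi>sum: "\<phi> (\<Sum>j\<in>J. g j) = (\<Sum>j\<in>J. \<phi> (g j))" if "finite J" for g and J :: "nat set"
    using that by induction (auto simp: \<phi> \<phi>0)
  show ?thesis
  \<comment> \<open>The relation for \<open>x ^ t\<close>, multiplied by \<open>x ^ i\<close> and
    mapped by \<open>\<phi>\<close>, is the recurrence.\<close>
  proof (rule that[of "\<lambda>i. \<phi> (x ^ i)" f])
    fix i
    have "x ^ (i + t) = (\<Sum>j<t. if f j = 1 then x ^ (i + j) else 0)"
      by (simp add: power_add f sum_distrib_left if_distrib cong: if_cong)
    then have "\<phi> (x ^ (i + t)) = (\<Sum>j<t. \<phi> (if f j = 1 then x ^ (i + j) else 0))"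
      by (simp add: \<phi>sum)
    also have "\<dots> = (\<Sum>j<t. f j * \<phi> (x ^ (i + j)))"
      by (rule sum.cong) (auto simp: \<phi>0)
    finally show "\<phi> (x ^ (i + t)) = (\<Sum>j<t. f j * \<phi> (x ^ (i + j)))" .
  qed (use \<phi> in auto)
qed

section \<open>A structured language and its compilation\<close>

text \<open>All iteration is bounded by a scalar, so evaluation is a total function and a time bound
  can be read off the syntax. Truth values are integers, positive meaning true. \<open>ESum\<close>
  lets counting conditions be written as expressions without side effects on the program's
  arrays.\<close>

datatype ex =
    EN int
  | EV vname
  | ER vname ex
  | EP ex ex
  | EM ex ex
  | ELt ex ex
  | EIf ex ex ex
  | ESum vname vname ex

primrec eval :: "ex \<Rightarrow> (vname \<Rightarrow> int) \<Rightarrow> state \<Rightarrow> int" where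
  "eval (EN k) \<rho> s = k"
| "eval (EV x) \<rho> s = \<rho> x"
| "eval (ER a i) \<rho> s = s a (eval i \<rho> s)"
| "eval (EP a b) \<rho> s = eval a \<rho> s + eval b \<rho> s"
| "eval (EM a b) \<rho> s = eval a \<rho> s - eval b \<rho> s"
| "eval (ELt a b) \<rho> s = (if eval a \<rho> s < eval b \<rho> s then 1 else 0)"
| "eval (EIf c a b) \<rho> s = (if 0 < eval c \<rho> s then eval a \<rho> s else eval b \<rho> s)"
| "eval (ESum x k e) \<rho> s = (\<Sum>i<nat (s k 0). eval e (\<rho>(x := int i)) s)"

datatype cmd =
    CAssign vname ex ex
  | CSeq cmd cmd
  | CIf ex cmd cmd
  | CFor vname vname cmd
  | CSkip

primrec loop :: "(nat \<Rightarrow> state \<Rightarrow> state) \<Rightarrow> nat \<Rightarrow> state \<Rightarrow> state" where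
  "loop f 0 s = s"
| "loop f (Suc m) s = f m (loop f m s)"

primrec sem :: "cmd \<Rightarrow> (vname \<Rightarrow> int) \<Rightarrow> state \<Rightarrow> state" where
  "sem (CAssign a i e) \<rho> s = s(a := (s a)(eval i \<rho> s := eval e \<rho> s))"
| "sem (CSeq c d) \<rho> s = sem d \<rho> (sem c \<rho> s)"
| "sem (CIf e c d) \<rho> s = (if 0 < eval e \<rho> s then sem c \<rho> s else sem d \<rho> s)"
| "sem (CFor x k c) \<rho> s = loop (\<lambda>i. sem c (\<rho>(x := int i))) (nat (s k 0)) s"
| "sem CSkip \<rho> s = s"

text \<open>Arrays whose names begin with a reserved character hold the loop variables and
  the evaluation stack of the compiled program.\<close>

definition plain :: "vname \<Rightarrow> bool" where
  "plain x \<longleftrightarrow> (case x of [] \<Rightarrow> True | c # _ \<Rightarrow> c \<noteq> CHR ''%'' \<and> c \<noteq> CHR ''$'')"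

primrec bounds_ex :: "ex \<Rightarrow> vname set" where
  "bounds_ex (EN k) = {}"
| "bounds_ex (EV x) = {}"
| "bounds_ex (ER a i) = bounds_ex i"
| "bounds_ex (EP a b) = bounds_ex a \<union> bounds_ex b"
| "bounds_ex (EM a b) = bounds_ex a \<union> bounds_ex b"
| "bounds_ex (ELt a b) = bounds_ex a \<union> bounds_ex b"
| "bounds_ex (EIf c a b) = bounds_ex c \<union> bounds_ex a \<union> bounds_ex b"
| "bounds_ex (ESum x k e) = insert k (bounds_ex e)"

primrec plain_ex :: "ex \<Rightarrow> bool" where
  "plain_ex (EN k) = True"
| "plain_ex (EV x) = True"
| "plain_ex (ER a i) = (plain a \<and> plain_ex i)"
| "plain_ex (EP a b) = (plain_ex a \<and> plain_ex b)"
| "plain_ex (EM a b) = (plain_ex a \<and> plain_ex b)"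
| "plain_ex (ELt a b) = (plain_ex a \<and> plain_ex b)"
| "plain_ex (EIf c a b) = (plain_ex c \<and> plain_ex a \<and> plain_ex b)"
| "plain_ex (ESum x k e) = (plain k \<and> plain_ex e)"

primrec bounds :: "cmd \<Rightarrow> vname set" where
  "bounds (CAssign a i e) = bounds_ex i \<union> bounds_ex e"
| "bounds (CSeq c d) = bounds c \<union> bounds d"
| "bounds (CIf e c d) = bounds_ex e \<union> bounds c \<union> bounds d"
| "bounds (CFor x k c) = insert k (bounds c)"
| "bounds CSkip = {}"

primrec plain_cmd :: "cmd \<Rightarrow> bool" where
  "plain_cmd (CAssign a i e) = (plain a \<and> plain_ex i \<and> plain_ex e)"
| "plain_cmd (CSeq c d) = (plain_cmd c \<and> plain_cmd d)"
| "plain_cmd (CIf e c d) = (plain_ex e \<and> plain_cmd c \<and> plain_cmd d)"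
| "plain_cmd (CFor x k c) = (plain k \<and> plain_cmd c)"
| "plain_cmd CSkip = True"

primrec writes :: "cmd \<Rightarrow> vname set" where
  "writes (CAssign a i e) = {a}"
| "writes (CSeq c d) = writes c \<union> writes d"
| "writes (CIf e c d) = writes c \<union> writes d"
| "writes (CFor x k c) = writes c"
| "writes CSkip = {}"

lemma loop_frame:
  assumes "\<And>i s. i < m \<Longrightarrow> f i s x = s x"
  shows "loop f m s x = s x"
  using assms by (induction m) auto

lemma sem_frame: "x \<notin> writes c \<Longrightarrow> sem c \<rho> s x = s x"
  by (induction c arbitrary: \<rho> s) (auto intro: loop_frame)

lemma loop_invariant:
  assumes "P 0 s" "\<And>i u. i < m \<Longrightarrow> P i u \<Longrightarrow> P (Suc i) (f i u)"
  shows "P m (loop f m s)"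
proof -
  have "j \<le> m \<Longrightarrow> P j (loop f j s)" for j
    by (induction j) (auto simp: assms)
  then show ?thesis by simp
qed

section \<open>Compilation to the random access machine and its cost\<close>

abbreviation stack :: "int \<Rightarrow> aexp" where
  "stack d \<equiv> Read ''$'' (N d)"

abbreviation push :: "int \<Rightarrow> aexp \<Rightarrow> com" where
  "push d a \<equiv> Write ''$'' (N d) a"

abbreviation lvar :: "vname \<Rightarrow> vname" where
  "lvar x \<equiv> CHR ''%'' # x"

text \<open>The value is left in stack cell \<open>d\<close> and the cells below \<open>d\<close>
  are preserved. For \<open>ESum\<close>, cell \<open>d\<close> accumulates the sum and cell
  \<open>d + 1\<close> saves the outer value of the loop variable, so that variable names can be
  reused in nested loops.\<close>

primrec comp_ex :: "ex \<Rightarrow> int \<Rightarrow> com" where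
  "comp_ex (EN k) d = push d (N k)"
| "comp_ex (EV x) d = push d (Read (lvar x) (N 0))"
| "comp_ex (ER a i) d = Seq (comp_ex i d) (push d (Read a (stack d)))"
| "comp_ex (EP a b) d = Seq (comp_ex a d) (Seq (comp_ex b (d + 1)) (push d (Plus (stack d) (stack (d + 1)))))"
| "comp_ex (EM a b) d = Seq (comp_ex a d) (Seq (comp_ex b (d + 1)) (push d (Minus (stack d) (stack (d + 1)))))"
| "comp_ex (ELt a b) d = Seq (comp_ex a d) (Seq (comp_ex b (d + 1))
     (If (Less (stack d) (stack (d + 1))) (push d (N 1)) (push d (N 0))))"
| "comp_ex (EIf c a b) d = Seq (comp_ex c d) (If (Less (N 0) (stack d)) (comp_ex a d) (comp_ex b d))"
| "comp_ex (ESum x k e) d =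
     Seq (push d (N 0)) (Seq (push (d + 1) (Read (lvar x) (N 0))) (Seq (Write (lvar x) (N 0) (N 0))
      (Seq (While (Less (Read (lvar x) (N 0)) (Read k (N 0)))
        (Seq (comp_ex e (d + 2)) (Seq (push d (Plus (stack d) (stack (d + 2))))
          (Write (lvar x) (N 0) (Plus (Read (lvar x) (N 0)) (N 1))))))
      (Write (lvar x) (N 0) (stack (d + 1))))))"

primrec comp_cmd :: "cmd \<Rightarrow> int \<Rightarrow> com" where
  "comp_cmd (CAssign a i e) d = Seq (comp_ex i d) (Seq (comp_ex e (d + 1)) (Write a (stack d) (stack (d + 1))))"
| "comp_cmd (CSeq c c') d = Seq (comp_cmd c d) (comp_cmd c' d)"
| "comp_cmd (CIf e c c') d = Seq (comp_ex e d) (If (Less (N 0) (stack d)) (comp_cmd c d) (comp_cmd c' d))"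
| "comp_cmd (CFor x k c) d =
     Seq (push d (Read (lvar x) (N 0))) (Seq (Write (lvar x) (N 0) (N 0))
      (Seq (While (Less (Read (lvar x) (N 0)) (Read k (N 0)))
        (Seq (comp_cmd c (d + 1)) (Write (lvar x) (N 0) (Plus (Read (lvar x) (N 0)) (N 1)))))
      (Write (lvar x) (N 0) (stack d))))"
| "comp_cmd CSkip d = Skip"

text \<open>\<open>B k\<close> bounds the loop bound held in \<open>k\<close>. A conditional is
  charged for both branches, and the constants are generous, which keeps the bound a plain sum and
  product.\<close>

primrec time_ex :: "ex \<Rightarrow> (vname \<Rightarrow> nat) \<Rightarrow> nat" where
  "time_ex (EN k) B = 9"
| "time_ex (EV x) B = 9"
| "time_ex (ER a i) B = 9 + time_ex i B"
| "time_ex (EP a b) B = 9 + (time_ex a B + time_ex b B)"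
| "time_ex (EM a b) B = 9 + (time_ex a B + time_ex b B)"
| "time_ex (ELt a b) B = 20 + (time_ex a B + time_ex b B)"
| "time_ex (EIf c a b) B = 9 + (time_ex c B + (time_ex a B + time_ex b B))"
| "time_ex (ESum x k e) B = 30 + B k * (30 + time_ex e B)"

primrec time_cmd :: "cmd \<Rightarrow> (vname \<Rightarrow> nat) \<Rightarrow> nat" where
  "time_cmd (CAssign a i e) B = 9 + (time_ex i B + time_ex e B)"
| "time_cmd (CSeq c d) B = time_cmd c B + time_cmd d B"
| "time_cmd (CIf e c d) B = 9 + (time_ex e B + (time_cmd c B + time_cmd d B))"
| "time_cmd (CFor x k c) B = 30 + B k * (30 + time_cmd c B)"
| "time_cmd CSkip B = 9"

definition simulates :: "(vname \<Rightarrow> int) \<Rightarrow> state \<Rightarrow> state \<Rightarrow> bool" where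
  "simulates \<rho> S s \<longleftrightarrow> (\<forall>x. plain x \<longrightarrow> s x = S x) \<and> (\<forall>x. s (lvar x) 0 = \<rho> x)"

definition keeps :: "int \<Rightarrow> state \<Rightarrow> state \<Rightarrow> bool" where
  "keeps d s s' \<longleftrightarrow> (\<forall>j<d. s' ''$'' j = s ''$'' j)"

definition runs :: "com \<Rightarrow> state \<Rightarrow> nat \<Rightarrow> (state \<Rightarrow> bool) \<Rightarrow> bool" where
  "runs c s T Q \<longleftrightarrow> (\<exists>t s'. exec c s t s' \<and> t \<le> T \<and> Q s')"

lemma runs_Skip: "1 \<le> T \<Longrightarrow> Q s \<Longrightarrow> runs Skip s T Q"
  unfolding runs_def by (blast intro: exec_Skip)

lemma runs_Write:
  "1 + acost i + acost a \<le> T \<Longrightarrow> Q (s(x := (s x)(aval i s := aval a s))) \<Longrightarrow> runs (Write x i a) s T Q"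
  unfolding runs_def by (blast intro: exec_Write)

lemma runs_Seq:
  assumes "runs c1 s Ta Qa" "\<And>u. Qa u \<Longrightarrow> runs c2 u Tb Q" "Ta + Tb \<le> T"
  shows "runs (Seq c1 c2) s T Q"
proof -
  obtain t u where u: "exec c1 s t u" "t \<le> Ta" "Qa u" using assms(1) by (auto simp: runs_def)
  obtain t' u' where "exec c2 u t' u'" "t' \<le> Tb" "Q u'" using assms(2)[OF u(3)] by (auto simp: runs_def)
  with u assms(3) show ?thesis unfolding runs_def
    by (intro exI[of _ "t + t'"] exI[of _ u']) (auto intro: exec_Seq)
qed

lemma runs_If:
  assumes "bval b s \<Longrightarrow> runs c1 s Ta Q" "\<not> bval b s \<Longrightarrow> runs c2 s Tb Q"
    and "1 + bcost b + max Ta Tb \<le> T"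
  shows "runs (If b c1 c2) s T Q"
proof (cases "bval b s")
  case True
  with assms(1) obtain t u where u: "exec c1 s t u" "t \<le> Ta" "Q u" by (auto simp: runs_def)
  from exec_IfTrue[OF True u(1)] u assms(3) show ?thesis unfolding runs_def
    by (intro exI[of _ "1 + bcost b + t"] exI[of _ u]) auto
next
  case False
  with assms(2) obtain t u where u: "exec c2 s t u" "t \<le> Tb" "Q u" by (auto simp: runs_def)
  from exec_IfFalse[OF False u(1)] u assms(3) show ?thesis unfolding runs_def
    by (intro exI[of _ "1 + bcost b + t"] exI[of _ u]) auto
qed

text \<open>The invariant counts completed iterations and the total \<open>m\<close> is known
  beforehand, which is enough for compiled bounded loops.\<close>

lemma runs_While:
  assumes "I 0 s" "\<And>i u. i < m \<Longrightarrow> I i u \<Longrightarrow> bval b u \<and> runs c u T (I (Suc i))"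
    and "\<And>u. I m u \<Longrightarrow> \<not> bval b u"
  shows "runs (While b c) s (1 + bcost b + m * (1 + bcost b + T)) (I m)"
proof -
  have "I i u \<Longrightarrow> i \<le> m \<Longrightarrow> runs (While b c) u (1 + bcost b + (m - i) * (1 + bcost b + T)) (I m)" for i u
  proof (induction "m - i" arbitrary: i u)
    case 0
    then have "i = m" by simp
    with 0 exec_WhileFalse[OF assms(3)[of u]] show ?case unfolding runs_def
      by (intro exI[of _ "1 + bcost b"] exI[of _ u]) auto
  next
    case (Suc k)
    then have i: "i < m" by simp
    obtain t u' where u': "bval b u" "exec c u t u'" "t \<le> T" "I (Suc i) u'"
      using assms(2)[OF i Suc.prems(1)] by (auto simp: runs_def)
    have "runs (While b c) u' (1 + bcost b + (m - Suc i) * (1 + bcost b + T)) (I m)"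
      by (rule Suc.hyps(1)) (use Suc.hyps(2) u'(4) i in auto)
    then obtain t' w where w: "exec (While b c) u' t' w" "t' \<le> 1 + bcost b + (m - Suc i) * (1 + bcost b + T)" "I m w"
      unfolding runs_def by blast
    have eq: "m - i = Suc (m - Suc i)" using i by simp
    show ?case unfolding runs_def
      using exec_WhileTrue[OF u'(1,2) w(1)] u'(3) w(2,3)
      by (intro exI[of _ "1 + bcost b + t + t'"] exI[of _ w]) (simp add: eq)
  qed
  from this[OF assms(1)] show ?thesis by simp
qed

lemma runs_weaken: "runs c s T Q \<Longrightarrow> T \<le> T' \<Longrightarrow> (\<And>u. Q u \<Longrightarrow> Q' u) \<Longrightarrow> runs c s T' Q'"
  unfolding runs_def by (meson le_trans)

lemma lvar_neq [simp]: "lvar x \<noteq> ''$''" "''$'' \<noteq> lvar x"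
  by auto

lemma plain_not [simp]: "\<not> plain (lvar x)" "\<not> plain ''$''"
  by (auto simp: plain_def)

lemma plain_neq: "plain k \<Longrightarrow> k \<noteq> ''$''" "plain k \<Longrightarrow> k \<noteq> lvar x"
  by auto

lemma simulates_stack [simp]: "simulates \<rho> S (s(''$'' := f)) \<longleftrightarrow> simulates \<rho> S s"
  by (auto simp: simulates_def plain_neq)

lemma simulates_lvar: "simulates \<rho> S s \<Longrightarrow> simulates (\<rho>(x := f 0)) S (s(lvar x := f))"
  by (auto simp: simulates_def plain_neq)

lemma comp_ex_correct:
  assumes "plain_ex e" "simulates \<rho> S s" "\<And>k. k \<in> bounds_ex e \<Longrightarrow> S k 0 \<le> int (B k)"
  shows "runs (comp_ex e d) s (time_ex e B)
    (\<lambda>s'. simulates \<rho> S s' \<and> keeps d s s' \<and> s' ''$'' d = eval e \<rho> S)"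
  using assms
proof (induction e arbitrary: \<rho> s d)
  case (EN k)
  then show ?case by (auto intro!: runs_Write simp: keeps_def)
next
  case (EV x)
  then show ?case by (auto intro!: runs_Write simp: keeps_def) (simp add: simulates_def)
next
  case (ER a i)
  show ?case
    unfolding comp_ex.simps time_ex.simps
    by (rule runs_Seq[OF ER.IH[of \<rho> s d], where Tb = 9], use ER.prems in simp_all)
      (auto intro!: runs_Write simp: keeps_def plain_neq, auto simp: simulates_def)
next
  case (EP a b)
  show ?case
    unfolding comp_ex.simps time_ex.simps
    apply (rule runs_Seq[OF EP.IH(1)[of \<rho> s d], where Tb = "time_ex b B + 9"])
    using EP.prems apply simp_all
    apply (rule runs_Seq[OF EP.IH(2)[of \<rho>], where Tb = 9])
    using EP.prems apply simp_all
    apply (rule runs_Write)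
    apply (auto simp: keeps_def)
    done
next
  case (EM a b)
  show ?case
    unfolding comp_ex.simps time_ex.simps
    apply (rule runs_Seq[OF EM.IH(1)[of \<rho> s d], where Tb = "time_ex b B + 9"])
    using EM.prems apply simp_all
    apply (rule runs_Seq[OF EM.IH(2)[of \<rho>], where Tb = 9])
    using EM.prems apply simp_all
    apply (rule runs_Write)
    apply (auto simp: keeps_def)
    done
next
  case (ELt a b)
  show ?case
    unfolding comp_ex.simps time_ex.simps
    apply (rule runs_Seq[OF ELt.IH(1)[of \<rho> s d], where Tb = "time_ex b B + 20"])
        apply (use ELt.prems in auto)[3]
     apply (rule runs_Seq[OF ELt.IH(2)[of \<rho>], where Tb = 20])
         apply (use ELt.prems in auto)[3]
      apply (rule runs_If[of _ _ _ 3 _ _ 3])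
        apply (rule runs_Write; auto simp: keeps_def simulates_def plain_neq)
       apply (rule runs_Write; auto simp: keeps_def simulates_def plain_neq)
      apply simp_all
    done
next
  case (EIf c a b)
  show ?case
    unfolding comp_ex.simps time_ex.simps
    apply (rule runs_Seq[OF EIf.IH(1)[of \<rho> s d], where Tb = "time_ex a B + time_ex b B + 9"])
        apply (use EIf.prems in auto)[3]
     apply (rule runs_If[of _ _ _ "time_ex a B" _ _ "time_ex b B"])
       apply (rule runs_weaken[OF EIf.IH(2)[of \<rho>]]; use EIf.prems in \<open>auto simp: keeps_def\<close>)
      apply (rule runs_weaken[OF EIf.IH(3)[of \<rho>]]; use EIf.prems in \<open>auto simp: keeps_def\<close>)
     apply simp_all
    done
next
  case (ESum x k e)
  define m where "m = nat (S k 0)"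
  have pk: "plain k" using ESum.prems by simp
  have mB: "m \<le> B k" using ESum.prems(3)[of k] by (simp add: m_def)
  \<comment> \<open>Before iteration \<open>i\<close>, cell \<open>d\<close> holds the partial sum
    and cell \<open>d + 1\<close> the saved value of the loop variable.\<close>
  define I where "I i u \<longleftrightarrow> simulates (\<rho>(x := int i)) S u \<and> keeps d s u \<and> u ''$'' (d + 1) = \<rho> x \<and>
    u ''$'' d = (\<Sum>i<i. eval e (\<rho>(x := int i)) S)" for i u
  have body: "bval (Less (Read (lvar x) (N 0)) (Read k (N 0))) u \<and>
     runs (Seq (comp_ex e (d + 2)) (Seq (push d (Plus (stack d) (stack (d + 2))))
          (Write (lvar x) (N 0) (Plus (Read (lvar x) (N 0)) (N 1))))) u (time_ex e B + 20) (I (Suc i))"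
    if i: "i < m" and u: "I i u" for i u
  proof
    have "u (lvar x) 0 = int i" "u k = S k" using u pk by (auto simp: I_def simulates_def)
    then show "bval (Less (Read (lvar x) (N 0)) (Read k (N 0))) u" using i by (simp add: m_def)
    show "runs (Seq (comp_ex e (d + 2)) (Seq (push d (Plus (stack d) (stack (d + 2))))
          (Write (lvar x) (N 0) (Plus (Read (lvar x) (N 0)) (N 1))))) u (time_ex e B + 20) (I (Suc i))"
    proof (rule runs_Seq[of _ _ "time_ex e B" _ _ 20])
      show "runs (comp_ex e (d + 2)) u (time_ex e B)
         (\<lambda>s'. simulates (\<rho>(x := int i)) S s' \<and> keeps (d + 2) u s' \<and> s' ''$'' (d + 2) = eval e (\<rho>(x := int i)) S)"
      proof (rule ESum.IH[of "\<rho>(x := int i)"])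
        show "simulates (\<rho>(x := int i)) S u" using u by (simp only: I_def)
      qed (use ESum.prems in auto)
      fix w assume w: "simulates (\<rho>(x := int i)) S w \<and> keeps (d + 2) u w \<and> w ''$'' (d + 2) = eval e (\<rho>(x := int i)) S"
      have wx: "w (lvar x) 0 = int i" using w by (simp add: simulates_def)
      have "simulates (\<rho>(x := int (Suc i))) S (w(lvar x := (w (lvar x))(0 := int (Suc i))))"
        using simulates_lvar[of "\<rho>(x := int i)" S w x "(w (lvar x))(0 := int (Suc i))"] w by simp
      then have sim: "simulates (\<rho>(x := 1 + int i)) S (w(lvar x := (w (lvar x))(0 := 1 + int i)))" by simp
      have ws: "w ''$'' d = u ''$'' d" "w ''$'' (d + 1) = u ''$'' (d + 1)" "\<And>j. j < d \<Longrightarrow> w ''$'' j = u ''$'' j"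
        using w by (auto simp: keeps_def)
      show "runs (Seq (push d (Plus (stack d) (stack (d + 2))))
          (Write (lvar x) (N 0) (Plus (Read (lvar x) (N 0)) (N 1)))) w 20 (I (Suc i))"
        apply (rule runs_Seq[of _ _ 7 "\<lambda>w'. w' = w(''$'' := (w ''$'')(d := w ''$'' d + w ''$'' (d + 2)))" _ 9])
          apply (rule runs_Write; simp)
         apply (rule runs_Write)
          apply simp
        using u w wx ws sim by (auto simp: I_def keeps_def fun_upd_twist[of "''$''"] add.commute)
    qed simp
  qed
  have fin: "\<not> bval (Less (Read (lvar x) (N 0)) (Read k (N 0))) u" if "I m u" for u
  proof -
    have "u (lvar x) 0 = int m" "u k = S k" using that pk by (auto simp: I_def simulates_def)
    then show ?thesis by (simp add: m_def)
  qed
  let ?b = "Less (Read (lvar x) (N 0)) (Read k (N 0))"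
  have sx: "s (lvar x) 0 = \<rho> x" using ESum.prems by (simp add: simulates_def)
  have "simulates (\<rho>(x := 0)) S (s(lvar x := (s (lvar x))(0 := 0)))"
    using simulates_lvar[OF ESum.prems(2), of x "(s (lvar x))(0 := 0)"] by simp
  then have sim0: "simulates (\<rho>(x := 0)) S (s(''$'' := g, lvar x := (s (lvar x))(0 := 0)))" for g
    by (subst fun_upd_twist) auto
  have tm: "1 + bcost ?b + m * (1 + bcost ?b + (time_ex e B + 20)) \<le> 6 + B k * (30 + time_ex e B)"
    using mB by (auto intro!: mult_mono)
  have while: "runs (While ?b (Seq (comp_ex e (d + 2)) (Seq (push d (Plus (stack d) (stack (d + 2))))
          (Write (lvar x) (N 0) (Plus (Read (lvar x) (N 0)) (N 1)))))) w (6 + B k * (30 + time_ex e B)) (I m)"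
    if "I 0 w" for w
    by (rule runs_weaken[OF runs_While[of I, OF that body fin] tm])
  show ?case unfolding comp_ex.simps time_ex.simps
    apply (rule runs_Seq[of _ _ 3 "\<lambda>w. w = s(''$'' := (s ''$'')(d := 0))" _ "27 + B k * (30 + time_ex e B)"])
      apply (rule runs_Write; simp)
     apply (rule runs_Seq[of _ _ 4 "\<lambda>w. w = s(''$'' := (s ''$'')(d := 0, d + 1 := \<rho> x))" _ "23 + B k * (30 + time_ex e B)"])
       apply (rule runs_Write; simp add: sx)
      apply (rule runs_Seq[of _ _ 4 "I 0" _ "19 + B k * (30 + time_ex e B)"])
        apply (rule runs_Write; simp add: I_def keeps_def sim0)
       apply (rule runs_Seq[of _ _ "6 + B k * (30 + time_ex e B)" "I m" _ "6"])
         apply (erule while)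
        apply (rule runs_Write)
         apply simp
        apply (auto simp: I_def keeps_def m_def simulates_def plain_neq)
    done
qed

text \<open>\<open>sem\<close> reads a loop bound once, whereas the compiled \<open>While\<close>
  rereads it in every test. Disjointness of \<open>bounds c\<close> and \<open>writes c\<close>
  makes the two agree and keeps the estimates \<open>B\<close> valid during the whole run.\<close>

lemma comp_cmd_correct:
  assumes "plain_cmd c" "simulates \<rho> S s" "\<And>k. k \<in> bounds c \<Longrightarrow> S k 0 \<le> int (B k)"
    and "bounds c \<inter> writes c = {}"
  shows "runs (comp_cmd c d) s (time_cmd c B) (\<lambda>s'. simulates \<rho> (sem c \<rho> S) s' \<and> keeps d s s')"
  using assms
proof (induction c arbitrary: \<rho> S s d)
  case (CAssign a i e)
  show ?case unfolding comp_cmd.simps time_cmd.simps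
    apply (rule runs_Seq[OF comp_ex_correct[of i \<rho> S s B d], where Tb = "time_ex e B + 9"])
    using CAssign.prems apply simp_all
    apply (rule runs_Seq[OF comp_ex_correct[of e \<rho> S _ B "d + 1"], where Tb = 9])
    using CAssign.prems apply simp_all
    apply (rule runs_Write)
     apply (auto simp: keeps_def plain_neq)
    apply (auto simp: simulates_def)
    done
next
  case (CSeq c1 c2)
  have b: "sem c1 \<rho> S k 0 \<le> int (B k)" if "k \<in> bounds c2" for k
    using CSeq.prems that by (subst sem_frame) auto
  show ?case unfolding comp_cmd.simps time_cmd.simps
    apply (rule runs_Seq[OF CSeq.IH(1)[of \<rho> S s d]])
    using CSeq.prems apply (auto)[4]
    apply (rule runs_weaken[OF CSeq.IH(2)[of \<rho> "sem c1 \<rho> S"]])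
    using CSeq.prems b by (auto simp: keeps_def)
next
  case (CIf e c1 c2)
  show ?case unfolding comp_cmd.simps time_cmd.simps
    apply (rule runs_Seq[OF comp_ex_correct[of e \<rho> S s B d], where Tb = "time_cmd c1 B + (time_cmd c2 B + 9)"])
        apply (use CIf.prems in auto)[3]
     apply (rule runs_If[of _ _ _ "time_cmd c1 B" _ _ "time_cmd c2 B"])
      apply (rule runs_weaken[OF CIf.IH(1)[of \<rho> S]]; use CIf.prems in \<open>auto simp: keeps_def\<close>)
     apply (rule runs_weaken[OF CIf.IH(2)[of \<rho> S]]; use CIf.prems in \<open>auto simp: keeps_def\<close>)
    apply simp_all
    done
next
  case (CFor x k c)
  define m where "m = nat (S k 0)"
  let ?L = "\<lambda>i. loop (\<lambda>i. sem c (\<rho>(x := int i))) i S"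
  have pk: "plain k" and kw: "k \<notin> writes c" using CFor.prems by auto
  have mB: "m \<le> B k" using CFor.prems(3)[of k] by (simp add: m_def)
  have Lfr: "y \<notin> writes c \<Longrightarrow> ?L i y = S y" for y i
    by (rule loop_frame) (simp add: sem_frame)
  define I where "I i u \<longleftrightarrow> simulates (\<rho>(x := int i)) (?L i) u \<and> keeps d s u \<and> u ''$'' d = \<rho> x" for i u
  let ?b = "Less (Read (lvar x) (N 0)) (Read k (N 0))"
  let ?c = "Seq (comp_cmd c (d + 1)) (Write (lvar x) (N 0) (Plus (Read (lvar x) (N 0)) (N 1)))"
  have body: "bval ?b u \<and> runs ?c u (time_cmd c B + 20) (I (Suc i))"
    if i: "i < m" and u: "I i u" for i u
  proof
    have "u (lvar x) 0 = int i" "u k = S k" using u pk Lfr[OF kw] by (auto simp: I_def simulates_def)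
    then show "bval ?b u" using i by (simp add: m_def)
    show "runs ?c u (time_cmd c B + 20) (I (Suc i))"
    proof (rule runs_Seq[of _ _ "time_cmd c B" _ _ 20])
      show "runs (comp_cmd c (d + 1)) u (time_cmd c B)
         (\<lambda>s'. simulates (\<rho>(x := int i)) (?L (Suc i)) s' \<and> keeps (d + 1) u s')"
        unfolding loop.simps
      proof (rule CFor.IH[of "\<rho>(x := int i)"])
        show "simulates (\<rho>(x := int i)) (?L i) u" using u by (simp only: I_def)
        show "?L i k' 0 \<le> int (B k')" if "k' \<in> bounds c" for k'
          using CFor.prems that by (subst Lfr) auto
      qed (use CFor.prems in auto)
      fix w assume w: "simulates (\<rho>(x := int i)) (?L (Suc i)) w \<and> keeps (d + 1) u w"
      have wx: "w (lvar x) 0 = int i" using w by (simp add: simulates_def)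
      have "simulates (\<rho>(x := int (Suc i))) (?L (Suc i)) (w(lvar x := (w (lvar x))(0 := int (Suc i))))"
        using simulates_lvar[of "\<rho>(x := int i)" "?L (Suc i)" w x "(w (lvar x))(0 := int (Suc i))"] w by simp
      then show "runs (Write (lvar x) (N 0) (Plus (Read (lvar x) (N 0)) (N 1))) w 20 (I (Suc i))"
        using u w wx by (intro runs_Write) (auto simp: I_def keeps_def add.commute)
    qed simp
  qed
  have fin: "\<not> bval ?b u" if "I m u" for u
  proof -
    have "u (lvar x) 0 = int m" "u k = S k" using that pk Lfr[OF kw] by (auto simp: I_def simulates_def)
    then show ?thesis by (simp add: m_def)
  qed
  have sx: "s (lvar x) 0 = \<rho> x" using CFor.prems by (simp add: simulates_def)
  have "simulates (\<rho>(x := 0)) S (s(lvar x := (s (lvar x))(0 := 0)))"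
    using simulates_lvar[OF CFor.prems(2), of x "(s (lvar x))(0 := 0)"] by simp
  then have sim0: "simulates (\<rho>(x := 0)) S (s(''$'' := g, lvar x := (s (lvar x))(0 := 0)))" for g
    by (subst fun_upd_twist) auto
  have tm: "1 + bcost ?b + m * (1 + bcost ?b + (time_cmd c B + 20)) \<le> 6 + B k * (30 + time_cmd c B)"
    using mB by (auto intro!: mult_mono)
  have while: "runs (While ?b ?c) w (6 + B k * (30 + time_cmd c B)) (I m)" if "I 0 w" for w
    by (rule runs_weaken[OF runs_While[of I, OF that body fin] tm])
  show ?case unfolding comp_cmd.simps time_cmd.simps
    apply (rule runs_Seq[of _ _ 4 "\<lambda>w. w = s(''$'' := (s ''$'')(d := \<rho> x))" _ "23 + B k * (30 + time_cmd c B)"])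
      apply (rule runs_Write; simp add: sx)
     apply (rule runs_Seq[of _ _ 4 "I 0" _ "19 + B k * (30 + time_cmd c B)"])
       apply (rule runs_Write; simp add: I_def keeps_def sim0)
      apply (rule runs_Seq[of _ _ "6 + B k * (30 + time_cmd c B)" "I m" _ "6"])
        apply (erule while)
       apply (rule runs_Write)
        apply simp
       apply (auto simp: I_def keeps_def m_def simulates_def plain_neq)
    done
next
  case CSkip
  then show ?case by (auto intro!: runs_Skip simp: keeps_def)
qed

section \<open>Clusters in simple graphs\<close>

locale ugraph =
  fixes n :: nat and E :: "nat \<Rightarrow> nat \<Rightarrow> bool"
  assumes sym: "E x y \<Longrightarrow> E y x" and irrefl: "\<not> E x x"
begin

definition deg :: "nat set \<Rightarrow> nat \<Rightarrow> nat" where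
  "deg B x = card {y \<in> B. E x y}"

text \<open>Ordered pairs are counted: for disjoint sets this is the number of edges between them,
  whereas \<open>ecount C C\<close> counts each inner edge twice.\<close>

definition ecount :: "nat set \<Rightarrow> nat set \<Rightarrow> nat" where
  "ecount A B = (\<Sum>x\<in>A. deg B x)"

abbreviation out :: "nat set \<Rightarrow> nat" where
  "out A \<equiv> ecount A ({..<n} - A)"

definition miss :: "nat set \<Rightarrow> nat \<Rightarrow> nat" where
  "miss C x = card {y \<in> C - {x}. \<not> E x y}"

lemma deg_sum: "finite B \<Longrightarrow> deg B x = (\<Sum>y\<in>B. of_bool (E x y))"
  by (simp add: deg_def Int_def)

lemma deg_Un: "finite B \<Longrightarrow> finite B' \<Longrightarrow> B \<inter> B' = {} \<Longrightarrow> deg (B \<union> B') x = deg B x + deg B' x"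
  by (simp add: deg_sum sum.union_disjoint del: sum_of_bool_eq)

lemma deg_mono: "finite B \<Longrightarrow> A \<subseteq> B \<Longrightarrow> deg A x \<le> deg B x"
  unfolding deg_def by (intro card_mono) auto

lemma deg_le: "finite B \<Longrightarrow> deg B x \<le> card B"
  unfolding deg_def by (intro card_mono) auto

lemma ecount_commute: "finite A \<Longrightarrow> finite B \<Longrightarrow> ecount A B = ecount B A"
proof -
  assume fin: "finite A" "finite B"
  have "(\<Sum>x\<in>A. \<Sum>y\<in>B. of_bool (E x y)) = (\<Sum>y\<in>B. \<Sum>x\<in>A. of_bool (E x y) :: nat)"
    by (rule sum.swap)
  also have "\<dots> = (\<Sum>y\<in>B. \<Sum>x\<in>A. of_bool (E y x))"
    by (intro sum.cong refl arg_cong[of _ _ of_bool]) (auto intro: sym)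
  finally show ?thesis using fin by (simp add: ecount_def deg_sum del: sum_of_bool_eq)
qed

lemma ecount_empty [simp]: "ecount {} B = 0" "ecount A {} = 0"
  by (simp_all add: ecount_def deg_def)

lemma ecount_Un_right:
  "finite B \<Longrightarrow> finite B' \<Longrightarrow> B \<inter> B' = {} \<Longrightarrow> ecount A (B \<union> B') = ecount A B + ecount A B'"
  by (simp add: ecount_def deg_Un sum.distrib)

lemma ecount_Un_left:
  "finite A \<Longrightarrow> finite A' \<Longrightarrow> A \<inter> A' = {} \<Longrightarrow> ecount (A \<union> A') B = ecount A B + ecount A' B"
  by (simp add: ecount_def sum.union_disjoint)

lemma ecount_split_right: "finite B \<Longrightarrow> C \<subseteq> B \<Longrightarrow> ecount A B = ecount A C + ecount A (B - C)"
  using ecount_Un_right[of C "B - C" A] by (simp add: Un_absorb1 finite_subset)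

lemma ecount_mono: "finite A' \<Longrightarrow> finite B' \<Longrightarrow> A \<subseteq> A' \<Longrightarrow> B \<subseteq> B' \<Longrightarrow> ecount A B \<le> ecount A' B'"
proof -
  assume *: "finite A'" "finite B'" "A \<subseteq> A'" "B \<subseteq> B'"
  have "ecount A B \<le> (\<Sum>x\<in>A. deg B' x)"
    unfolding ecount_def using * by (intro sum_mono deg_mono)
  also have "\<dots> \<le> ecount A' B'"
    unfolding ecount_def using * by (intro sum_mono2) auto
  finally show ?thesis .
qed

lemma ecount_le: "finite A \<Longrightarrow> finite B \<Longrightarrow> ecount A B \<le> card A * card B"
proof -
  assume "finite A" "finite B"
  then have "ecount A B \<le> (\<Sum>x\<in>A. card B)"
    unfolding ecount_def by (intro sum_mono deg_le)
  then show ?thesis by simp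
qed

lemma ecount_self: "ecount {v} {v} = 0"
  by (auto simp: ecount_def deg_def irrefl)

text \<open>Cutting the vertices into \<open>Z - Y\<close>, \<open>Y - Z\<close>,
  \<open>Z \<inter> Y\<close> and the rest, the right side exceeds the left by twice the number of
  edges between the last two parts. Hence if \<open>Z\<close> and \<open>Y\<close> respect a bound
  on outgoing edges, so does one of the two differences.\<close>

lemma out_posimodular:
  assumes "Z \<subseteq> {..<n}" "Y \<subseteq> {..<n}"
  shows "out (Z - Y) + out (Y - Z) \<le> out Z + out Y"
proof -
  define P Q R S where "P = Z - Y" and "Q = Y - Z" and "R = Z \<inter> Y" and "S = {..<n} - (Z \<union> Y)"
  note d = P_def Q_def R_def S_def
  have fin: "finite P" "finite Q" "finite R" "finite S"
    using assms finite_subset[of _ "{..<n}"] by (auto simp: d)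
  have dis: "P \<inter> Q = {}" "P \<inter> R = {}" "P \<inter> S = {}" "Q \<inter> R = {}" "Q \<inter> S = {}" "R \<inter> S = {}"
    "(Q \<union> R) \<inter> S = {}" "(P \<union> R) \<inter> S = {}"
    by (auto simp: d)
  have eq: "Z = P \<union> R" "Y = Q \<union> R" "{..<n} - Z = Q \<union> S" "{..<n} - Y = P \<union> S"
    "{..<n} - (Z - Y) = (Q \<union> R) \<union> S" "{..<n} - (Y - Z) = (P \<union> R) \<union> S" "Z - Y = P" "Y - Z = Q"
    using assms by (auto simp: d)
  have PQ: "P \<inter> Q = {}" "R \<inter> Q = {}" "P \<inter> R = {}" by (auto simp: d)
  have "out (Z - Y) = ecount P Q + ecount P R + ecount P S"
    unfolding eq(5) unfolding eq(7) using fin dis by (simp add: ecount_Un_right)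
  moreover have "out (Y - Z) = ecount Q P + ecount Q R + ecount Q S"
    unfolding eq(6) unfolding eq(8) using fin dis by (simp add: ecount_Un_right)
  moreover have "out Z = ecount P Q + ecount P S + ecount R Q + ecount R S"
    unfolding eq(3) unfolding eq(1) using fin dis by (simp add: ecount_Un_right ecount_Un_left)
  moreover have "out Y = ecount Q P + ecount Q S + ecount R P + ecount R S"
    unfolding eq(4) unfolding eq(2) using fin dis by (simp add: ecount_Un_right ecount_Un_left)
  ultimately show ?thesis
    using ecount_commute[OF fin(3,1)] ecount_commute[OF fin(3,2)] by linarith
qed

lemma neighbour_count_le:
  assumes "finite A" "finite B"
  shows "card {y \<in> B. \<exists>x\<in>A. E x y} \<le> ecount A B"
proof -
  have "{y \<in> B. \<exists>x\<in>A. E x y} = (\<Union>x\<in>A. {y \<in> B. E x y})" by auto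
  then have "card {y \<in> B. \<exists>x\<in>A. E x y} \<le> (\<Sum>x\<in>A. card {y \<in> B. E x y})"
    using card_UN_le[OF assms(1)] by metis
  then show ?thesis by (simp add: ecount_def deg_def)
qed

text \<open>Here simplicity of the graph enters, as \<open>v\<close> sends at most \<open>card (C - {v})\<close> edges into \<open>C\<close>.\<close>

lemma few_outgoing_edges:
  assumes C: "C \<subseteq> {..<n}" "v \<in> C" and "out C < out {v}"
  shows "ecount (C - {v}) ({..<n} - C) < card (C - {v})"
proof -
  let ?A = "C - {v}"
  have fin: "finite ?A" "finite C" using C finite_subset by auto
  have 1: "C = {v} \<union> ?A" "{..<n} - {v} = ?A \<union> ({..<n} - C)" using C by auto
  have "out C = ecount {v} ({..<n} - C) + ecount ?A ({..<n} - C)"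
    using fin by (subst 1(1), subst ecount_Un_left) auto
  moreover have "out {v} = ecount {v} ?A + ecount {v} ({..<n} - C)"
    using fin by (subst 1(2), subst ecount_Un_right) auto
  moreover have "ecount {v} ?A \<le> card ?A"
    using ecount_le[of "{v}" ?A] fin by simp
  ultimately show ?thesis using assms(3) by linarith
qed

lemma miss_plus_deg:
  assumes "finite C" "x \<in> C"
  shows "miss C x + deg C x = card C - 1"
proof -
  have "C - {x} = {y \<in> C. E x y} \<union> {y \<in> C - {x}. \<not> E x y}" using irrefl by auto
  then have "card (C - {x}) = card {y \<in> C. E x y} + card {y \<in> C - {x}. \<not> E x y}"
    using assms by (metis (no_types, lifting) card_Un_disjoint disjoint_iff finite_Diff finite_Un mem_Collect_eq)
  then show ?thesis using assms by (simp add: miss_def deg_def)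
qed

text \<open>Fewer edges leave \<open>C - {v}\<close> than it has vertices, which yields
  \<open>u\<close>. Since \<open>u\<close> misses at most \<open>p\<close> vertices of
  \<open>C\<close>, the set \<open>B\<close> contains all but \<open>p\<close> of them. Both
  \<open>B\<close> and \<open>Q\<close> are determined by \<open>u\<close> and \<open>v\<close>, so
  all that remains unknown about \<open>C\<close> is its trace on the small set
  \<open>Q\<close>.\<close>

lemma large_cluster:
  assumes C: "C \<subseteq> {..<n}" "v \<in> C" and few: "ecount (C - {v}) ({..<n} - C) < card (C - {v})"
    and miss: "\<And>x. x \<in> C \<Longrightarrow> miss C x \<le> p" and large: "4 * p < card C"
  obtains u B Q where "u < n" "B = {x. x < n \<and> (x = v \<or> x = u \<or> E u x)}"
    "Q = {x. x < n \<and> x \<notin> B \<and> card B \<le> deg B x + p}"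
    "C = B \<union> (Q \<inter> C)" "card Q \<le> p + 1"
proof -
  let ?A = "C - {v}" and ?V = "{..<n}"
  have fin: "finite C" using C finite_subset by auto
  have "\<exists>u\<in>?A. deg (?V - C) u = 0"
  proof (rule ccontr)
    assume "\<not> ?thesis"
    then have "(\<Sum>u\<in>?A. 1) \<le> ecount ?A (?V - C)"
      unfolding ecount_def by (intro sum_mono) (auto simp: Suc_le_eq)
    with few show False by simp
  qed
  then obtain u where u: "u \<in> ?A" "\<And>y. y < n \<Longrightarrow> E u y \<Longrightarrow> y \<in> C" by (auto simp: deg_def)
  define B where "B = {x. x < n \<and> (x = v \<or> x = u \<or> E u x)}"
  define Q where "Q = {x. x < n \<and> x \<notin> B \<and> card B \<le> deg B x + p}"
  have BC: "B \<subseteq> C" using u C by (auto simp: B_def)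
  have finB: "finite B" using BC fin finite_subset by auto
  have CB: "C - B \<subseteq> {y \<in> C - {u}. \<not> E u y}" using C by (auto simp: B_def)
  have cCB: "card (C - B) \<le> p"
    using card_mono[OF _ CB] miss[of u] u fin by (simp add: miss_def)
  have cB: "card C \<le> card B + p"
    using cCB card_Diff_subset[OF finB BC] by simp
  have CQ: "C - B \<subseteq> Q"
  proof
    fix x assume x: "x \<in> C - B"
    have "{y \<in> B. \<not> E x y} \<subseteq> {y \<in> C - {x}. \<not> E x y}" using x BC by auto
    then have "card {y \<in> B. \<not> E x y} \<le> p"
      using card_mono[of "{y \<in> C - {x}. \<not> E x y}" "{y \<in> B. \<not> E x y}"] miss[of x] x fin
      unfolding miss_def by simp
    moreover have "card B = card {y \<in> B. E x y} + card {y \<in> B. \<not> E x y}"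
    proof -
      have "B = {y \<in> B. E x y} \<union> {y \<in> B. \<not> E x y}" by auto
      then show ?thesis
        using finB by (metis (no_types, lifting) card_Un_disjoint disjoint_iff finite_Un mem_Collect_eq)
    qed
    ultimately show "x \<in> Q" using x C by (auto simp: Q_def deg_def)
  qed
  have finQ: "finite Q" unfolding Q_def by auto
  \<comment> \<open>Two vertices of \<open>Q - C\<close> would each have at least
    \<open>card B - p - 1\<close> neighbours in \<open>B - {v}\<close>, one being deducted for
    \<open>v\<close>. With \<open>card C \<le> card B + p\<close> the resulting inequality
    \<open>2 * (card B - p - 1) < card C - 1\<close> forces \<open>card C \<le> 4 * p\<close>; this
    is the origin of the threshold.\<close>
  have "card (Q - C) < 2"
  proof (rule ccontr)
    assume "\<not> card (Q - C) < 2"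
    have vB: "v \<in> B" using C by (auto simp: B_def)
    have "(\<Sum>x\<in>Q - C. card B - p - 1) \<le> ecount (Q - C) (B - {v})"
      unfolding ecount_def
    proof (rule sum_mono)
      fix x assume x: "x \<in> Q - C"
      have "B = {v} \<union> (B - {v})" using vB by auto
      then have "deg B x = deg {v} x + deg (B - {v}) x"
        using finB by (metis Diff_disjoint deg_Un finite.emptyI finite_Diff finite_insert)
      moreover have "deg {v} x \<le> 1" using deg_le[of "{v}" x] by simp
      ultimately show "card B - p - 1 \<le> deg (B - {v}) x"
        using x by (auto simp: Q_def)
    qed
    also have "\<dots> \<le> ecount (?V - C) ?A"
      using BC fin by (intro ecount_mono) (auto simp: Q_def)
    also have "\<dots> < card ?A" using few fin by (simp add: ecount_commute)
    finally have "card (Q - C) * (card B - p - 1) < card C - 1" using C fin by simp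
    moreover have "2 * (card B - p - 1) \<le> card (Q - C) * (card B - p - 1)"
      using \<open>\<not> card (Q - C) < 2\<close> by (intro mult_right_mono) auto
    ultimately have "2 * (card B - p - 1) < card C - 1" by linarith
    then show False using cB large by linarith
  qed
  moreover have "card Q \<le> card (Q - C) + card (Q \<inter> C)"
    by (metis Int_Diff_Un card_Un_le add.commute)
  moreover have "card (Q \<inter> C) \<le> p"
  proof -
    have "Q \<inter> C \<subseteq> C - B" by (auto simp: Q_def)
    then show ?thesis using card_mono[of "C - B" "Q \<inter> C"] cCB fin by simp
  qed
  moreover have "C = B \<union> (Q \<inter> C)" using BC CQ by (auto simp: Q_def)
  ultimately show ?thesis using that[of u B Q] u C by (auto simp: B_def Q_def)
qed

text \<open>Each nonadjacent pair is counted twice, which makes the number expressible through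
  \<open>card C\<close> and \<open>ecount C C\<close>.\<close>

definition nonadj :: "nat set \<Rightarrow> nat" where
  "nonadj C = (\<Sum>x\<in>C. miss C x)"

lemma nonadj_eq: "finite C \<Longrightarrow> nonadj C + ecount C C = card C * (card C - 1)"
proof -
  assume fin: "finite C"
  then have "(\<Sum>x\<in>C. miss C x + deg C x) = (\<Sum>x\<in>C. card C - 1)"
    by (intro sum.cong) (auto simp: miss_plus_deg)
  then show ?thesis by (simp add: nonadj_def ecount_def sum.distrib)
qed

text \<open>Attaching \<open>v\<close> adds quantities that depend on \<open>v\<close> alone, except
  for its edges into \<open>A\<close>, and these are \<open>ecount A {v}\<close>. Outgoing edges are
  all edge ends minus the inner ones, and nonadjacent pairs are all pairs minus the adjacent
  ones.\<close>

lemma same_counts: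
  assumes A: "A \<subseteq> {..<n} - {v}" "A' \<subseteq> {..<n} - {v}" and v: "v < n"
    and "card A = card A'" "ecount A {v} = ecount A' {v}"
    and "ecount A (insert v A) = ecount A' (insert v A')" "ecount A {..<n} = ecount A' {..<n}"
  shows "out (insert v A) = out (insert v A')" "nonadj (insert v A) = nonadj (insert v A')"
    "card (insert v A) = card (insert v A')"
    "miss (insert v A) v = miss (insert v A') v"
proof -
  have inner: "ecount (insert v Z) (insert v Z) = ecount Z (insert v Z) + ecount Z {v}"
    and all: "ecount (insert v Z) {..<n} = ecount Z {..<n} + ecount {v} {..<n}"
    and outX: "out (insert v Z) = ecount (insert v Z) {..<n} - ecount (insert v Z) (insert v Z)"
    and finX: "finite Z" and vX: "v \<notin> Z"
    and degv: "deg (insert v Z) v = ecount Z {v}"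
    if "Z \<subseteq> {..<n} - {v}" for Z
  proof -
    show finX: "finite Z" using that finite_subset by auto
    show vX: "v \<notin> Z" using that by auto
    have "ecount (insert v Z) (insert v Z) = ecount {v} (insert v Z) + ecount Z (insert v Z)"
      using ecount_Un_left[of "{v}" Z] finX vX by simp
    moreover have "ecount {v} (insert v Z) = ecount {v} Z"
      using ecount_Un_right[of "{v}" Z] finX vX ecount_self by simp
    ultimately show "ecount (insert v Z) (insert v Z) = ecount Z (insert v Z) + ecount Z {v}"
      by (simp add: ecount_commute finX)
    show "ecount (insert v Z) {..<n} = ecount Z {..<n} + ecount {v} {..<n}"
      using ecount_Un_left[of "{v}" Z] finX vX by simp
    show "out (insert v Z) = ecount (insert v Z) {..<n} - ecount (insert v Z) (insert v Z)"
      using ecount_split_right[of "{..<n}" "insert v Z" "insert v Z"] that v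
      by (metis (no_types, lifting) Diff_subset add_diff_cancel_left' finite_lessThan insert_subset lessThan_iff subset_trans)
    have "deg (insert v Z) v = ecount {v} Z"
      using finX vX \<open>ecount {v} (insert v Z) = ecount {v} Z\<close> by (simp add: ecount_def)
    then show "deg (insert v Z) v = ecount Z {v}" by (simp add: ecount_commute finX)
  qed
  note facts = inner[OF A(1)] inner[OF A(2)] all[OF A(1)] all[OF A(2)] outX[OF A(1)] outX[OF A(2)]
    finX[OF A(1)] finX[OF A(2)] vX[OF A(1)] vX[OF A(2)] degv[OF A(1)] degv[OF A(2)]
  show "out (insert v A) = out (insert v A')" using assms facts by simp
  show c: "card (insert v A) = card (insert v A')" using assms facts by simp
  show "nonadj (insert v A) = nonadj (insert v A')"
    using nonadj_eq[of "insert v A"] nonadj_eq[of "insert v A'"] assms facts c by simp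
  show "miss (insert v A) v = miss (insert v A') v"
    using miss_plus_deg[of "insert v A" v] miss_plus_deg[of "insert v A'" v] facts c assms(5) by simp
qed

text \<open>Packing the counts of \<open>same_counts\<close> into one number turns the choice of components into
  a subset sum problem.\<close>

definition key :: "nat \<Rightarrow> nat \<Rightarrow> nat set \<Rightarrow> nat" where
  "key M v D = card D + M * ecount D {v} + M ^ 2 * ecount D (insert v D) + M ^ 3 * ecount D {..<n}"

lemma key_empty [simp]: "key M v {} = 0"
  by (simp add: key_def)

text \<open>The only count that is not additive for arbitrary disjoint sets is
  \<open>ecount D (insert v D)\<close>; it becomes additive because no edge joins \<open>D\<close>
  and \<open>D'\<close>.\<close>

lemma key_Un:
  assumes "finite D" "finite D'" "D \<inter> D' = {}" "v \<notin> D \<union> D'" "\<And>x y. x \<in> D \<Longrightarrow> y \<in> D' \<Longrightarrow> \<not> E x y"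
  shows "key M v (D \<union> D') = key M v D + key M v D'"
proof -
  have "deg D' x = 0" if "x \<in> D" for x
    using assms that by (auto simp: deg_def)
  then have z: "ecount D D' = 0" by (simp add: ecount_def)
  then have z': "ecount D' D = 0" using assms by (simp add: ecount_commute)
  have "ecount D (insert v D \<union> D') = ecount D (insert v D)"
    using assms z by (subst ecount_Un_right) auto
  moreover have "ecount D' (insert v D' \<union> D) = ecount D' (insert v D')"
    using assms z' by (subst ecount_Un_right) auto
  moreover have "insert v D \<union> D' = insert v (D \<union> D')" "insert v D' \<union> D = insert v (D \<union> D')" by auto
  ultimately have "ecount D (insert v (D \<union> D')) = ecount D (insert v D)"
    "ecount D' (insert v (D \<union> D')) = ecount D' (insert v D')" by simp_all
  then show ?thesis
    using assms unfolding key_def by (simp add: ecount_Un_left card_Un_disjoint algebra_simps)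
qed

text \<open>This makes \<open>n * n + 1\<close> a valid radix: the four counts are the digits of the
  key.\<close>

lemma key_components_less:
  assumes "D \<subseteq> {..<n} - {v}" "v < n"
  shows "card D < n * n + 1" "ecount D {v} < n * n + 1" "ecount D (insert v D) < n * n + 1"
    "ecount D {..<n} < n * n + 1"
proof -
  have fin: "finite D" using assms finite_subset by auto
  have c: "card D \<le> n" using card_mono[of "{..<n}" D] assms by auto
  also have "n \<le> n * n" by (cases n) auto
  finally show "card D < n * n + 1" by simp
  have "ecount D {..<n} \<le> n * n"
    using ecount_le[of D "{..<n}"] fin mult_le_mono1[OF c, of n] by (metis card_lessThan finite_lessThan le_trans)
  moreover have "ecount D {v} \<le> ecount D {..<n}" "ecount D (insert v D) \<le> ecount D {..<n}"
    using assms fin by (auto intro!: ecount_mono)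
  ultimately show "ecount D {v} < n * n + 1" "ecount D (insert v D) < n * n + 1" "ecount D {..<n} < n * n + 1"
    by linarith+
qed

lemma radix_unique:
  fixes a b c d :: nat
  assumes "a < M" "a' < M" "b < M" "b' < M" "c < M" "c' < M"
    and "a + M * b + M ^ 2 * c + M ^ 3 * d = a' + M * b' + M ^ 2 * c' + M ^ 3 * d'"
  shows "a = a' \<and> b = b' \<and> c = c' \<and> d = d'"
proof -
  have step: "x = x' \<and> y = y'" if "x + M * y = x' + M * y'" "x < M" "x' < M" for x x' y y' :: nat
  proof -
    have "(x + M * y) mod M = x" "(x' + M * y') mod M = x'" "(x + M * y) div M = y" "(x' + M * y') div M = y'"
      using that(2,3) by simp_all
    then show ?thesis using that(1) by metis
  qed
  have "a + M * (b + M * (c + M * d)) = a' + M * (b' + M * (c' + M * d'))"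
    using assms(7) by (simp add: algebra_simps power2_eq_square power3_eq_cube)
  then show ?thesis using step assms(1-6) by meson
qed

lemma key_less:
  assumes "D \<subseteq> {..<n} - {v}" "v < n" "M = n * n + 1"
  shows "key M v D < M ^ 4"
proof -
  define a b c d where "a = card D" "b = ecount D {v}" "c = ecount D (insert v D)" "d = ecount D {..<n}"
  note less = key_components_less[OF assms(1,2), folded a_b_c_d_def assms(3)]
  have step: "x + M * y < M * Y" if "x < M" "y < Y" for x y Y
  proof -
    have "x + M * y < M * (y + 1)" using that by simp
    also have "\<dots> \<le> M * Y" using that by (intro mult_left_mono) auto
    finally show ?thesis .
  qed
  have "a + M * (b + M * (c + M * d)) < M * (M * (M * M))"
    using less by (intro step)
  then show ?thesis
    by (simp add: key_def algebra_simps power2_eq_square power3_eq_cube power4_eq_xxxx flip: a_b_c_d_def)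
qed

lemma key_inject:
  assumes "D \<subseteq> {..<n} - {v}" "D' \<subseteq> {..<n} - {v}" "v < n" "M = n * n + 1" "key M v D = key M v D'"
  shows "card D = card D'" "ecount D {v} = ecount D' {v}"
    "ecount D (insert v D) = ecount D' (insert v D')" "ecount D {..<n} = ecount D' {..<n}"
  using radix_unique[OF _ _ _ _ _ _ assms(5)[unfolded key_def]]
    key_components_less[OF assms(1,3), folded assms(4)] key_components_less[OF assms(2,3), folded assms(4)]
  by blast+

text \<open>The properties by which the three measures are treated at once. Monotonicity allows
  clusters to be trimmed; the bound on \<open>miss\<close> serves large clusters; the last clause,
  in which every bound on the misses of \<open>Z\<close> also bounds those of \<open>Y\<close>,
  allows a small cluster to be replaced by the set that the subset sum computation finds.\<close>

definition measure_like :: "(nat set \<Rightarrow> nat) \<Rightarrow> bool" where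
  "measure_like \<mu> \<longleftrightarrow>
     (\<forall>Z Y. Y \<subseteq> {..<n} \<longrightarrow> Z \<subseteq> Y \<longrightarrow> \<mu> Z \<le> \<mu> Y) \<and>
     (\<forall>Z x. Z \<subseteq> {..<n} \<longrightarrow> x \<in> Z \<longrightarrow> miss Z x \<le> \<mu> Z) \<and>
     (\<forall>Z Y. Z \<subseteq> {..<n} \<longrightarrow> Y \<subseteq> {..<n} \<longrightarrow> card Z = card Y \<longrightarrow> nonadj Z = nonadj Y \<longrightarrow>
        (\<forall>d. (\<forall>x\<in>Z. miss Z x \<le> d) \<longrightarrow> (\<forall>x\<in>Y. miss Y x \<le> d)) \<longrightarrow> \<mu> Y \<le> \<mu> Z)"

end

section \<open>Components of the coloured vertices and their exchange\<close>

locale coloured_graph = ugraph +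
  fixes v :: nat and col :: "nat \<Rightarrow> bool" and lab :: "nat \<Rightarrow> nat"
  assumes v: "v < n"
begin

definition active :: "nat set" where
  "active = {x. x < n \<and> x \<noteq> v \<and> col x}"

definition cls :: "nat \<Rightarrow> nat set" where
  "cls l = {x \<in> active. lab x = l}"

text \<open>Distinct classes are not joined by edges, so a vertex has the same degree in its class
  plus \<open>v\<close> as in any union of classes plus \<open>v\<close>. A lower bound on degrees
  in the union can therefore be tested class by class.\<close>

definition heavy :: "nat \<Rightarrow> nat \<Rightarrow> bool" where
  "heavy h l \<longleftrightarrow> (\<forall>x\<in>cls l. h \<le> deg (insert v (cls l)) x)"

text \<open>The classes are the connected components of the active vertices. Connectedness is
  expressed without paths: a set of active vertices closed under active neighbours is a union of
  classes.\<close>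

definition component_labelling :: bool where
  "component_labelling \<longleftrightarrow>
     (\<forall>x\<in>active. lab x < n) \<and>
     (\<forall>x\<in>active. \<forall>y\<in>active. E x y \<longrightarrow> lab x = lab y) \<and>
     (\<forall>S. S \<subseteq> active \<longrightarrow> (\<forall>x\<in>S. \<forall>y\<in>active. E x y \<longrightarrow> y \<in> S) \<longrightarrow>
        (\<forall>x\<in>active. \<forall>y\<in>active. lab x = lab y \<longrightarrow> x \<in> S \<longrightarrow> y \<in> S))"

lemma
  assumes component_labelling
  shows lab_less: "x \<in> active \<Longrightarrow> lab x < n"
    and lab_edge: "x \<in> active \<Longrightarrow> y \<in> active \<Longrightarrow> E x y \<Longrightarrow> lab x = lab y"
    and lab_closed: "S \<subseteq> active \<Longrightarrow> (\<And>x y. x \<in> S \<Longrightarrow> y \<in> active \<Longrightarrow> E x y \<Longrightarrow> y \<in> S) \<Longrightarrow>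
      x \<in> S \<Longrightarrow> y \<in> active \<Longrightarrow> lab x = lab y \<Longrightarrow> y \<in> S"
  using assms unfolding component_labelling_def by (blast, blast, meson subsetD)

lemma cls_subset: "cls l \<subseteq> {..<n} - {v}"
  by (auto simp: cls_def active_def)

lemma finite_cls: "finite (cls l)"
  using cls_subset finite_subset by blast

lemma key_UN:
  assumes lab: component_labelling and J: "finite J"
  shows "key M v (\<Union>l\<in>J. cls l) = (\<Sum>l\<in>J. key M v (cls l))"
  using J
proof induction
  case (insert l J)
  have "key M v (cls l \<union> (\<Union>l\<in>J. cls l)) = key M v (cls l) + key M v (\<Union>l\<in>J. cls l)"
  proof (rule key_Un)
    show "cls l \<inter> (\<Union>l\<in>J. cls l) = {}" using insert.hyps by (auto simp: cls_def)
    show "v \<notin> cls l \<union> (\<Union>l\<in>J. cls l)" by (auto simp: cls_def active_def)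
    show "\<not> E x y" if "x \<in> cls l" "y \<in> (\<Union>l\<in>J. cls l)" for x y
      using that insert.hyps lab_edge[OF lab, of x y] by (auto simp: cls_def)
  qed (use insert.hyps finite_cls in auto)
  then show ?case using insert by simp
qed simp

lemma deg_UN_cls:
  assumes lab: component_labelling and "finite J" "l \<in> J" "x \<in> cls l"
  shows "deg (insert v (\<Union>l\<in>J. cls l)) x = deg (insert v (cls l)) x"
proof -
  have "{y \<in> insert v (\<Union>l\<in>J. cls l). E x y} = {y \<in> insert v (cls l). E x y}"
  proof (rule Collect_cong)
    fix y
    show "(y \<in> insert v (\<Union>l\<in>J. cls l) \<and> E x y) = (y \<in> insert v (cls l) \<and> E x y)"
      using lab_edge[OF lab, of x y] assms(3,4) by (auto simp: cls_def)
  qed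
  then show ?thesis by (simp add: deg_def)
qed

lemma union_of_classes:
  assumes lab: component_labelling
    and C: "C \<subseteq> {..<n}" "v \<in> C" and inside: "\<And>x. x \<in> C - {v} \<Longrightarrow> col x"
    and outside: "\<And>x y. x \<in> C - {v} \<Longrightarrow> y < n \<Longrightarrow> y \<notin> C \<Longrightarrow> E x y \<Longrightarrow> \<not> col y"
  obtains J where "J \<subseteq> {..<n}" "C = insert v (\<Union>l\<in>J. cls l)"
proof (rule that)
  let ?A = "C - {v}"
  have A: "?A \<subseteq> active" using C inside by (auto simp: active_def)
  have closed: "y \<in> ?A" if "x \<in> ?A" "y \<in> active" "lab x = lab y" for x y
    by (rule lab_closed[OF lab A _ that]) (use outside in \<open>auto simp: active_def\<close>)
  show "lab ` ?A \<subseteq> {..<n}" using lab_less[OF lab] A by auto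
  have "?A = (\<Union>l\<in>lab ` ?A. cls l)"
  proof (intro Set.set_eqI iffI)
    fix x assume "x \<in> ?A"
    then show "x \<in> (\<Union>l\<in>lab ` ?A. cls l)" using A unfolding cls_def by blast
  next
    fix x assume "x \<in> (\<Union>l\<in>lab ` ?A. cls l)"
    then obtain y where y: "y \<in> ?A" "x \<in> active" "lab x = lab y" unfolding cls_def by blast
    then show "x \<in> ?A" using closed[OF y(1,2) y(3)[symmetric]] by simp
  qed
  then show "C = insert v (\<Union>l\<in>lab ` ?A. cls l)" using C by (metis insert_Diff)
qed

text \<open>Equal key sums mean equal digits, which settles the counts and the misses of
  \<open>v\<close>. The misses of all other vertices are controlled by \<open>heavy\<close>, since
  size minus one minus degree is the number of misses and the sizes agree.\<close>

lemma exchange: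
  assumes lab: component_labelling and J: "J \<subseteq> {..<n}" "J' \<subseteq> {..<n}" and M: "M = n * n + 1"
    and C: "C = insert v (\<Union>l\<in>J. cls l)" and C': "C' = insert v (\<Union>l\<in>J'. cls l)"
    and keys: "(\<Sum>l\<in>J. key M v (cls l)) = (\<Sum>l\<in>J'. key M v (cls l))"
    and d: "\<And>x. x \<in> C \<Longrightarrow> miss C x \<le> d"
    and heavy: "\<And>l. l \<in> J' \<Longrightarrow> heavy (card C - 1 - d) l"
  shows "out C' = out C" "card C' = card C" "nonadj C' = nonadj C" "x \<in> C' \<Longrightarrow> miss C' x \<le> d"
proof -
  let ?A = "\<Union>l\<in>J. cls l" and ?A' = "\<Union>l\<in>J'. cls l"
  have fin: "finite J" "finite J'" using J finite_subset by auto
  have A: "?A \<subseteq> {..<n} - {v}" "?A' \<subseteq> {..<n} - {v}" using cls_subset by auto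
  have "key M v ?A = key M v ?A'" using keys lab fin by (simp add: key_UN)
  note same = same_counts[OF A v key_inject[OF A v M this]]
  show "out C' = out C" "card C' = card C" "nonadj C' = nonadj C"
    using same by (simp_all add: C C')
  assume x: "x \<in> C'"
  show "miss C' x \<le> d"
  proof (cases "x = v")
    case True
    then show ?thesis using same(4) d[of v] by (simp add: C C')
  next
    case False
    then obtain l where l: "l \<in> J'" "x \<in> cls l" using x C' by auto
    have "card C' - 1 - d \<le> deg C' x"
      using heavy[OF l(1)] l(2) deg_UN_cls[OF lab fin(2) l] \<open>card C' = card C\<close>
      by (auto simp: heavy_def C')
    moreover have "finite C'" using fin finite_cls by (simp add: C')
    ultimately show ?thesis using miss_plus_deg[of C' x] x by linarith
  qed
qed

text \<open>The classes forming \<open>C\<close> pass the test made with the threshold of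
  \<open>C\<close> itself, so filtering never loses the solution being looked for.\<close>

lemma heavy_class:
  assumes lab: component_labelling and J: "J \<subseteq> {..<n}" "l \<in> J"
    and C: "C = insert v (\<Union>l\<in>J. cls l)" and d: "\<And>x. x \<in> C \<Longrightarrow> miss C x \<le> d"
  shows "heavy (card C - 1 - d) l"
proof -
  have fin: "finite J" using J finite_subset by auto
  have "finite C" using fin finite_cls by (auto simp: C)
  then have "card C - 1 - d \<le> deg C x" if "x \<in> C" for x
    using miss_plus_deg[of C x] d[OF that] that by linarith
  moreover have "x \<in> C" if "x \<in> cls l" for x using that J(2) by (auto simp: C)
  ultimately show ?thesis using deg_UN_cls[OF lab fin J(2)] unfolding heavy_def C by metis
qed

end

section \<open>Running times and expressions\<close>

definition poly_exp :: "(nat \<Rightarrow> int \<Rightarrow> nat) \<Rightarrow> bool" where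
  "poly_exp T \<longleftrightarrow> (\<exists>k. \<forall>n p. T n p \<le> single_exp_bound k n p)"

lemma poly_exp_le: "poly_exp T \<Longrightarrow> (\<And>n p. T' n p \<le> T n p) \<Longrightarrow> poly_exp T'"
  unfolding poly_exp_def by (meson le_trans)

lemma poly_exp_mult [intro]:
  assumes "poly_exp T" "poly_exp U"
  shows "poly_exp (\<lambda>n p. T n p * U n p)"
proof -
  obtain k l where kl: "\<And>n p. T n p \<le> single_exp_bound k n p" "\<And>n p. U n p \<le> single_exp_bound l n p"
    using assms by (auto simp: poly_exp_def)
  \<comment> \<open>A single constant serves as coefficient and as exponent, so it has to dominate
    both the product \<open>k * l\<close> and the sum \<open>k + l\<close>.\<close>
  have "T n p * U n p \<le> single_exp_bound (k * l + (k + l)) n p" for n p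
  proof -
    have "T n p * U n p \<le> single_exp_bound k n p * single_exp_bound l n p"
      using kl by (intro mult_mono) auto
    also have "\<dots> = (k * l) * 2 ^ ((k + l) * nat p) * (n + 1) ^ (k + l)"
      by (simp add: single_exp_bound_def power_add algebra_simps)
    also have "\<dots> \<le> single_exp_bound (k * l + (k + l)) n p"
      unfolding single_exp_bound_def by (intro mult_mono power_increasing) auto
    finally show ?thesis .
  qed
  then show ?thesis unfolding poly_exp_def by blast
qed

lemma poly_exp_add [intro]:
  assumes "poly_exp T" "poly_exp U"
  shows "poly_exp (\<lambda>n p. T n p + U n p)"
proof -
  obtain k l where kl: "\<And>n p. T n p \<le> single_exp_bound k n p" "\<And>n p. U n p \<le> single_exp_bound l n p"
    using assms by (auto simp: poly_exp_def)
  have "T n p + U n p \<le> single_exp_bound (k + l) n p" for n p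
  proof -
    have "T n p + U n p \<le> k * 2 ^ ((k + l) * nat p) * (n + 1) ^ (k + l) + l * 2 ^ ((k + l) * nat p) * (n + 1) ^ (k + l)"
      by (rule add_mono; rule order_trans[OF kl(1)] order_trans[OF kl(2)];
          unfold single_exp_bound_def; intro mult_mono power_increasing; auto)
    then show ?thesis by (simp add: single_exp_bound_def algebra_simps)
  qed
  then show ?thesis unfolding poly_exp_def by blast
qed

lemma poly_exp_const [intro]: "poly_exp (\<lambda>n p. c)"
  unfolding poly_exp_def single_exp_bound_def
proof (intro exI allI)
  fix n p
  show "c \<le> c * 2 ^ (c * nat p) * (n + 1) ^ c"
    using mult_le_mono2[of 1 "2 ^ (c * nat p) * (n + 1) ^ c" c] by (simp add: mult.assoc)
qed

lemma poly_exp_size [intro]: "poly_exp (\<lambda>n p. n)"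
  unfolding poly_exp_def single_exp_bound_def
  by (intro exI[of _ 1] allI) (simp add: trans_le_add2 le_SucI)

lemma poly_exp_two_power [intro]: "poly_exp (\<lambda>n p. 2 ^ nat p)"
  unfolding poly_exp_def single_exp_bound_def by (intro exI[of _ 1] allI) simp

lemma poly_exp_parameter [intro]: "poly_exp (\<lambda>n p. nat p)"
  by (rule poly_exp_le[OF poly_exp_two_power]) (rule less_imp_le_nat[OF less_exp])

lemma poly_exp_power [intro]: "poly_exp T \<Longrightarrow> poly_exp (\<lambda>n p. T n p ^ j)"
  by (induction j) auto

lemma poly_exp_time_ex:
  "(\<And>k. k \<in> bounds_ex e \<Longrightarrow> poly_exp (\<lambda>n p. B n p k)) \<Longrightarrow> poly_exp (\<lambda>n p. time_ex e (B n p))"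
  by (induction e) (auto intro!: poly_exp_add poly_exp_mult)

lemma poly_exp_time_cmd:
  "(\<And>k. k \<in> bounds c \<Longrightarrow> poly_exp (\<lambda>n p. B n p k)) \<Longrightarrow> poly_exp (\<lambda>n p. time_cmd c (B n p))"
  by (induction c) (auto intro!: poly_exp_add poly_exp_mult poly_exp_time_ex)

section \<open>Loops that fill arrays, derived operators and the initial constants\<close>

text \<open>The step may assume that other arrays are untouched and that cells of \<open>a\<close>
  not yet visited still hold their old contents. Thus \<open>e\<close> may read \<open>a\<close>
  itself, at the cell about to be written or at cells outside the range of \<open>g\<close>.\<close>

lemma for_fill:
  assumes inj: "inj_on g {..<m}" and m: "nat (S k 0) = m"
    and step: "\<And>i T. i < m \<Longrightarrow> (\<And>x. x \<noteq> a \<Longrightarrow> T x = S x) \<Longrightarrow> (\<And>j. j \<notin> g ` {..<i} \<Longrightarrow> T a j = S a j) \<Longrightarrow>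
      eval idx (\<rho>(x := int i)) T = g i \<and> eval e (\<rho>(x := int i)) T = w i"
  shows "x' \<noteq> a \<Longrightarrow> sem (CFor x k (CAssign a idx e)) \<rho> S x' = S x'"
    and "i < m \<Longrightarrow> sem (CFor x k (CAssign a idx e)) \<rho> S a (g i) = w i"
    and "j \<notin> g ` {..<m} \<Longrightarrow> sem (CFor x k (CAssign a idx e)) \<rho> S a j = S a j"
proof -
  define I where "I i T \<longleftrightarrow> (\<forall>x. x \<noteq> a \<longrightarrow> T x = S x) \<and> (\<forall>j. j \<notin> g ` {..<i} \<longrightarrow> T a j = S a j) \<and>
    (\<forall>j<i. T a (g j) = w j)" for i and T :: state
  have "I m (loop (\<lambda>i. sem (CAssign a idx e) (\<rho>(x := int i))) m S)"
  proof (rule loop_invariant)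
    show "I 0 S" by (simp add: I_def)
    fix i T assume i: "i < m" and T: "I i T"
    have ev: "eval idx (\<rho>(x := int i)) T = g i" "eval e (\<rho>(x := int i)) T = w i"
      using step[OF i, of T] T by (auto simp: I_def)
    have neq: "g j \<noteq> g i" if "j < i" for j
      using inj_onD[OF inj, of j i] that i by auto
    show "I (Suc i) (sem (CAssign a idx e) (\<rho>(x := int i)) T)"
      using T neq unfolding I_def sem.simps ev by (auto simp: less_Suc_eq lessThan_Suc)
  qed
  then show "x' \<noteq> a \<Longrightarrow> sem (CFor x k (CAssign a idx e)) \<rho> S x' = S x'"
    "i < m \<Longrightarrow> sem (CFor x k (CAssign a idx e)) \<rho> S a (g i) = w i"
    "j \<notin> g ` {..<m} \<Longrightarrow> sem (CFor x k (CAssign a idx e)) \<rho> S a j = S a j"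
    by (auto simp: I_def m)
qed

text \<open>One successful iteration suffices, at an index that the program does not know, provided
  that later iterations cannot undo the success.\<close>

lemma loop_eventually:
  assumes "I s" "\<And>i u. i < m \<Longrightarrow> I u \<Longrightarrow> I (f i u)" and "i < m" "\<And>u. I u \<Longrightarrow> P (f i u)"
    and "\<And>j u. j < m \<Longrightarrow> I u \<Longrightarrow> P u \<Longrightarrow> P (f j u)"
  shows "P (loop f m s)"
proof -
  have "I (loop f m s) \<and> (i < m \<longrightarrow> P (loop f m s))"
    by (rule loop_invariant[where P = "\<lambda>j u. I u \<and> (i < j \<longrightarrow> P u)"]) (use assms in \<open>auto simp: less_Suc_eq\<close>)
  with assms(3) show ?thesis by simp
qed

abbreviation sc :: "vname \<Rightarrow> ex" where
  "sc x \<equiv> ER x (EN 0)"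

definition eand :: "ex \<Rightarrow> ex \<Rightarrow> ex" where "eand a b = EIf a b (EN 0)"
definition enot :: "ex \<Rightarrow> ex" where "enot a = EIf a (EN 0) (EN 1)"
definition eor :: "ex \<Rightarrow> ex \<Rightarrow> ex" where "eor a b = EIf a (EN 1) b"
definition ele :: "ex \<Rightarrow> ex \<Rightarrow> ex" where "ele a b = enot (ELt b a)"
definition eeq :: "ex \<Rightarrow> ex \<Rightarrow> ex" where "eeq a b = eand (ele a b) (ele b a)"
definition ecount_if :: "ex \<Rightarrow> ex" where "ecount_if b = EIf b (EN 1) (EN 0)"

text \<open>The product of \<open>u\<close> and \<open>e\<close>, provided that \<open>0 \<le> u \<le> n\<close>; \<open>e\<close> must not use the loop variable.\<close>

definition emul :: "ex \<Rightarrow> ex \<Rightarrow> ex" where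
  "emul u e = ESum ''#'' ''n'' (EIf (ELt (EV ''#'') u) e (EN 0))"

definition eadj :: "vname \<Rightarrow> vname \<Rightarrow> ex" where
  "eadj x y = ER ''adj'' (EP (emul (EV x) (sc ''n'')) (EV y))"

lemmas macro_defs = eand_def enot_def eor_def ele_def eeq_def ecount_if_def emul_def eadj_def

lemma truth [simp]:
  "0 < eval (ELt a b) \<rho> s \<longleftrightarrow> eval a \<rho> s < eval b \<rho> s"
  "0 < eval (eand a b) \<rho> s \<longleftrightarrow> 0 < eval a \<rho> s \<and> 0 < eval b \<rho> s"
  "0 < eval (eor a b) \<rho> s \<longleftrightarrow> 0 < eval a \<rho> s \<or> 0 < eval b \<rho> s"
  "0 < eval (enot a) \<rho> s \<longleftrightarrow> \<not> 0 < eval a \<rho> s"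
  "0 < eval (ele a b) \<rho> s \<longleftrightarrow> eval a \<rho> s \<le> eval b \<rho> s"
  "0 < eval (eeq a b) \<rho> s \<longleftrightarrow> eval a \<rho> s = eval b \<rho> s"
  "eval (ecount_if b) \<rho> s = (if 0 < eval b \<rho> s then 1 else 0)"
  by (auto simp: macro_defs)

lemma sum_if_less: "u \<le> n \<Longrightarrow> (\<Sum>i<n. if int i < int u then c else 0) = int u * c" for c :: int
proof (induction n)
  case (Suc n)
  show ?case
  proof (cases "u = Suc n")
    case True
    then have "(\<Sum>i<Suc n. if int i < int u then c else 0) = (\<Sum>i<Suc n. c)" by (intro sum.cong) auto
    then show ?thesis using True by simp
  next
    case False
    then show ?thesis using Suc by simp
  qed
qed simp

text \<open>Multiplication by the radix \<open>n * n + 1\<close> as repeated addition, the machine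
  having no product.\<close>

definition mulM :: "ex \<Rightarrow> ex" where
  "mulM e = EP (ESum ''i'' ''n'' (ESum ''j'' ''n'' e)) e"

fun seqs :: "cmd list \<Rightarrow> cmd" where
  "seqs [] = CSkip"
| "seqs [c] = c"
| "seqs (c # cs) = CSeq c (seqs cs)"

text \<open>Computes the binary logarithm of a power of two just above \<open>n\<close> and adds it
  to \<open>t\<close>. While \<open>w\<close> is at most \<open>n\<close> every round doubles it, so
  \<open>n\<close> rounds are enough.\<close>

definition doublings :: cmd where
  "doublings = CFor ''i'' ''n'' (CIf (ele (sc ''w'') (sc ''n''))
     (CSeq (CAssign ''w'' (EN 0) (EP (sc ''w'') (sc ''w''))) (CAssign ''t'' (EN 0) (EP (sc ''t'') (EN 1)))) CSkip)"

text \<open>\<open>M\<close>, \<open>M2\<close> and \<open>M3\<close> are the weights of the digits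
  of a key and \<open>K\<close> bounds all keys. The doublings of \<open>p\<close> give
  \<open>8 * p + 2\<close>, the number of vertices whose colours matter, and the logarithm added by
  \<open>doublings\<close> supplies the factor \<open>n\<close> in the universality condition. A
  seed has \<open>tt\<close> bits: \<open>t\<close> initial values and \<open>t\<close> feedback
  coefficients.\<close>

definition prepare :: cmd where
  "prepare = seqs [
     CAssign ''M'' (EN 0) (mulM (EN 1)),
     CAssign ''M2'' (EN 0) (mulM (sc ''M'')),
     CAssign ''M3'' (EN 0) (mulM (sc ''M2'')),
     CAssign ''K'' (EN 0) (mulM (sc ''M3'')),
     CAssign ''t'' (EN 0) (EIf (ELt (sc ''p'') (EN 0)) (EN 0) (EP (sc ''p'') (sc ''p''))),
     CAssign ''t'' (EN 0) (EP (sc ''t'') (sc ''t'')),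
     CAssign ''t'' (EN 0) (EP (EP (sc ''t'') (sc ''t'')) (EN 2)),
     CAssign ''w'' (EN 0) (EN 1),
     doublings,
     CAssign ''tt'' (EN 0) (EP (sc ''t'') (sc ''t'')),
     CAssign ''N'' (EN 0) (EN 1)]"

text \<open>Kept apart from \<open>prepare\<close>, which computes the loop bound \<open>tt\<close>:
  a compiled command must not write its own loop bounds.\<close>

definition prepare_seeds :: cmd where
  "prepare_seeds = CFor ''i'' ''tt'' (CAssign ''N'' (EN 0) (EP (sc ''N'') (sc ''N'')))"

lemma doubling:
  assumes n: "nat (S ''n'' 0) = n" "S ''n'' 0 = int n"
    and w: "S ''w'' 0 = 1" and t: "S ''t'' 0 = int t0"
    and S': "S' = sem doublings \<rho> S"
  obtains l where "S' ''t'' 0 = int (t0 + l)" "l \<le> n" "n < 2 ^ l" "2 ^ l \<le> 2 * n + 1"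
proof -
  \<comment> \<open>The clause \<open>min i n < 2 ^ l\<close> yields \<open>n < 2 ^ l\<close> after
    \<open>n\<close> rounds. Doubling only while \<open>2 ^ l \<le> n\<close> keeps
    \<open>2 ^ l\<close> at most \<open>2 * n + 1\<close>, where the summand one covers
    \<open>n = 0\<close>.\<close>
  define I where "I i u \<longleftrightarrow> u ''n'' 0 = int n \<and>
    (\<exists>l. l \<le> i \<and> u ''t'' 0 = int (t0 + l) \<and> u ''w'' 0 = 2 ^ l \<and> (2::nat) ^ l \<le> 2 * n + 1 \<and> min i n < 2 ^ l)" for i and u :: state
  have "I n S'"
    unfolding S' doublings_def sem.simps(4) n(1)
  proof (rule loop_invariant)
    show "I 0 S" using assms by (auto simp: I_def intro!: exI[of _ 0])
    fix i u assume i: "i < n" and u: "I i u"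
    obtain l where l: "l \<le> i" "u ''t'' 0 = int (t0 + l)" "u ''w'' 0 = 2 ^ l" "(2::nat) ^ l \<le> 2 * n + 1" "min i n < 2 ^ l"
      using u by (auto simp: I_def)
    have le: "(2::int) ^ l \<le> int n \<longleftrightarrow> (2::nat) ^ l \<le> n"
      by (metis of_nat_le_iff of_nat_numeral of_nat_power)
    show "I (Suc i) (sem (CIf (ele (sc ''w'') (sc ''n''))
       (CSeq (CAssign ''w'' (EN 0) (EP (sc ''w'') (sc ''w''))) (CAssign ''t'' (EN 0) (EP (sc ''t'') (EN 1)))) CSkip) (\<rho>(''i'' := int i)) u)"
    proof (cases "(2::nat) ^ l \<le> n")
      case True
      then show ?thesis using u l i le unfolding I_def
        by (auto intro!: exI[of _ "Suc l"])
    next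
      case False
      then show ?thesis using u l i le unfolding I_def
        by (auto intro!: exI[of _ l])
    qed
  qed
  then show ?thesis using that by (auto simp: I_def)
qed

lemma prepare_correct:
  assumes n: "S ''n'' 0 = int n" and p: "S ''p'' 0 = p" and S': "S' = sem prepare_seeds \<rho> (sem prepare \<rho> S)"
  defines "U \<equiv> sem prepare \<rho> S"
  obtains l where "l \<le> n" "n < 2 ^ l" "2 ^ l \<le> 2 * n + 1"
    "U ''n'' 0 = int n" "U ''tt'' 0 = int (2 * (8 * nat p + 2 + l))"
    "S' ''M'' 0 = int (n * n + 1)" "S' ''M2'' 0 = int ((n * n + 1) ^ 2)" "S' ''M3'' 0 = int ((n * n + 1) ^ 3)"
    "S' ''K'' 0 = int ((n * n + 1) ^ 4)"
    "S' ''t'' 0 = int (8 * nat p + 2 + l)" "S' ''tt'' 0 = int (2 * (8 * nat p + 2 + l))"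
    "S' ''N'' 0 = int (2 ^ (2 * (8 * nat p + 2 + l)))"
    "\<And>x. x \<notin> {''M'', ''M2'', ''M3'', ''K'', ''t'', ''w'', ''tt'', ''N''} \<Longrightarrow> S' x = S x"
proof -
  let ?m = "int (n * n + 1)"
  define S1 where "S1 = S(''M'' := (S ''M'')(0 := ?m), ''M2'' := (S ''M2'')(0 := ?m ^ 2),
    ''M3'' := (S ''M3'')(0 := ?m ^ 3), ''K'' := (S ''K'')(0 := ?m ^ 4),
    ''t'' := (S ''t'')(0 := int (8 * nat p + 2)), ''w'' := (S ''w'')(0 := 1))"
  define S2 where "S2 = sem doublings \<rho> S1"
  have mul: "eval (mulM e) \<rho> u = ?m * c" if "\<And>i j. eval e (\<rho>(''i'' := i, ''j'' := j)) u = c" "eval e \<rho> u = c" "u ''n'' 0 = int n" for e u c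
    using that by (simp add: mulM_def algebra_simps)
  have m1: "eval (mulM (EN 1)) \<rho> u = ?m" if "u ''n'' 0 = int n" for u
    using mul[of "EN 1" _ 1] that by simp
  have m2: "eval (mulM (sc x)) \<rho> u = ?m * u x 0" if "u ''n'' 0 = int n" for u x
    using mul[of "sc x" u "u x 0"] that by simp
  have c0: "int (8 * nat p + 2) = (if p < 0 then 2 else 8 * p + 2)" by simp
  define T1 where "T1 = S(''M'' := (S ''M'')(0 := ?m))"
  define T2 where "T2 = T1(''M2'' := (S ''M2'')(0 := ?m ^ 2))"
  define T3 where "T3 = T2(''M3'' := (S ''M3'')(0 := ?m ^ 3))"
  define T4 where "T4 = T3(''K'' := (S ''K'')(0 := ?m ^ 4))"
  define T5 where "T5 = T4(''t'' := (S ''t'')(0 := if p < 0 then 0 else p + p))"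
  define T6 where "T6 = T5(''t'' := (S ''t'')(0 := if p < 0 then 0 else 4 * p))"
  define T7 where "T7 = T6(''t'' := (S ''t'')(0 := int (8 * nat p + 2)))"
  have T: "sem (CAssign ''M'' (EN 0) (mulM (EN 1))) \<rho> S = T1"
    "sem (CAssign ''M2'' (EN 0) (mulM (sc ''M''))) \<rho> T1 = T2"
    "sem (CAssign ''M3'' (EN 0) (mulM (sc ''M2''))) \<rho> T2 = T3"
    "sem (CAssign ''K'' (EN 0) (mulM (sc ''M3''))) \<rho> T3 = T4"
    "sem (CAssign ''t'' (EN 0) (EIf (ELt (sc ''p'') (EN 0)) (EN 0) (EP (sc ''p'') (sc ''p'')))) \<rho> T4 = T5"
    "sem (CAssign ''t'' (EN 0) (EP (sc ''t'') (sc ''t''))) \<rho> T5 = T6"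
    "sem (CAssign ''t'' (EN 0) (EP (EP (sc ''t'') (sc ''t'')) (EN 2))) \<rho> T6 = T7"
    "sem (CAssign ''w'' (EN 0) (EN 1)) \<rho> T7 = S1"
    unfolding T7_def S1_def c0
    by (simp_all add: m1 m2 T1_def T2_def T3_def T4_def T5_def T6_def fun_eq_iff n p power2_eq_square
      power3_eq_cube power4_eq_xxxx del: of_nat_mult of_nat_add)
  have U: "U = S2(''tt'' := (S2 ''tt'')(0 := S2 ''t'' 0 + S2 ''t'' 0), ''N'' := (S2 ''N'')(0 := 1))"
    unfolding U_def prepare_def seqs.simps sem.simps(2) T S2_def[symmetric] by simp
  obtain l where l: "S2 ''t'' 0 = int (8 * nat p + 2 + l)" "l \<le> n" "n < 2 ^ l" "2 ^ l \<le> 2 * n + 1"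
    by (rule doubling[of S1 n "8 * nat p + 2" S2 \<rho>]) (auto simp: S1_def S2_def n)
  have fr: "S2 x = S1 x" if "x \<noteq> ''w''" "x \<noteq> ''t''" for x
    unfolding S2_def by (rule sem_frame) (use that in \<open>auto simp: doublings_def\<close>)
  have tt: "U ''tt'' 0 = int (2 * (8 * nat p + 2 + l))" by (simp add: U l)
  have S'fr: "S' x = U x" if "x \<noteq> ''N''" for x
    unfolding S' U_def[symmetric] by (rule sem_frame) (use that in \<open>auto simp: prepare_seeds_def\<close>)
  have lp: "loop (\<lambda>i. sem (CAssign ''N'' (EN 0) (EP (sc ''N'') (sc ''N''))) (\<rho>(''i'' := int i))) m U ''N'' 0 = 2 ^ m" for m
    by (induction m) (auto simp: U)
  then have N: "S' ''N'' 0 = int (2 ^ (2 * (8 * nat p + 2 + l)))"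
    unfolding S' U_def[symmetric] prepare_seeds_def sem.simps(4) tt nat_int
    by (simp only: lp of_nat_power of_nat_numeral)
  show ?thesis
    by (rule that[OF l(2-4) _ tt _ _ _ _ _ _ N]) (auto simp: S'fr tt U l fr S1_def n)
qed

section \<open>The program and its verification\<close>

lemma pos_if [simp]: "0 < (if P then 1 else (0::int)) \<longleftrightarrow> P"
  by simp

section \<open>Program text: testing candidates, labelling components, subset sums\<close>

definition eout :: ex where
  "eout = ESum ''x'' ''n'' (ESum ''y'' ''n''
     (ecount_if (eand (ER ''c'' (EV ''x'')) (eand (enot (ER ''c'' (EV ''y''))) (eadj ''x'' ''y'')))))"

definition eidx :: "vname \<Rightarrow> vname \<Rightarrow> ex" where
  "eidx v u = EP (emul (EV v) (sc ''n'')) (EV u)"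

text \<open>The candidate is in \<open>c\<close>; on success it becomes row \<open>v\<close> of the
  matrix \<open>X\<close>. An earlier row may be overwritten, as any cluster containing
  \<open>v\<close> will do.\<close>

definition check :: "ex \<Rightarrow> cmd" where
  "check mu = CIf (eand mu (ele eout (sc ''q'')))
     (CSeq (CAssign ''ok'' (EV ''v'') (EN 1))
       (CFor ''u'' ''n'' (CAssign ''X'' (eidx ''v'' ''u'') (ER ''c'' (EV ''u''))))) CSkip"

definition eact :: "vname \<Rightarrow> ex" where
  "eact x = eand (ER ''r'' (EV x)) (enot (eeq (EV x) (EV ''v'')))"

text \<open>Both labels are saved in scalars because the loop overwrites the cells they were read
  from.\<close>

definition relabel :: cmd where
  "relabel = seqs [
     CAssign ''old'' (EN 0) (ER ''lab'' (EV ''y'')),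
     CAssign ''new'' (EN 0) (ER ''lab'' (EV ''x'')),
     CFor ''z'' ''n'' (CAssign ''lab'' (EV ''z'')
       (EIf (eeq (ER ''lab'' (EV ''z'')) (sc ''old'')) (sc ''new'') (ER ''lab'' (EV ''z''))))]"

text \<open>A single pass over the pairs suffices: merging renames a whole class, so labels made
  equal earlier stay equal.\<close>

definition label :: cmd where
  "label = CSeq (CFor ''x'' ''n'' (CAssign ''lab'' (EV ''x'') (EV ''x'')))
     (CFor ''x'' ''n'' (CFor ''y'' ''n''
       (CIf (eand (eact ''x'') (eand (eact ''y'') (eadj ''x'' ''y''))) relabel CSkip)))"

definition ecls :: "vname \<Rightarrow> ex" where
  "ecls x = eand (eact x) (eeq (ER ''lab'' (EV x)) (EV ''l''))"

definition ecls_v :: "vname \<Rightarrow> ex" where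
  "ecls_v x = eor (ecls x) (eeq (EV x) (EV ''v''))"

text \<open>The key summed vertex by vertex: \<open>x\<close> contributes 1, then \<open>M\<close>
  if adjacent to \<open>v\<close>, and for every neighbour \<open>M3\<close>, increased by
  \<open>M2\<close> if the neighbour is \<open>v\<close> or in the class.\<close>

definition ekey :: ex where
  "ekey = ESum ''x'' ''n'' (EIf (ecls ''x'')
     (EP (EP (EN 1) (EIf (eadj ''x'' ''v'') (sc ''M'') (EN 0)))
       (ESum ''y'' ''n'' (EIf (eadj ''x'' ''y'') (EP (sc ''M3'') (EIf (ecls_v ''y'') (sc ''M2'') (EN 0))) (EN 0))))
     (EN 0))"

definition elight :: ex where
  "elight = ESum ''x'' ''n'' (ecount_if (eand (ecls ''x'')
     (ELt (ESum ''y'' ''n'' (ecount_if (eand (ecls_v ''y'') (eadj ''x'' ''y'')))) (EV ''h''))))"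

text \<open>\<open>sol\<close> is a table with one row of length \<open>K\<close> per vertex; column
  \<open>k\<close> is a vertex set realising the key sum \<open>k\<close>.\<close>

definition copy_solution :: cmd where
  "copy_solution = CFor ''u'' ''n'' (CAssign ''sol'' (EP (emul (EV ''u'') (sc ''K'')) (sc ''tgt''))
     (EIf (ecls ''u'') (EN 1) (ER ''sol'' (EP (emul (EV ''u'') (sc ''K'')) (EM (sc ''tgt'') (sc ''kap''))))))"

text \<open>Targets descend, as usual for subset sums in a single array: the entry at
  \<open>tgt - kap\<close> still belongs to the previous stage, so no class is used twice. Sums
  already reached keep their solution.\<close>

definition add_class :: cmd where
  "add_class = CSeq (CAssign ''kap'' (EN 0) ekey)
     (CFor ''i'' ''K'' (CSeq (CAssign ''tgt'' (EN 0) (EM (EM (sc ''K'') (EN 1)) (EV ''i'')))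
       (CIf (eand (ELt (ER ''reach'' (sc ''tgt'')) (EN 1))
              (eand (ele (sc ''kap'') (sc ''tgt'')) (ER ''reach'' (EM (sc ''tgt'') (sc ''kap'')))))
         (CSeq (CAssign ''reach'' (sc ''tgt'') (EN 1))
           copy_solution)
         CSkip)))"

text \<open>Of \<open>sol\<close> only column 0 is cleared, for the empty union; any other column is
  read only after its sum has been marked in \<open>reach\<close>, when it has been written.\<close>

definition subset_sums :: cmd where
  "subset_sums = seqs [
     CFor ''k'' ''K'' (CAssign ''reach'' (EV ''k'') (EN 0)),
     CFor ''u'' ''n'' (CAssign ''sol'' (emul (EV ''u'') (sc ''K'')) (EN 0)),
     CAssign ''reach'' (EN 0) (EN 1),
     CFor ''l'' ''n'' (CIf (ELt elight (EN 1)) add_class CSkip)]"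

section \<open>Memory layout and the invariant of stored clusters\<close>

locale run = ugraph n E for n E +
  fixes p q :: int and \<mu> :: "nat set \<Rightarrow> nat" and mu :: ex
begin

abbreviation M :: nat where "M \<equiv> n * n + 1"

abbreviation K :: nat where "K \<equiv> (n * n + 1) ^ 4"

definition base :: "state \<Rightarrow> bool" where
  "base S \<longleftrightarrow> S ''n'' 0 = int n \<and> S ''p'' 0 = p \<and> S ''q'' 0 = q \<and>
     (\<forall>u<n. \<forall>v<n. S ''adj'' (int u * int n + int v) = of_bool (E u v)) \<and>
     S ''M'' 0 = int M \<and> S ''M2'' 0 = int (M ^ 2) \<and> S ''M3'' 0 = int (M ^ 3) \<and> S ''K'' 0 = int K"

definition cset :: "state \<Rightarrow> vname \<Rightarrow> nat set" where
  "cset S a = {u. u < n \<and> 0 < S a (int u)}"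

definition row :: "state \<Rightarrow> nat \<Rightarrow> nat set" where
  "row S v = {u. u < n \<and> 0 < S ''X'' (int v * int n + int u)}"

definition input_names :: "vname set" where
  "input_names = {''n'', ''p'', ''q'', ''adj'', ''M'', ''M2'', ''M3'', ''K''}"

lemma base_frame: "base S \<Longrightarrow> (\<And>x. x \<in> input_names \<Longrightarrow> S' x = S x) \<Longrightarrow> base S'"
  unfolding base_def input_names_def by simp

lemma base_sem: "base S \<Longrightarrow> writes c \<inter> input_names = {} \<Longrightarrow> base (sem c \<rho> S)"
  by (erule base_frame) (rule sem_frame, auto)

lemma base_n: "base S \<Longrightarrow> S ''n'' 0 = int n"
  by (simp add: base_def)

lemma base_K: "base S \<Longrightarrow> S ''K'' 0 = int K"
  by (simp add: base_def)

lemma eval_emul: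
  assumes "base S" "\<And>j. eval e (\<rho>(''#'' := j)) S = c" "0 \<le> \<rho> u" "\<rho> u \<le> int n" "u \<noteq> ''#''"
  shows "eval (emul (EV u) e) \<rho> S = \<rho> u * c"
  using sum_if_less[of "nat (\<rho> u)" n c] assms by (simp add: emul_def base_n cong: if_cong)

lemma eval_eadj:
  assumes "base S" "0 \<le> \<rho> x" "\<rho> x < int n" "0 \<le> \<rho> y" "\<rho> y < int n" "x \<noteq> ''#''"
  shows "0 < eval (eadj x y) \<rho> S \<longleftrightarrow> E (nat (\<rho> x)) (nat (\<rho> y))"
proof -
  have "eval (emul (EV x) (sc ''n'')) \<rho> S = \<rho> x * int n"
    using assms by (intro eval_emul) (auto simp: base_n)
  moreover have "S ''adj'' (int (nat (\<rho> x)) * int n + int (nat (\<rho> y))) = of_bool (E (nat (\<rho> x)) (nat (\<rho> y)))"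
    using assms unfolding base_def by (metis nat_less_iff)
  ultimately show ?thesis using assms by (simp add: eadj_def)
qed

lemma eval_eidx:
  assumes "base S" "0 \<le> \<rho> x" "\<rho> x < int n" "x \<noteq> ''#''"
  shows "eval (eidx x y) \<rho> S = \<rho> x * int n + \<rho> y"
  using assms by (simp add: eidx_def eval_emul base_n)

lemma int_deg: "B \<subseteq> {..<n} \<Longrightarrow> (\<Sum>y<n. if y \<in> B \<and> E x y then 1 else 0) = int (deg B x)"
proof -
  assume "B \<subseteq> {..<n}"
  then have "{y \<in> B. E x y} = {..<n} \<inter> {y. y \<in> B \<and> E x y}" by auto
  then show ?thesis by (simp add: deg_def sum.If_cases)
qed

lemma int_ecount:
  assumes "A \<subseteq> {..<n}" "B \<subseteq> {..<n}"
  shows "(\<Sum>x<n. \<Sum>y<n. if x \<in> A \<and> y \<in> B \<and> E x y then 1 else 0) = int (ecount A B)"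
proof -
  have "(\<Sum>x<n. \<Sum>y<n. if x \<in> A \<and> y \<in> B \<and> E x y then 1 else 0) = (\<Sum>x<n. if x \<in> A then int (deg B x) else 0)"
    using int_deg[OF assms(2)] by (intro sum.cong) auto
  also have "\<dots> = (\<Sum>x\<in>A. int (deg B x))"
    using assms(1) by (simp add: sum.If_cases Int_absorb1)
  finally show ?thesis by (simp add: ecount_def)
qed

lemma cset_subset: "cset S a \<subseteq> {..<n}"
  by (auto simp: cset_def)

lemma row_subset: "row S v \<subseteq> {..<n}"
  by (auto simp: row_def)

lemma eval_eout:
  assumes "base S"
  shows "eval eout \<rho> S = int (out (cset S ''c''))"
proof -
  have "eval eout \<rho> S = (\<Sum>x<n. \<Sum>y<n. if x \<in> cset S ''c'' \<and> y \<in> {..<n} - cset S ''c'' \<and> E x y then 1 else 0)"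
    unfolding eout_def using assms
    by (auto simp: base_n eval_eadj cset_def intro!: sum.cong)
  also have "\<dots> = int (out (cset S ''c''))"
    using cset_subset by (intro int_ecount) auto
  finally show ?thesis .
qed

lemma row_index_inject:
  assumes "u < n" "u' < n" "int w * int n + int u = int v * int n + int u'"
  shows "w = v \<and> u = u'"
proof -
  have eq: "w * n + u = v * n + u'"
    using assms(3) by (metis of_nat_add of_nat_eq_iff of_nat_mult)
  have "(w * n + u) div n = w" "(v * n + u') div n = v" "(w * n + u) mod n = u" "(v * n + u') mod n = u'"
    using assms by auto
  then show ?thesis using eq by metis
qed

definition valid :: "nat \<Rightarrow> nat set \<Rightarrow> bool" where
  "valid v C \<longleftrightarrow> v \<in> C \<and> int (\<mu> C) \<le> p \<and> int (out C) \<le> q"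

definition solved :: "state \<Rightarrow> nat \<Rightarrow> bool" where
  "solved S v \<longleftrightarrow> 0 < S ''ok'' (int v)"

text \<open>Most colourings lead to meaningless candidates. Soundness is therefore an invariant of
  the stored rows alone, and completeness is argued separately through
  \<open>progress\<close>.\<close>

definition good :: "state \<Rightarrow> bool" where
  "good S \<longleftrightarrow> base S \<and> (\<forall>v<n. solved S v \<longrightarrow> valid v (row S v))"

definition progress :: "state \<Rightarrow> state \<Rightarrow> bool" where
  "progress S S' \<longleftrightarrow> (\<forall>v. solved S v \<longrightarrow> solved S' v)"

lemma good_base: "good S \<Longrightarrow> base S"
  by (simp add: good_def)

lemma progress_refl: "progress S S"
  by (simp add: progress_def)

lemma progress_trans: "progress S S' \<Longrightarrow> progress S' S'' \<Longrightarrow> progress S S''"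
  by (simp add: progress_def)

lemma
  assumes "writes c \<inter> insert ''ok'' (insert ''X'' input_names) = {}"
  shows good_sem: "good S \<Longrightarrow> good (sem c \<rho> S)" and progress_sem: "progress S (sem c \<rho> S)"
proof -
  have "sem c \<rho> S ''ok'' = S ''ok''" "sem c \<rho> S ''X'' = S ''X''"
    using assms by (simp_all add: sem_frame)
  moreover have "base S \<Longrightarrow> base (sem c \<rho> S)" by (rule base_sem) (use assms in simp_all)
  ultimately show "good S \<Longrightarrow> good (sem c \<rho> S)" "progress S (sem c \<rho> S)"
    by (simp_all add: good_def progress_def solved_def row_def)
qed

definition mu_spec :: bool where
  "mu_spec \<longleftrightarrow> (\<forall>\<rho> S. base S \<longrightarrow> cset S ''c'' \<noteq> {} \<longrightarrow> (0 < eval mu \<rho> S \<longleftrightarrow> int (\<mu> (cset S ''c'')) \<le> p))"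

definition row_updated :: "state \<Rightarrow> state \<Rightarrow> nat \<Rightarrow> nat set \<Rightarrow> bool" where
  "row_updated S S' v R \<longleftrightarrow> (\<forall>y. y \<noteq> ''X'' \<longrightarrow> S' y = S y) \<and> row S' v = R \<and>
     (\<forall>w<n. w \<noteq> v \<longrightarrow> row S' w = row S w)"

lemma row_updated_base: "row_updated S S' v R \<Longrightarrow> base S \<Longrightarrow> base S'"
  by (erule base_frame) (auto simp: row_updated_def input_names_def)

text \<open>The new value may depend on the row being rewritten, at the current index only, and on
  all other rows. This covers both copying a candidate into a row and trimming a row in
  place.\<close>

lemma row_update:
  fixes S idx e \<rho> x
  defines "S' \<equiv> sem (CFor ''u'' ''n'' (CAssign ''X'' (eidx x ''u'') e)) \<rho> S"
  assumes base: "base S" and x: "\<rho> x = int v" "v < n" "x \<noteq> ''#''" "x \<noteq> ''u''"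
    and e: "\<And>u T. u < n \<Longrightarrow> base T \<Longrightarrow> (\<And>y. y \<noteq> ''X'' \<Longrightarrow> T y = S y) \<Longrightarrow>
       (\<And>w. w < n \<Longrightarrow> w \<noteq> v \<Longrightarrow> row T w = row S w) \<Longrightarrow> (u \<in> row T v \<longleftrightarrow> u \<in> row S v) \<Longrightarrow>
       0 < eval e (\<rho>(''u'' := int u)) T \<longleftrightarrow> u \<in> R"
    and R: "R \<subseteq> {..<n}"
  shows "row_updated S S' v R"
proof -
  define I where "I i T \<longleftrightarrow> (\<forall>y. y \<noteq> ''X'' \<longrightarrow> T y = S y) \<and> (\<forall>w<n. w \<noteq> v \<longrightarrow> row T w = row S w) \<and>
    (\<forall>u<n. u \<in> row T v \<longleftrightarrow> (if u < i then u \<in> R else u \<in> row S v))" for i and T :: state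
  have "I n S'"
    unfolding S'_def sem.simps(4) base_n[OF base] nat_int
  proof (rule loop_invariant)
    show "I 0 S" by (simp add: I_def)
    fix i T assume i: "i < n" and T: "I i T"
    have bT: "base T" using base T by (elim base_frame) (auto simp: I_def input_names_def)
    let ?r = "\<rho>(''u'' := int i)"
    have ix: "eval (eidx x ''u'') ?r T = int v * int n + int i"
      using x bT by (simp add: eval_eidx)
    have ev: "0 < eval e ?r T \<longleftrightarrow> i \<in> R"
      using T bT i by (intro e) (auto simp: I_def)
    show "I (Suc i) (sem (CAssign ''X'' (eidx x ''u'') e) ?r T)"
      unfolding I_def
    proof (intro conjI allI impI)
      fix w assume w: "w < n" "w \<noteq> v"
      have "row (sem (CAssign ''X'' (eidx x ''u'') e) ?r T) w = row T w"
        unfolding row_def using row_index_inject[of _ i w v] i w by (auto simp: ix)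
      then show "row (sem (CAssign ''X'' (eidx x ''u'') e) ?r T) w = row S w"
        using T w by (simp add: I_def)
    next
      fix u assume u: "u < n"
      have "u \<in> row (sem (CAssign ''X'' (eidx x ''u'') e) ?r T) v \<longleftrightarrow> (if u = i then i \<in> R else u \<in> row T v)"
        unfolding row_def using u i by (auto simp: ix ev)
      then show "u \<in> row (sem (CAssign ''X'' (eidx x ''u'') e) ?r T) v \<longleftrightarrow> (if u < Suc i then u \<in> R else u \<in> row S v)"
        using T u by (auto simp: I_def less_Suc_eq)
    qed (use T in \<open>auto simp: I_def\<close>)
  qed
  then show ?thesis
    using R row_subset[of S' v] by (auto simp: I_def row_updated_def)
qed

lemma check_correct:
  fixes S \<rho>
  defines "S' \<equiv> sem (check mu) \<rho> S"
  assumes spec: mu_spec and good: "good S" and v: "\<rho> ''v'' = int v" "v < n" "v \<in> cset S ''c''"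
  shows "good S'" "progress S S'" "x \<noteq> ''ok'' \<Longrightarrow> x \<noteq> ''X'' \<Longrightarrow> S' x = S x"
    "valid v (cset S ''c'') \<Longrightarrow> solved S' v"
proof -
  have base: "base S" using good by (rule good_base)
  have cond: "0 < eval (eand mu (ele eout (sc ''q''))) \<rho> S \<longleftrightarrow> valid v (cset S ''c'')"
    using spec base v by (auto simp: mu_spec_def valid_def eval_eout) (auto simp: base_def)
  show fr: "x \<noteq> ''ok'' \<Longrightarrow> x \<noteq> ''X'' \<Longrightarrow> S' x = S x" for x
    unfolding S'_def by (rule sem_frame) (auto simp: check_def)
  have "good S' \<and> progress S S' \<and> (valid v (cset S ''c'') \<longrightarrow> solved S' v)"
  proof (cases "valid v (cset S ''c'')")
    case False
    then have "S' = S" by (simp only: S'_def check_def sem.simps cond if_False)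
    then show ?thesis using good False by (simp add: progress_refl)
  next
    case True
    define S1 where "S1 = S(''ok'' := (S ''ok'')(int v := 1))"
    have S': "S' = sem (CFor ''u'' ''n'' (CAssign ''X'' (eidx ''v'' ''u'') (ER ''c'' (EV ''u'')))) \<rho> S1"
      using True by (simp only: S'_def check_def sem.simps(2,3) cond if_True) (simp add: S1_def v)
    have b1: "base S1" using base by (rule base_frame) (auto simp: S1_def input_names_def)
    have cS1: "cset S1 ''c'' = cset S ''c''" by (simp add: cset_def S1_def)
    have e: "0 < eval (ER ''c'' (EV ''u'')) (\<rho>(''u'' := int u)) T \<longleftrightarrow> u \<in> cset S ''c''"
      if "u < n" "\<And>y. y \<noteq> ''X'' \<Longrightarrow> T y = S1 y" for u T
      using that by (simp add: cset_def S1_def)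
    have upd: "row_updated S1 S' v (cset S ''c'')"
      unfolding S'
    proof (rule row_update)
      show "0 < eval (ER ''c'' (EV ''u'')) (\<rho>(''u'' := int u)) T \<longleftrightarrow> u \<in> cset S ''c''"
        if "u < n" "\<And>y. y \<noteq> ''X'' \<Longrightarrow> T y = S1 y" for u T
        using that by (simp add: cset_def S1_def)
    qed (use b1 v cset_subset in auto)
    have "base S'" using row_updated_base[OF upd b1] .
    have solved': "solved S' w \<longleftrightarrow> w = v \<or> solved S w" for w
      using upd by (auto simp: solved_def S1_def row_updated_def)
    have "row S1 w = row S w" for w by (simp add: row_def S1_def)
    then have "good S'"
      using upd \<open>base S'\<close> good solved' True unfolding good_def row_updated_def by metis
    then show ?thesis using solved' by (auto simp: progress_def)
  qed
  then show "good S'" "progress S S'" "valid v (cset S ''c'') \<Longrightarrow> solved S' v" by auto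
qed

section \<open>Correctness of the component labelling\<close>

text \<open>The invariant of the merging process: \<open>D\<close> holds of the pairs already
  treated, and the last clause says that no class has spread beyond what edges force.\<close>

definition labelled :: "nat set \<Rightarrow> (nat \<Rightarrow> nat \<Rightarrow> bool) \<Rightarrow> (nat \<Rightarrow> int) \<Rightarrow> bool" where
  "labelled A D f \<longleftrightarrow> (\<forall>x<n. 0 \<le> f x \<and> f x < int n) \<and>
     (\<forall>x\<in>A. \<forall>y\<in>A. D x y \<longrightarrow> E x y \<longrightarrow> f x = f y) \<and>
     (\<forall>C. C \<subseteq> A \<longrightarrow> (\<forall>x\<in>C. \<forall>y\<in>A. E x y \<longrightarrow> y \<in> C) \<longrightarrow>
        (\<forall>x\<in>A. \<forall>y\<in>A. f x = f y \<longrightarrow> x \<in> C \<longrightarrow> y \<in> C))"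

lemma
  assumes "labelled A D f"
  shows labelled_range: "x < n \<Longrightarrow> 0 \<le> f x \<and> f x < int n"
    and labelled_edge: "x \<in> A \<Longrightarrow> y \<in> A \<Longrightarrow> D x y \<Longrightarrow> E x y \<Longrightarrow> f x = f y"
    and labelled_closed: "C \<subseteq> A \<Longrightarrow> (\<forall>x\<in>C. \<forall>y\<in>A. E x y \<longrightarrow> y \<in> C) \<Longrightarrow>
      x \<in> A \<Longrightarrow> y \<in> A \<Longrightarrow> f x = f y \<Longrightarrow> x \<in> C \<Longrightarrow> y \<in> C"
proof -
  note a = assms[unfolded labelled_def]
  show "x < n \<Longrightarrow> 0 \<le> f x \<and> f x < int n" using a[THEN conjunct1] by blast
  show "x \<in> A \<Longrightarrow> y \<in> A \<Longrightarrow> D x y \<Longrightarrow> E x y \<Longrightarrow> f x = f y"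
    by (rule a[THEN conjunct2, THEN conjunct1, THEN bspec, THEN bspec, THEN mp, THEN mp])
  show "C \<subseteq> A \<Longrightarrow> (\<forall>x\<in>C. \<forall>y\<in>A. E x y \<longrightarrow> y \<in> C) \<Longrightarrow>
      x \<in> A \<Longrightarrow> y \<in> A \<Longrightarrow> f x = f y \<Longrightarrow> x \<in> C \<Longrightarrow> y \<in> C"
    by (rule a[THEN conjunct2, THEN conjunct2, THEN spec, THEN mp, THEN mp, THEN bspec, THEN bspec, THEN mp, THEN mp])
qed

lemma labelled_mono: "labelled A D f \<Longrightarrow> (\<And>x y. x \<in> A \<Longrightarrow> y \<in> A \<Longrightarrow> E x y \<Longrightarrow> D' x y \<Longrightarrow> D x y) \<Longrightarrow> labelled A D' f"
proof -
  assume L: "labelled A D f" and D: "\<And>x y. x \<in> A \<Longrightarrow> y \<in> A \<Longrightarrow> E x y \<Longrightarrow> D' x y \<Longrightarrow> D x y"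
  show ?thesis
    unfolding labelled_def
  proof (intro conjI)
    show "\<forall>x\<in>A. \<forall>y\<in>A. D' x y \<longrightarrow> E x y \<longrightarrow> f x = f y"
      by (intro ballI impI, rule labelled_edge[OF L]) (rule D | assumption)+
  qed (rule L[unfolded labelled_def, THEN conjunct1] L[unfolded labelled_def, THEN conjunct2, THEN conjunct2])+
qed

text \<open>The merge respects every neighbour-closed set because such a set contains both of
  \<open>x\<close> and \<open>y\<close> or neither, and by induction the two old classes lie inside
  or outside together with them.\<close>

lemma labelled_merge:
  assumes f: "labelled A D f" and A: "A \<subseteq> {..<n}" and xy: "x \<in> A" "y \<in> A" "E x y"
    and g: "\<And>z. z < n \<Longrightarrow> g z = (if f z = f y then f x else f z)"
    and D: "\<And>a b. D' a b \<Longrightarrow> D a b \<or> (a = x \<and> b = y)"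
  shows "labelled A D' g"
  unfolding labelled_def
proof (intro conjI allI impI ballI)
  have An: "z < n" if "z \<in> A" for z using A that by auto
  fix z assume z: "z < n"
  then show "0 \<le> g z" "g z < int n" using labelled_range[OF f] An[OF xy(1)] by (simp_all add: g)
next
  have An: "z < n" if "z \<in> A" for z using A that by auto
  fix a b assume ab: "a \<in> A" "b \<in> A" "D' a b" "E a b"
  show "g a = g b"
  proof (cases "a = x \<and> b = y")
    case True
    then show ?thesis using An xy by (simp add: g)
  next
    case False
    then have "f a = f b" using D[OF ab(3)] ab labelled_edge[OF f] by blast
    then show ?thesis using An ab by (simp add: g)
  qed
next
  have An: "z < n" if "z \<in> A" for z using A that by auto
  fix C a b assume C: "C \<subseteq> A" "\<forall>x\<in>C. \<forall>y\<in>A. E x y \<longrightarrow> y \<in> C" and ab: "a \<in> A" "b \<in> A" "g a = g b" "a \<in> C"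
  have cl: "z' \<in> C" if "z \<in> A" "z' \<in> A" "f z = f z'" "z \<in> C" for z z'
    by (rule labelled_closed[OF f C that])
  have xyC: "x \<in> C \<longleftrightarrow> y \<in> C" using C(2) xy sym by blast
  have gab: "g a = (if f a = f y then f x else f a)" "g b = (if f b = f y then f x else f b)"
    using An ab by (simp_all add: g)
  show "b \<in> C"
  proof (cases "f a = f b")
    case True
    then show ?thesis using cl ab by blast
  next
    case False
    then consider "f a = f y" "f b = f x" | "f b = f y" "f a = f x"
      using ab(3) unfolding gab by (auto split: if_splits)
    then show ?thesis
    proof cases
      case 1
      then have "y \<in> C" using cl[of a y] ab xy by blast
      then show ?thesis using cl[of x b] 1 ab xy xyC by simp
    next
      case 2
      then have "x \<in> C" using cl[of a x] ab xy by blast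
      then show ?thesis using cl[of y b] 2 ab xy xyC by simp
    qed
  qed
qed

definition colour :: "state \<Rightarrow> nat \<Rightarrow> bool" where
  "colour S x \<longleftrightarrow> 0 < S ''r'' (int x)"

definition labels :: "state \<Rightarrow> nat \<Rightarrow> nat" where
  "labels S x = nat (S ''lab'' (int x))"

abbreviation actives :: "state \<Rightarrow> nat \<Rightarrow> nat set" where
  "actives S v \<equiv> coloured_graph.active n v (colour S)"

lemma actives_iff: "v < n \<Longrightarrow> x \<in> actives S v \<longleftrightarrow> x < n \<and> x \<noteq> v \<and> colour S x"
proof -
  assume "v < n"
  then interpret coloured_graph n E v "colour S" "labels S" by unfold_locales
  show ?thesis by (simp add: active_def)
qed

lemma eval_eact:
  assumes "v < n" "\<rho> ''v'' = int v" "0 \<le> \<rho> x" "\<rho> x < int n"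
  shows "0 < eval (eact x) \<rho> S \<longleftrightarrow> nat (\<rho> x) \<in> actives S v"
  using assms by (auto simp: eact_def actives_iff colour_def)

definition label_spec :: "state \<Rightarrow> nat \<Rightarrow> bool" where
  "label_spec S v \<longleftrightarrow> labelled (actives S v) (\<lambda>_ _. True) (\<lambda>x. S ''lab'' (int x))"

lemma relabel_correct:
  assumes base: "base S" and v: "v < n" and xy: "x < n" "y < n" "\<rho> ''x'' = int x" "\<rho> ''y'' = int y"
  shows "z < n \<Longrightarrow> sem relabel \<rho> S ''lab'' (int z) =
    (if S ''lab'' (int z) = S ''lab'' (int y) then S ''lab'' (int x) else S ''lab'' (int z))"
proof -
  assume z: "z < n"
  define S1 where "S1 = S(''old'' := (S ''old'')(0 := S ''lab'' (int y)), ''new'' := (S ''new'')(0 := S ''lab'' (int x)))"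
  have S: "sem relabel \<rho> S = sem (CFor ''z'' ''n'' (CAssign ''lab'' (EV ''z'')
       (EIf (eeq (ER ''lab'' (EV ''z'')) (sc ''old'')) (sc ''new'') (ER ''lab'' (EV ''z''))))) \<rho> S1"
    using xy by (simp add: relabel_def S1_def)
  have n: "nat (S1 ''n'' 0) = n" using base by (simp add: S1_def base_n)
  show ?thesis
    unfolding S
  proof (rule for_fill(2)[where g = int and m = n and k = "''n''" and S = S1 and
        w = "\<lambda>z. if S ''lab'' (int z) = S ''lab'' (int y) then S ''lab'' (int x) else S ''lab'' (int z)", OF _ n _ z])
    fix i T assume T: "\<And>x. x \<noteq> ''lab'' \<Longrightarrow> T x = S1 x" "\<And>j. j \<notin> int ` {..<i} \<Longrightarrow> T ''lab'' j = S1 ''lab'' j"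
    have "T ''lab'' (int i) = S ''lab'' (int i)" using T(2)[of "int i"] by (simp add: S1_def image_iff)
    then show "eval (EV ''z'') (\<rho>(''z'' := int i)) T = int i \<and>
        eval (EIf (eeq (ER ''lab'' (EV ''z'')) (sc ''old'')) (sc ''new'') (ER ''lab'' (EV ''z''))) (\<rho>(''z'' := int i)) T
        = (if S ''lab'' (int i) = S ''lab'' (int y) then S ''lab'' (int x) else S ''lab'' (int i))"
      using T(1) by (simp add: S1_def)
  qed simp
qed

lemma label_correct:
  assumes base: "base S" and v: "v < n" "\<rho> ''v'' = int v"
  shows "label_spec (sem label \<rho> S) v"
proof -
  define c where "c = CIf (eand (eact ''x'') (eand (eact ''y'') (eadj ''x'' ''y''))) relabel CSkip"
  define S0 where "S0 = sem (CFor ''x'' ''n'' (CAssign ''lab'' (EV ''x'') (EV ''x''))) \<rho> S"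
  have wc: "writes c = {''lab'', ''old'', ''new''}" by (auto simp: c_def relabel_def)
  have S0lab: "S0 ''lab'' (int x) = int x" if "x < n" for x
    unfolding S0_def
    by (rule for_fill(2)[where g = int and m = n and k = "''n''" and S = S, OF _ _ _ that])
      (auto simp: inj_on_def base base_n)
  have S0fr: "S0 x = S x" if "x \<noteq> ''lab''" for x
    unfolding S0_def by (rule sem_frame) (use that in simp)
  define A where "A = actives S v"
  have An: "A \<subseteq> {..<n}" using v by (auto simp: A_def actives_iff)
  define I where "I D T \<longleftrightarrow> labelled A D (\<lambda>x. T ''lab'' (int x)) \<and>
    (\<forall>x. x \<notin> {''lab'', ''old'', ''new''} \<longrightarrow> T x = S x)" for D and T :: state
  have Ibase: "base T" if "I D T" for D T
  proof (rule base_frame[OF base])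
    fix x assume "x \<in> input_names"
    then have "x \<notin> {''lab'', ''old'', ''new''}" by (auto simp: input_names_def)
    then show "T x = S x" using that unfolding I_def by blast
  qed
  \<comment> \<open>The treated pairs are those lexicographically before the current one.\<close>
  have step: "I (\<lambda>x y. x < i \<or> x = i \<and> y < Suc j) (sem c (\<rho>(''x'' := int i, ''y'' := int j)) T)"
    if T: "I (\<lambda>x y. x < i \<or> x = i \<and> y < j) T" and ij: "i < n" "j < n" for i j T
  proof -
    let ?r = "\<rho>(''x'' := int i, ''y'' := int j)"
    have bT: "base T" using Ibase T .
    have "T ''r'' = S ''r''" using T unfolding I_def by (elim conjE allE[of _ "''r''"]) simp
    then have AT: "actives T v = A" unfolding A_def using v by (simp add: set_eq_iff actives_iff colour_def)
    have cond: "0 < eval (eand (eact ''x'') (eand (eact ''y'') (eadj ''x'' ''y''))) ?r T \<longleftrightarrow> i \<in> A \<and> j \<in> A \<and> E i j"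
      using v ij bT by (simp add: eval_eact[OF v(1)] eval_eadj AT)
    have fr: "\<forall>x. x \<notin> {''lab'', ''old'', ''new''} \<longrightarrow> sem c ?r T x = S x"
      using T sem_frame[of _ c ?r T] by (simp add: I_def wc)
    show ?thesis
    proof (cases "i \<in> A \<and> j \<in> A \<and> E i j")
      case True
      then have eq: "sem c ?r T = sem relabel ?r T" by (simp only: c_def sem.simps(3) cond) simp
      have "labelled A (\<lambda>x y. x < i \<or> x = i \<and> y < Suc j) (\<lambda>x. sem c ?r T ''lab'' (int x))"
      proof (rule labelled_merge[of A _ "\<lambda>x. T ''lab'' (int x)" i j])
        show "sem c ?r T ''lab'' (int z) = (if T ''lab'' (int z) = T ''lab'' (int j) then T ''lab'' (int i) else T ''lab'' (int z))"
          if "z < n" for z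
          unfolding eq by (rule relabel_correct[OF bT v(1) ij _ _ that]) auto
        show "labelled A (\<lambda>x y. x < i \<or> x = i \<and> y < j) (\<lambda>x. T ''lab'' (int x))"
          using T by (simp only: I_def)
      qed (use An True in auto)
      then show ?thesis using fr by (simp add: I_def)
    next
      case False
      then have eq: "sem c ?r T = T" by (simp only: c_def sem.simps cond False if_False)
      have "labelled A (\<lambda>x y. x < i \<or> x = i \<and> y < Suc j) (\<lambda>x. T ''lab'' (int x))"
        using T False unfolding I_def by (elim conjE labelled_mono) (auto simp: less_Suc_eq)
      then show ?thesis using T by (simp add: eq I_def)
    qed
  qed
  have n0: "nat (T ''n'' 0) = n" if "I D T" for D T using Ibase[OF that] by (simp add: base_n)
  have "I (\<lambda>x y. x < n) (loop (\<lambda>i. sem (CFor ''y'' ''n'' c) (\<rho>(''x'' := int i))) n S0)"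
  proof (rule loop_invariant[where P = "\<lambda>i. I (\<lambda>x y. x < i)"])
    have "labelled A (\<lambda>_ _. False) (\<lambda>x. S0 ''lab'' (int x))"
      using An by (auto simp: labelled_def S0lab subset_iff)
    then show "I (\<lambda>x y. x < 0) S0" using S0fr by (simp add: I_def)
    fix i T assume i: "i < n" and T: "I (\<lambda>x y. x < i) T"
    have "I (\<lambda>x y. x < i \<or> x = i \<and> y < n) (loop (\<lambda>j. sem c (\<rho>(''x'' := int i, ''y'' := int j))) n T)"
    proof (rule loop_invariant[where P = "\<lambda>j. I (\<lambda>x y. x < i \<or> x = i \<and> y < j)"])
      show "I (\<lambda>x y. x < i \<or> x = i \<and> y < 0) T" using T by simp
    qed (rule step[OF _ i])
    then show "I (\<lambda>x y. x < Suc i) (sem (CFor ''y'' ''n'' c) (\<rho>(''x'' := int i)) T)"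
      unfolding I_def sem.simps(4) n0[OF T] using An
      by (elim conjE, intro conjI, elim labelled_mono) (auto simp: less_Suc_eq)
  qed
  moreover have "sem label \<rho> S = loop (\<lambda>i. sem (CFor ''y'' ''n'' c) (\<rho>(''x'' := int i))) n S0"
    unfolding label_def sem.simps(2) S0_def[symmetric] c_def[symmetric]
    by (subst sem.simps(4)) (simp add: base_n[OF base] S0fr)
  ultimately have "I (\<lambda>x y. x < n) (sem label \<rho> S)" by simp
  then have L: "labelled A (\<lambda>x y. x < n) (\<lambda>x. sem label \<rho> S ''lab'' (int x))" and
    fr: "sem label \<rho> S ''r'' = S ''r''" unfolding I_def by (blast, elim conjE allE[of _ "''r''"], simp)
  have "actives (sem label \<rho> S) v = A" unfolding A_def using v by (simp add: set_eq_iff actives_iff colour_def fr)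
  then show ?thesis using L An unfolding label_spec_def by (simp only:) (elim labelled_mono, auto)
qed

lemma label_spec_component_labelling:
  assumes "label_spec S v" "v < n"
  shows "coloured_graph.component_labelling n E v (colour S) (labels S)"
proof -
  interpret coloured_graph n E v "colour S" "labels S" by unfold_locales (rule assms(2))
  have pos: "0 \<le> S ''lab'' (int x)" "S ''lab'' (int x) < int n" if "x < n" for x
    using labelled_range[OF assms(1)[unfolded label_spec_def] that] by simp_all
  have an: "x < n" if "x \<in> active" for x using that by (simp add: active_def)
  have eq: "labels S x = labels S y \<longleftrightarrow> S ''lab'' (int x) = S ''lab'' (int y)" if "x < n" "y < n" for x y
    using pos that by (simp add: labels_def eq_nat_nat_iff)
  show ?thesis
    unfolding component_labelling_def
  proof (intro conjI ballI allI impI)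
    show "labels S x < n" if "x \<in> active" for x using pos an that by (simp add: labels_def nat_less_iff)
    show "labels S x = labels S y" if "x \<in> active" "y \<in> active" "E x y" for x y
      using labelled_edge[OF assms(1)[unfolded label_spec_def] that(1,2) TrueI that(3)] that eq an by blast
    show "y \<in> C" if "C \<subseteq> active" "\<forall>x\<in>C. \<forall>y\<in>active. E x y \<longrightarrow> y \<in> C" "x \<in> active" "y \<in> active"
      "labels S x = labels S y" "x \<in> C" for C x y
      using labelled_closed[OF assms(1)[unfolded label_spec_def] that(1-4)] that eq an by blast
  qed
qed

abbreviation block :: "state \<Rightarrow> nat \<Rightarrow> nat \<Rightarrow> nat set" where
  "block S v \<equiv> coloured_graph.cls n v (colour S) (labels S)"

abbreviation heavy_class_of :: "state \<Rightarrow> nat \<Rightarrow> nat \<Rightarrow> nat \<Rightarrow> bool" where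
  "heavy_class_of S v \<equiv> coloured_graph.heavy n E v (colour S) (labels S)"

lemma block_iff: "v < n \<Longrightarrow> x \<in> block S v l \<longleftrightarrow> x \<in> actives S v \<and> labels S x = l"
proof -
  assume "v < n"
  then interpret coloured_graph n E v "colour S" "labels S" by unfold_locales
  show ?thesis by (simp add: cls_def)
qed

lemma heavy_iff: "v < n \<Longrightarrow> heavy_class_of S v h l \<longleftrightarrow> (\<forall>x\<in>block S v l. h \<le> deg (insert v (block S v l)) x)"
proof -
  assume "v < n"
  then interpret coloured_graph n E v "colour S" "labels S" by unfold_locales
  show ?thesis by (simp add: heavy_def)
qed

lemma block_subset: "v < n \<Longrightarrow> block S v l \<subseteq> {..<n} - {v}"
  by (auto simp: block_iff actives_iff)

lemma
  assumes v: "v < n" "\<rho> ''v'' = int v" and l: "\<rho> ''l'' = int l" and lab: "label_spec S v"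
    and x: "0 \<le> \<rho> x" "\<rho> x < int n"
  shows eval_ecls: "0 < eval (ecls x) \<rho> S \<longleftrightarrow> nat (\<rho> x) \<in> block S v l"
    and eval_ecls_v: "0 < eval (ecls_v x) \<rho> S \<longleftrightarrow> nat (\<rho> x) \<in> insert v (block S v l)"
proof -
  have "0 \<le> S ''lab'' (\<rho> x)"
    using labelled_range[OF lab[unfolded label_spec_def], of "nat (\<rho> x)"] x by simp
  then have "S ''lab'' (\<rho> x) = int l \<longleftrightarrow> labels S (nat (\<rho> x)) = l"
    using x by (auto simp: labels_def)
  then show "0 < eval (ecls x) \<rho> S \<longleftrightarrow> nat (\<rho> x) \<in> block S v l"
    using v x l by (simp add: ecls_def eval_eact[where v = v and \<rho> = \<rho>, OF v] block_iff)
  then show "0 < eval (ecls_v x) \<rho> S \<longleftrightarrow> nat (\<rho> x) \<in> insert v (block S v l)"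
    using v x by (auto simp: ecls_v_def)
qed

lemma sum_if_mem: "A \<subseteq> {..<n} \<Longrightarrow> (\<Sum>x<n. if x \<in> A then f x else 0) = (\<Sum>x\<in>A. f x)" for f :: "nat \<Rightarrow> int"
  by (simp add: sum.If_cases Int_absorb1)

lemma eval_ekey:
  assumes base: "base S" and v: "v < n" "\<rho> ''v'' = int v" and l: "\<rho> ''l'' = int l" and lab: "label_spec S v"
  shows "eval ekey \<rho> S = int (key M v (block S v l))"
proof -
  let ?D = "block S v l"
  have DV: "?D \<subseteq> {..<n}" "insert v ?D \<subseteq> {..<n}" using block_subset[OF v(1), of S l] v by auto
  have cst: "S ''M'' 0 = int M" "S ''M2'' 0 = int (M ^ 2)" "S ''M3'' 0 = int (M ^ 3)"
    using base by (simp_all add: base_def)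
  have inner: "(\<Sum>y<n. if E x y then int (M ^ 3) + (if y \<in> insert v ?D then int (M ^ 2) else 0) else 0) =
      int (M ^ 3) * int (deg {..<n} x) + int (M ^ 2) * int (deg (insert v ?D) x)" for x
  proof -
    have "(\<Sum>y<n. if E x y then int (M ^ 3) + (if y \<in> insert v ?D then int (M ^ 2) else 0) else 0) =
      (\<Sum>y<n. int (M ^ 3) * (if y \<in> {..<n} \<and> E x y then 1 else 0) + int (M ^ 2) * (if y \<in> insert v ?D \<and> E x y then 1 else 0))"
      by (intro sum.cong) auto
    then show ?thesis
      unfolding sum.distrib sum_distrib_left[symmetric] int_deg[OF DV(2)] int_deg[OF subset_refl] .
  qed
  have one: "deg {v} x = (if E x v then 1 else 0)" for x
  proof -
    have "{y \<in> {v}. E x y} = (if E x v then {v} else {})" by auto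
    then show ?thesis by (simp add: deg_def)
  qed
  have "eval ekey \<rho> S = (\<Sum>x<n. if x \<in> ?D then 1 + (if E x v then int M else 0) +
      (\<Sum>y<n. if E x y then int (M ^ 3) + (if y \<in> insert v ?D then int (M ^ 2) else 0) else 0) else 0)"
    unfolding ekey_def
    by (simp only: eval.simps base_n[OF base] nat_int, intro sum.cong refl)
      (simp add: cst eval_eadj[OF base] eval_ecls[OF v(1) _ _ lab] eval_ecls_v[OF v(1) _ _ lab] v l
        del: of_nat_power of_nat_add of_nat_mult cong: if_cong)
  also have "\<dots> = (\<Sum>x\<in>?D. 1 + (if E x v then int M else 0) +
      (int (M ^ 3) * int (deg {..<n} x) + int (M ^ 2) * int (deg (insert v ?D) x)))"
    unfolding inner by (rule sum_if_mem[OF DV(1)])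
  also have "\<dots> = (\<Sum>x\<in>?D. int (1 + M * deg {v} x + M ^ 2 * deg (insert v ?D) x + M ^ 3 * deg {..<n} x))"
    by (intro sum.cong refl) (simp add: one)
  also have "\<dots> = int (key M v ?D)"
    by (simp only: of_nat_sum[symmetric] key_def ecount_def sum.distrib sum_distrib_left[symmetric]) simp
  finally show ?thesis .
qed

lemma eval_elight:
  assumes base: "base S" and v: "v < n" "\<rho> ''v'' = int v" and l: "\<rho> ''l'' = int l" and lab: "label_spec S v"
    and h: "\<rho> ''h'' = int h"
  shows "eval elight \<rho> S < 1 \<longleftrightarrow> heavy_class_of S v h l"
proof -
  let ?D = "block S v l"
  have DV: "?D \<subseteq> {..<n}" "insert v ?D \<subseteq> {..<n}" using block_subset[OF v(1), of S l] v by auto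
  have "eval elight \<rho> S = (\<Sum>x<n. if x \<in> ?D \<and> (\<Sum>y<n. if y \<in> insert v ?D \<and> E x y then 1 else 0) < int h then 1 else 0)"
    unfolding elight_def
    by (simp only: eval.simps base_n[OF base] nat_int, intro sum.cong refl)
      (simp add: base_n[OF base] eval_eadj[OF base] eval_ecls[OF v(1) _ _ lab] eval_ecls_v[OF v(1) _ _ lab] v l h cong: if_cong)
  also have "\<dots> = (\<Sum>x<n. if x \<in> ?D \<and> deg (insert v ?D) x < h then 1 else 0)"
    unfolding int_deg[OF DV(2)] by simp
  also have "\<dots> = int (card {x \<in> {..<n}. x \<in> ?D \<and> deg (insert v ?D) x < h})"
    by (simp add: sum.If_cases Int_def)
  finally have "eval elight \<rho> S < 1 \<longleftrightarrow> {x \<in> {..<n}. x \<in> ?D \<and> deg (insert v ?D) x < h} = {}"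
    by simp
  then show ?thesis
    unfolding heavy_iff[OF v(1)] using DV(1) by (auto simp: not_less) (meson lessThan_iff not_less subsetD)
qed

section \<open>Subset sums over the components\<close>

definition sset :: "state \<Rightarrow> nat \<Rightarrow> nat set" where
  "sset T k = {u. u < n \<and> 0 < T ''sol'' (int u * int K + int k)}"

text \<open>A marked sum comes with the union of some family realising it, not of every such family:
  different families with equal sums share a cell, and only one of them is remembered.\<close>

definition status :: "state \<Rightarrow> (nat \<Rightarrow> nat set) \<Rightarrow> (nat \<Rightarrow> nat) \<Rightarrow> nat set set \<Rightarrow> nat \<Rightarrow> bool" where
  "status T D \<kappa> F k \<longleftrightarrow> (0 < T ''reach'' (int k) \<longleftrightarrow> (\<exists>J\<in>F. sum \<kappa> J = k)) \<and>
     (0 < T ''reach'' (int k) \<longrightarrow> (\<exists>J\<in>F. sum \<kappa> J = k \<and> sset T k = (\<Union>j\<in>J. D j)))"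

definition families :: "(nat \<Rightarrow> bool) \<Rightarrow> nat \<Rightarrow> nat set set" where
  "families H l = {J. J \<subseteq> {..<l} \<and> (\<forall>j\<in>J. H j)}"

lemma families_0: "families H 0 = {{}}"
  by (auto simp: families_def)

lemma families_Suc_not: "\<not> H l \<Longrightarrow> families H (Suc l) = families H l"
  unfolding families_def lessThan_Suc by blast

lemma families_Suc:
  assumes "H l"
  shows "J \<in> families H (Suc l) \<longleftrightarrow> J \<in> families H l \<or> (\<exists>J'\<in>families H l. J = insert l J')"
proof
  assume "J \<in> families H (Suc l)"
  then show "J \<in> families H l \<or> (\<exists>J'\<in>families H l. J = insert l J')"
  proof (cases "l \<in> J")
    case True
    then have "J - {l} \<in> families H l" "J = insert l (J - {l})"
      using \<open>J \<in> families H (Suc l)\<close> unfolding families_def lessThan_Suc by blast+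
    then show ?thesis by blast
  next
    case False
    then show ?thesis
      using \<open>J \<in> families H (Suc l)\<close> unfolding families_def lessThan_Suc by blast
  qed
next
  assume "J \<in> families H l \<or> (\<exists>J'\<in>families H l. J = insert l J')"
  then show "J \<in> families H (Suc l)" using assms unfolding families_def lessThan_Suc by blast
qed

lemma sum_insert_family: "J \<in> families H l \<Longrightarrow> sum \<kappa> (insert l J) = \<kappa> l + sum \<kappa> J"
  by (subst sum.insert) (auto simp: families_def finite_subset)

text \<open>Without an update, either the sum \<open>k\<close> was reached already, or class
  \<open>l\<close> cannot help because \<open>k\<close> is too small or the remainder is not
  reached. In each case admitting \<open>l\<close> makes no new difference to cell
  \<open>k\<close>.\<close>

lemma status_keep:
  assumes "status U D \<kappa> (families H l) k" "H l"
    and "\<not> (\<not> 0 < U ''reach'' (int k) \<and> \<kappa> l \<le> k \<and> 0 < U ''reach'' (int (k - \<kappa> l)))"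
    and "\<kappa> l \<le> k \<Longrightarrow> status U D \<kappa> (families H l) (k - \<kappa> l)"
    and "T ''reach'' (int k) = U ''reach'' (int k)" "sset T k = sset U k"
  shows "status T D \<kappa> (families H (Suc l)) k"
proof -
  have "(\<exists>J\<in>families H (Suc l). sum \<kappa> J = k) \<longleftrightarrow> (\<exists>J\<in>families H l. sum \<kappa> J = k)"
  proof
    assume "\<exists>J\<in>families H (Suc l). sum \<kappa> J = k"
    then obtain I where I: "I \<in> families H (Suc l)" "sum \<kappa> I = k" by blast
    then consider "\<exists>J\<in>families H l. sum \<kappa> J = k" | J where "J \<in> families H l" "\<kappa> l + sum \<kappa> J = k"
      using families_Suc[of H l I, OF assms(2)] sum_insert_family[of _ H l \<kappa>] by metis
    then show "\<exists>J\<in>families H l. sum \<kappa> J = k"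
    proof cases
      case 2
      then have "\<kappa> l \<le> k" "sum \<kappa> J = k - \<kappa> l" by auto
      then have "0 < U ''reach'' (int (k - \<kappa> l))" using assms(4) 2(1) unfolding status_def by blast
      then have "0 < U ''reach'' (int k)" using assms(3) \<open>\<kappa> l \<le> k\<close> by blast
      then show ?thesis using assms(1) unfolding status_def by blast
    qed
  next
    assume "\<exists>J\<in>families H l. sum \<kappa> J = k"
    then show "\<exists>J\<in>families H (Suc l). sum \<kappa> J = k" using families_Suc[of H l, OF assms(2)] by blast
  qed
  then show ?thesis
    using assms(1) families_Suc[of H l, OF assms(2)] unfolding status_def assms(5,6) by blast
qed

lemma status_new:
  assumes "H l" "\<kappa> l \<le> k" "0 < U ''reach'' (int (k - \<kappa> l))" "status U D \<kappa> (families H l) (k - \<kappa> l)"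
    and "0 < T ''reach'' (int k)" "sset T k = D l \<union> sset U (k - \<kappa> l)"
  shows "status T D \<kappa> (families H (Suc l)) k"
proof -
  obtain J where J: "J \<in> families H l" "sum \<kappa> J = k - \<kappa> l" "sset U (k - \<kappa> l) = (\<Union>j\<in>J. D j)"
    using assms(3,4) unfolding status_def by blast
  have "insert l J \<in> families H (Suc l)" using families_Suc[of H l, OF assms(1)] J(1) by blast
  moreover have "sum \<kappa> (insert l J) = k" using J sum_insert_family[OF J(1), of \<kappa>] assms(2) by simp
  moreover have "sset T k = (\<Union>j\<in>insert l J. D j)" using J(3) assms(6) by simp
  ultimately show ?thesis using assms(5) unfolding status_def by blast
qed

lemma cell_inject:
  assumes "a < K" "b < K" "int u * int K + int a = int w * int K + int b"
  shows "u = w \<and> a = b"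
proof -
  have eq: "u * K + a = w * K + b"
    using assms(3) by (metis of_nat_add of_nat_eq_iff of_nat_mult)
  have "(u * K + a) div K = u" "(w * K + b) div K = w" "(u * K + a) mod K = a" "(w * K + b) mod K = b"
    using assms(1,2) by (simp_all del: power_eq_0_iff)
  then show ?thesis using eq by metis
qed

definition temps :: "vname set" where
  "temps = {''reach'', ''sol'', ''kap'', ''tgt''}"

lemma same_context:
  assumes "\<And>x. x \<notin> temps \<Longrightarrow> T x = S x" and "base S" "label_spec S v"
  shows "base T" "label_spec T v" "colour T = colour S" "labels T = labels S"
proof -
  have r: "T ''r'' = S ''r''" "T ''lab'' = S ''lab''" by (rule assms(1), simp add: temps_def)+
  then show c: "colour T = colour S" "labels T = labels S" by (simp_all add: colour_def labels_def fun_eq_iff)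
  show "label_spec T v" using assms(3) unfolding label_spec_def c r .
  show "base T" using assms(2)
  proof (rule base_frame)
    fix x assume "x \<in> input_names"
    then have "x \<notin> temps" by (auto simp: temps_def input_names_def)
    then show "T x = S x" by (rule assms(1))
  qed
qed

lemma base_K': "base S \<Longrightarrow> nat (S ''K'' 0) = K"
  by (simp add: base_K del: of_nat_power)

lemma eval_cell:
  assumes "base S" "u < n" "\<rho> ''u'' = int u" "\<And>j. eval e (\<rho>(''#'' := j)) S = eval e \<rho> S"
  shows "eval (EP (emul (EV ''u'') (sc ''K'')) e) \<rho> S = int u * int K + eval e \<rho> S"
proof -
  have "eval (emul (EV ''u'') (sc ''K'')) \<rho> S = int u * int K"
    using assms base_K[OF assms(1)] by (subst eval_emul[where c = "int K"]) (auto simp del: of_nat_power)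
  then show ?thesis by simp
qed

text \<open>Positivity of \<open>a\<close> separates the source column \<open>b - a\<close> from the
  target column \<open>b\<close>, so the loop never reads a cell that it has overwritten.\<close>

lemma copy_solution_correct:
  assumes base: "base S" and v: "v < n" "\<rho> ''v'' = int v" and l: "\<rho> ''l'' = int l" and lab: "label_spec S v"
    and tgt: "S ''tgt'' 0 = int b" "b < K" and kap: "S ''kap'' 0 = int a" "0 < a" "a \<le> b"
  defines "S' \<equiv> sem copy_solution \<rho> S"
  shows "sset S' b = block S v l \<union> sset S (b - a)" "k < K \<Longrightarrow> k \<noteq> b \<Longrightarrow> sset S' k = sset S k"
proof -
  let ?g = "\<lambda>u. int u * int K + int b"
  let ?w = "\<lambda>u. if u \<in> block S v l then 1 else S ''sol'' (int u * int K + int (b - a))"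
  have n: "nat (S ''n'' 0) = n" using base by (simp add: base_n)
  have inj: "inj_on ?g {..<n}" using cell_inject[OF tgt(2) tgt(2)] by (meson inj_onI)
  have step: "eval (EP (emul (EV ''u'') (sc ''K'')) (sc ''tgt'')) (\<rho>(''u'' := int i)) T = ?g i \<and>
      eval (EIf (ecls ''u'') (EN 1) (ER ''sol'' (EP (emul (EV ''u'') (sc ''K'')) (EM (sc ''tgt'') (sc ''kap'')))))
        (\<rho>(''u'' := int i)) T = ?w i"
    if i: "i < n" and T: "\<And>x. x \<noteq> ''sol'' \<Longrightarrow> T x = S x" "\<And>j. j \<notin> ?g ` {..<i} \<Longrightarrow> T ''sol'' j = S ''sol'' j" for i T
  proof -
    have "T x = S x" if "x \<notin> temps" for x using T(1)[of x] that by (auto simp: temps_def)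
    note ctx = same_context[OF this base lab]
    have Tt: "T ''tgt'' 0 = int b" "T ''kap'' 0 = int a" using T(1) tgt kap by simp_all
    have cell: "int i * int K + int (b - a) \<notin> ?g ` {..<i}"
    proof
      assume "int i * int K + int (b - a) \<in> ?g ` {..<i}"
      then obtain j where "int i * int K + int (b - a) = int j * int K + int b" by blast
      then have "b - a = b" using cell_inject[of "b - a" b i j] tgt(2) by simp
      then show False using kap by simp
    qed
    have e1: "eval (EP (emul (EV ''u'') (sc ''K'')) (sc ''tgt'')) (\<rho>(''u'' := int i)) T = ?g i"
      by (subst eval_cell[OF ctx(1) i]) (simp_all add: Tt)
    have e2: "eval (EP (emul (EV ''u'') (sc ''K'')) (EM (sc ''tgt'') (sc ''kap''))) (\<rho>(''u'' := int i)) T = int i * int K + int (b - a)"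
      by (subst eval_cell[OF ctx(1) i]) (use kap in \<open>simp_all add: Tt of_nat_diff\<close>)
    have c: "0 < eval (ecls ''u'') (\<rho>(''u'' := int i)) T \<longleftrightarrow> i \<in> block S v l"
      using eval_ecls[where \<rho> = "\<rho>(''u'' := int i)" and l = l and x = "''u''", OF v(1) _ _ ctx(2)] v l i
      by (simp add: ctx(3,4))
    show ?thesis
      unfolding e1 by (simp only: eval.simps(3,7) e2 c T(2)[OF cell] eval.simps(1) simp_thms)
  qed
  have fill1: "S' ''sol'' (?g u) = ?w u" if "u < n" for u
    unfolding S'_def copy_solution_def
    by (rule for_fill(2)[where g = ?g and m = n and k = "''n''" and S = S and \<rho> = \<rho> and a = "''sol''" and x = "''u''"
      and w = ?w, OF inj n], rule step) (simp_all add: that)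
  have fill2: "S' ''sol'' j = S ''sol'' j" if "j \<notin> ?g ` {..<n}" for j
    unfolding S'_def copy_solution_def
    by (rule for_fill(3)[where g = ?g and m = n and k = "''n''" and S = S and \<rho> = \<rho> and a = "''sol''" and x = "''u''"
      and w = ?w, OF inj n], rule step) (use that in simp_all)
  show "sset S' b = block S v l \<union> sset S (b - a)"
  proof (rule Set.set_eqI)
    fix u
    show "u \<in> sset S' b \<longleftrightarrow> u \<in> block S v l \<union> sset S (b - a)"
    proof (cases "u < n")
      case True
      then show ?thesis unfolding sset_def mem_Collect_eq Un_iff fill1[OF True] by simp
    next
      case False
      then show ?thesis using block_subset[OF v(1), of S l] unfolding sset_def by blast
    qed
  qed
  assume k: "k < K" "k \<noteq> b"
  have "int u * int K + int k \<notin> ?g ` {..<n}" for u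
    using cell_inject[OF k(1) tgt(2), of u] k(2) by blast
  then show "sset S' k = sset S k" using fill2 unfolding sset_def by presburger
qed

lemma add_class_correct:
  assumes base: "base S" and v: "v < n" "\<rho> ''v'' = int v" and l: "\<rho> ''l'' = int l" and lab: "label_spec S v"
    and H: "H l" and st: "\<And>k. k < K \<Longrightarrow> status S (block S v) (\<lambda>j. key M v (block S v j)) (families H l) k"
    and k: "k < K"
  shows "status (sem add_class \<rho> S) (block S v) (\<lambda>j. key M v (block S v j)) (families H (Suc l)) k"
proof -
  let ?D = "block S v" and ?\<kappa> = "\<lambda>j. key M v (block S v j)"
  define a where "a = ?\<kappa> l"
  define S0 where "S0 = S(''kap'' := (S ''kap'')(0 := int a))"
  define upd where "upd = CSeq (CAssign ''reach'' (sc ''tgt'') (EN 1))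
           copy_solution"
  define cnd where "cnd = eand (ELt (ER ''reach'' (sc ''tgt'')) (EN 1))
              (eand (ele (sc ''kap'') (sc ''tgt'')) (ER ''reach'' (EM (sc ''tgt'') (sc ''kap''))))"
  define c where "c = CSeq (CAssign ''tgt'' (EN 0) (EM (EM (sc ''K'') (EN 1)) (EV ''i''))) (CIf cnd upd CSkip)"
  have wc: "writes c \<subseteq> temps - {''kap''}" by (auto simp: c_def upd_def copy_solution_def temps_def)
  have S0: "sem add_class \<rho> S = loop (\<lambda>i. sem c (\<rho>(''i'' := int i))) K S0"
    using eval_ekey[where \<rho> = \<rho>, OF base v l lab] base_K'[OF base]
    by (simp add: add_class_def S0_def a_def c_def cnd_def upd_def)
  have st0: "status S0 ?D ?\<kappa> (families H l) k" if "k < K" for k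
    using st[OF that] by (simp add: status_def sset_def S0_def)
  \<comment> \<open>As targets descend, after \<open>i\<close> rounds the top \<open>i\<close> cells
    are at the new stage while all others still equal those of \<open>S0\<close>.\<close>
  define I where "I i T \<longleftrightarrow> (\<forall>x. x \<notin> temps \<longrightarrow> T x = S x) \<and> T ''kap'' 0 = int a \<and>
    (\<forall>k<K. if K \<le> k + i then status T ?D ?\<kappa> (families H (Suc l)) k
      else T ''reach'' (int k) = S0 ''reach'' (int k) \<and> sset T k = sset S0 k)" for i and T :: state
  have "I K (loop (\<lambda>i. sem c (\<rho>(''i'' := int i))) K S0)"
  proof (rule loop_invariant)
    show "I 0 S0" by (auto simp: I_def S0_def temps_def)
    fix i T assume i: "i < K" and T: "I i T"
    let ?r = "\<rho>(''i'' := int i)"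
    define b where "b = K - 1 - i"
    have bK: "b < K" using i by (auto simp: b_def)
    have Tf: "T x = S x" if "x \<notin> temps" for x using T that unfolding I_def by blast
    have Tk: "T ''kap'' 0 = int a" using T unfolding I_def by blast
    have Told: "T ''reach'' (int k) = S0 ''reach'' (int k)" "sset T k = sset S0 k" if "k < K" "k + i < K" for k
      using T that unfolding I_def by (meson not_less)+
    have Tnew: "status T ?D ?\<kappa> (families H (Suc l)) k" if "k < K" "K \<le> k + i" for k
      using T that unfolding I_def by meson
    define T1 where "T1 = T(''tgt'' := (T ''tgt'')(0 := int b))"
    have T1f: "T1 x = S x" if "x \<notin> temps" for x using Tf[OF that] that by (auto simp: T1_def temps_def)
    note ctx = same_context[OF T1f base lab]
    have bint: "int K - 1 - int i = int b" using i by (simp add: b_def of_nat_diff)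
    have "T ''K'' 0 = int K" using Tf[of "''K''"] base_K[OF base] by (simp add: temps_def)
    then have asg: "sem (CAssign ''tgt'' (EN 0) (EM (EM (sc ''K'') (EN 1)) (EV ''i''))) ?r T = T1"
      using bint by (simp add: T1_def)
    have T1s: "T1 ''tgt'' 0 = int b" "T1 ''kap'' 0 = int a" "T1 ''reach'' = T ''reach''" "sset T1 k = sset T k" for k
      by (simp_all add: T1_def Tk sset_def)
    have b_old: "b + i < K" using i by (simp add: b_def)
    have ba: "a \<le> b \<Longrightarrow> b - a < K \<and> b - a + i < K" using b_old by linarith
    have cond: "0 < eval cnd ?r T1 \<longleftrightarrow> \<not> 0 < S0 ''reach'' (int b) \<and> a \<le> b \<and> 0 < S0 ''reach'' (int (b - a))"
    proof -
      have "a \<le> b \<Longrightarrow> int b - int a = int (b - a)" by simp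
      then show ?thesis
        using Told[OF bK b_old] Told[of "b - a"] ba by (auto simp: cnd_def T1s)
    qed
    define T' where "T' = sem c ?r T"
    have T': "T' = (if 0 < eval cnd ?r T1 then sem upd ?r T1 else T1)"
      by (simp only: T'_def c_def sem.simps(2,3,5) asg)
    have fr: "T' x = T x" if "x \<notin> temps - {''kap''}" for x
      unfolding T'_def by (rule sem_frame) (use wc that in blast)
    have fr': "\<forall>x. x \<notin> temps \<longrightarrow> T' x = S x" using fr Tf by simp
    have kap': "T' ''kap'' 0 = int a" using fr[of "''kap''"] Tk by simp
    have cells: "(k \<noteq> b \<longrightarrow> T' ''reach'' (int k) = T ''reach'' (int k) \<and> sset T' k = sset T k) \<and>
      (k = b \<longrightarrow> status T' ?D ?\<kappa> (families H (Suc l)) k)" if k: "k < K" for k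
    proof (cases "0 < eval cnd ?r T1")
      case True
      then have cc: "\<not> 0 < S0 ''reach'' (int b)" "a \<le> b" "0 < S0 ''reach'' (int (b - a))" using cond by auto
      \<comment> \<open>With key zero the source and target cells would coincide, yet one is marked
        and the other is not.\<close>
      then have a0: "0 < a" by (cases a) auto
      define T2 where "T2 = T1(''reach'' := (T1 ''reach'')(int b := 1))"
      have T2f: "T2 x = S x" if "x \<notin> temps" for x using T1f[OF that] that by (auto simp: T2_def temps_def)
      note ctx2 = same_context[OF T2f base lab]
      have T2s: "T2 ''tgt'' 0 = int b" "T2 ''kap'' 0 = int a" "sset T2 k = sset T k" for k
        using T1s by (simp_all add: T2_def sset_def)
      have T'2: "T' = sem copy_solution ?r T2"
        using True T1s(1) by (simp add: T' upd_def T2_def)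
      have copy: "sset T' b = ?D l \<union> sset T2 (b - a)" "k < K \<Longrightarrow> k \<noteq> b \<Longrightarrow> sset T' k = sset T2 k" for k
        unfolding T'2 using copy_solution_correct[where \<rho> = ?r and l = l, OF ctx2(1) v(1) _ _ ctx2(2) T2s(1) bK T2s(2) a0 cc(2)] v l
        by (simp_all add: ctx2(3,4))
      have reach': "T' ''reach'' = T2 ''reach''" unfolding T'2 by (rule sem_frame) (simp add: copy_solution_def)
      have "status T' ?D ?\<kappa> (families H (Suc l)) b"
      proof (rule status_new[where U = S0 and \<kappa> = ?\<kappa> and l = l and H = H])
        show "sset T' b = ?D l \<union> sset S0 (b - ?\<kappa> l)"
          using copy(1) T2s(3) Told(2)[of "b - a"] ba[OF cc(2)] by (simp add: a_def)
        show "status S0 ?D ?\<kappa> (families H l) (b - ?\<kappa> l)" using st0 ba[OF cc(2)] by (simp add: a_def)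
      qed (use H cc in \<open>simp_all add: a_def reach' T2_def\<close>)
      then show ?thesis using copy(2)[OF k] T2s(3) reach' T1s(3) by (auto simp: T2_def)
    next
      case False
      then have T'1: "T' = T1" by (simp add: T')
      have "status T' ?D ?\<kappa> (families H (Suc l)) b"
      proof (rule status_keep[where U = S0 and \<kappa> = ?\<kappa> and l = l and H = H])
        show "status S0 ?D ?\<kappa> (families H l) b" using st0[OF bK] .
        show "status S0 ?D ?\<kappa> (families H l) (b - ?\<kappa> l)" if "?\<kappa> l \<le> b"
          using st0 ba that by (simp add: a_def)
        show "\<not> (\<not> 0 < S0 ''reach'' (int b) \<and> ?\<kappa> l \<le> b \<and> 0 < S0 ''reach'' (int (b - ?\<kappa> l)))"
          using False cond by (simp add: a_def)
      qed (use H Told[OF bK b_old] in \<open>simp_all add: T'1 T1s\<close>)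
      then show ?thesis using T'1 T1s by simp
    qed
    have "if K \<le> k + Suc i then status T' ?D ?\<kappa> (families H (Suc l)) k
      else T' ''reach'' (int k) = S0 ''reach'' (int k) \<and> sset T' k = sset S0 k" if k: "k < K" for k
    proof (cases "k = b")
      case True
      then show ?thesis using cells[OF k] i by (simp add: b_def)
    next
      case False
      then have same: "T' ''reach'' (int k) = T ''reach'' (int k)" "sset T' k = sset T k" using cells[OF k] by auto
      show ?thesis
      proof (cases "K \<le> k + i")
        case True
        then show ?thesis using Tnew[OF k True] same by (simp add: status_def)
      next
        case notle: False
        then have "\<not> K \<le> k + Suc i" using False by (simp add: b_def)
        then show ?thesis using Told[OF k] notle same by simp
      qed
    qed
    then show "I (Suc i) (sem c ?r T)" using fr' kap' unfolding I_def T'_def[symmetric] by blast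
  qed
  then show ?thesis using k unfolding S0 I_def by simp
qed

end

section \<open>Treating one vertex under a fixed colouring\<close>

definition try_sum :: "ex \<Rightarrow> cmd" where
  "try_sum mu = CIf (ER ''reach'' (EV ''k''))
     (CSeq (CFor ''u'' ''n'' (CAssign ''c'' (EV ''u'') (EIf (eeq (EV ''u'') (EV ''v'')) (EN 1)
         (ER ''sol'' (EP (emul (EV ''u'') (sc ''K'')) (EV ''k''))))))
       (check mu)) CSkip"

definition try_sums :: "ex \<Rightarrow> cmd" where
  "try_sums mu = CFor ''k'' ''K'' (try_sum mu)"

definition ebig :: "vname \<Rightarrow> ex" where
  "ebig y = eor (eeq (EV y) (EV ''v'')) (eor (eeq (EV y) (EV ''u'')) (eadj ''u'' y))"

definition try_hub :: "ex \<Rightarrow> cmd" where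
  "try_hub mu = CSeq (CFor ''x'' ''n'' (CAssign ''c'' (EV ''x'')
       (EIf (ebig ''x'') (EN 1) (ecount_if (eand (ER ''r'' (EV ''x''))
         (ele (ESum ''y'' ''n'' (ecount_if (ebig ''y'')))
           (EP (ESum ''y'' ''n'' (ecount_if (eand (ebig ''y'') (eadj ''x'' ''y'')))) (sc ''p'')))))))) (check mu)"

definition try_big :: "ex \<Rightarrow> cmd" where
  "try_big mu = CFor ''u'' ''n'' (try_hub mu)"

text \<open>The class filter needs the minimum degree inside a cluster that is not known, so all
  values \<open>h < n\<close> are tried. The labelling does not depend on \<open>h\<close> and is
  computed once.\<close>

definition vertex :: "ex \<Rightarrow> cmd" where
  "vertex mu = CSeq label (CSeq (CFor ''h'' ''n'' (CSeq subset_sums (try_sums mu))) (try_big mu))"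

context run
begin

lemma subset_sums_correct:
  assumes base: "base S" and v: "v < n" "\<rho> ''v'' = int v" and h: "\<rho> ''h'' = int h" and lab: "label_spec S v"
    and k: "k < K"
  shows "status (sem subset_sums \<rho> S) (block S v) (\<lambda>j. key M v (block S v j))
    (families (heavy_class_of S v h) n) k"
proof -
  let ?D = "block S v" and ?\<kappa> = "\<lambda>j. key M v (block S v j)" and ?H = "heavy_class_of S v h"
  define Sa where "Sa = sem (CFor ''k'' ''K'' (CAssign ''reach'' (EV ''k'') (EN 0))) \<rho> S"
  define Sb where "Sb = sem (CFor ''u'' ''n'' (CAssign ''sol'' (emul (EV ''u'') (sc ''K'')) (EN 0))) \<rho> Sa"
  define Sc where "Sc = Sb(''reach'' := (Sb ''reach'')(0 := 1))"
  define c where "c = CIf (ELt elight (EN 1)) add_class CSkip"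
  have wadd: "writes add_class \<subseteq> temps" by (auto simp: add_class_def copy_solution_def temps_def)
  have fa: "Sa x = S x" if "x \<noteq> ''reach''" for x
    unfolding Sa_def by (rule sem_frame) (use that in simp)
  have fb: "Sb x = Sa x" if "x \<noteq> ''sol''" for x
    unfolding Sb_def by (rule sem_frame) (use that in simp)
  have fc: "Sc x = S x" if "x \<notin> temps" for x
    using fa[of x] fb[of x] that by (auto simp: Sc_def temps_def)
  have ra: "Sa ''reach'' (int k) = 0" if "k < K" for k
    unfolding Sa_def
    by (rule for_fill(2)[where g = int and m = K and k = "''K''" and S = S and w = "\<lambda>_. 0", OF _ base_K'[OF base] _ that])
      simp_all
  have ba: "base Sa" using base by (rule base_frame) (auto simp: fa input_names_def)
  have inj: "inj_on (\<lambda>u. int u * int K) {..<n}"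
    by (rule inj_onI) (simp del: of_nat_power)
  have sb: "Sb ''sol'' (int u * int K) = 0" if "u < n" for u
    unfolding Sb_def
  proof (rule for_fill(2)[where g = "\<lambda>u. int u * int K" and m = n and k = "''n''" and S = Sa and w = "\<lambda>_. 0", OF inj _ _ that])
    show "nat (Sa ''n'' 0) = n" using ba by (simp add: base_n)
    fix i T assume i: "i < n" and T: "\<And>x. x \<noteq> ''sol'' \<Longrightarrow> T x = Sa x"
    have bT: "base T" using ba by (rule base_frame) (auto simp: T input_names_def)
    show "eval (emul (EV ''u'') (sc ''K'')) (\<rho>(''u'' := int i)) T = int i * int K \<and> eval (EN 0) (\<rho>(''u'' := int i)) T = 0"
      using i base_K[OF bT] by (subst eval_emul[OF bT, where c = "int K"]) (simp_all del: of_nat_power)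
  qed
  have c0: "status Sc ?D ?\<kappa> (families ?H 0) k" if "k < K" for k
  proof -
    have "sset Sc 0 = {}" using sb by (auto simp: sset_def Sc_def)
    moreover have "Sc ''reach'' (int k) = (if k = 0 then 1 else 0)"
      using ra[OF that] fb[of "''reach''"] by (simp add: Sc_def)
    ultimately show ?thesis by (simp add: status_def families_0)
  qed
  have S': "sem subset_sums \<rho> S = loop (\<lambda>l. sem c (\<rho>(''l'' := int l))) n Sc"
  proof -
    have "sem (CAssign ''reach'' (EN 0) (EN 1)) \<rho> Sb = Sc" by (simp add: Sc_def)
    moreover have "nat (Sc ''n'' 0) = n" using fc[of "''n''"] base_n[OF base] by (simp add: temps_def)
    ultimately show ?thesis
      unfolding subset_sums_def seqs.simps sem.simps(2) Sa_def[symmetric] Sb_def[symmetric] c_def[symmetric]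
      by (simp only: sem.simps(4))
  qed
  define I where "I l T \<longleftrightarrow> (\<forall>x. x \<notin> temps \<longrightarrow> T x = S x) \<and> (\<forall>k<K. status T ?D ?\<kappa> (families ?H l) k)" for l T
  have "I n (loop (\<lambda>l. sem c (\<rho>(''l'' := int l))) n Sc)"
  proof (rule loop_invariant)
    show "I 0 Sc" using c0 fc by (simp add: I_def)
    fix l T assume l: "l < n" and T: "I l T"
    let ?r = "\<rho>(''l'' := int l)"
    have Tf: "T x = S x" if "x \<notin> temps" for x using T that unfolding I_def by blast
    note ctx = same_context[OF Tf base lab]
    have st: "status T ?D ?\<kappa> (families ?H l) k" if "k < K" for k using T that unfolding I_def by blast
    have cond: "0 < eval (ELt elight (EN 1)) ?r T \<longleftrightarrow> ?H l"
      using eval_elight[where \<rho> = ?r and l = l and h = h, OF ctx(1) v(1) _ _ ctx(2)] v h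
      by (simp add: ctx(3,4))
    have fr: "sem add_class ?r T x = T x" if "x \<notin> temps" for x
      by (rule sem_frame) (use that wadd in blast)
    show "I (Suc l) (sem c ?r T)"
    proof (cases "?H l")
      case True
      have "status (sem add_class ?r T) ?D ?\<kappa> (families ?H (Suc l)) k" if "k < K" for k
        using add_class_correct[where \<rho> = ?r and l = l and H = ?H, OF ctx(1) v(1) _ _ ctx(2)] v True st that
        by (simp add: ctx(3,4) del: of_nat_power)
      moreover have "sem c ?r T = sem add_class ?r T" using True by (simp only: c_def sem.simps(3) cond if_True)
      ultimately show ?thesis using Tf fr by (simp add: I_def)
    next
      case False
      have "sem c ?r T = T" using False by (simp only: c_def sem.simps cond if_False)
      then show ?thesis using T False by (simp add: I_def families_Suc_not)
    qed
  qed
  then show ?thesis using k unfolding S' I_def by blast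
qed

text \<open>The contract of every search phase: a candidate may fail, but soundness and earlier
  successes survive, and only \<open>W\<close> is written. It composes along sequences and
  loops.\<close>

definition advances :: "vname set \<Rightarrow> state \<Rightarrow> state \<Rightarrow> bool" where
  "advances W S S' \<longleftrightarrow> good S' \<and> progress S S' \<and> (\<forall>x. x \<notin> W \<longrightarrow> S' x = S x)"

lemma advances_refl: "good S \<Longrightarrow> advances W S S"
  by (simp add: advances_def progress_refl)

lemma advances_trans: "advances W S T \<Longrightarrow> advances W T U \<Longrightarrow> advances W S U"
  by (auto simp: advances_def intro: progress_trans)

lemma advances_mono: "advances W S T \<Longrightarrow> W \<subseteq> W' \<Longrightarrow> advances W' S T"
  by (auto simp: advances_def)

lemma advances_sem:
  assumes "writes c \<inter> insert ''ok'' (insert ''X'' input_names) = {}" "writes c \<subseteq> W" "good S"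
  shows "advances W S (sem c \<rho> S)"
  using good_sem[OF assms(1,3)] progress_sem[OF assms(1)] assms(2) by (auto simp: advances_def intro: sem_frame)

lemma loop_advances:
  assumes "good S" "\<And>i T. i < m \<Longrightarrow> advances W S T \<Longrightarrow> advances W T (f i T)"
  shows "advances W S (loop f m S)"
    and "i < m \<Longrightarrow> (\<And>T. advances W S T \<Longrightarrow> solved (f i T) v) \<Longrightarrow> solved (loop f m S) v"
proof -
  show "advances W S (loop f m S)"
    by (rule loop_invariant[where P = "\<lambda>_. advances W S"]) (use assms in \<open>auto intro: advances_refl advances_trans\<close>)
  assume "i < m" "\<And>T. advances W S T \<Longrightarrow> solved (f i T) v"
  then show "solved (loop f m S) v"
    by (intro loop_eventually[where I = "advances W S" and i = i and P = "\<lambda>T. solved T v"])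
      (use assms in \<open>auto intro: advances_refl advances_trans\<close>, auto simp: advances_def progress_def)
qed

abbreviation check_writes :: "vname set" where
  "check_writes \<equiv> {''c'', ''ok'', ''X''}"

lemma check_advances:
  assumes mu_spec "good S" "\<rho> ''v'' = int v" "v < n" "v \<in> cset S ''c''"
  shows "advances check_writes S (sem (check mu) \<rho> S)"
    and "valid v (cset S ''c'') \<Longrightarrow> solved (sem (check mu) \<rho> S) v"
  using check_correct[where \<rho> = \<rho>, OF assms(1,2,3,4,5)] by (simp_all add: advances_def)

lemma try_sums_step:
  assumes spec: mu_spec and good: "good S" and v: "v < n" "\<rho> ''v'' = int v" and k: "k < K" "\<rho> ''k'' = int k"
  shows "advances check_writes S (sem (try_sum mu) \<rho> S)"
    and "0 < S ''reach'' (int k) \<Longrightarrow> valid v (insert v (sset S k)) \<Longrightarrow> solved (sem (try_sum mu) \<rho> S) v"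
proof -
  have base: "base S" using good by (rule good_base)
  define c1 where "c1 = CFor ''u'' ''n'' (CAssign ''c'' (EV ''u'') (EIf (eeq (EV ''u'') (EV ''v'')) (EN 1)
         (ER ''sol'' (EP (emul (EV ''u'') (sc ''K'')) (EV ''k'')))))"
  define S1 where "S1 = sem c1 \<rho> S"
  have a1: "advances check_writes S S1"
    unfolding S1_def by (rule advances_sem[OF _ _ good]) (auto simp: c1_def input_names_def)
  have w: "S1 ''c'' (int u) = (if u = v then 1 else S ''sol'' (int u * int K + int k))" if u: "u < n" for u
    unfolding S1_def c1_def
  proof (rule for_fill(2)[where g = int and m = n and k = "''n''" and S = S and
        w = "\<lambda>u. if u = v then 1 else S ''sol'' (int u * int K + int k)", OF _ _ _ u])
    show "nat (S ''n'' 0) = n" using base by (simp add: base_n)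
    fix i T assume i: "i < n" and T: "\<And>x. x \<noteq> ''c'' \<Longrightarrow> T x = S x"
    have bT: "base T" using base by (rule base_frame) (auto simp: T input_names_def)
    have e: "eval (EP (emul (EV ''u'') (sc ''K'')) (EV ''k'')) (\<rho>(''u'' := int i)) T = int i * int K + int k"
      by (subst eval_cell[OF bT i]) (simp_all add: k)
    show "eval (EV ''u'') (\<rho>(''u'' := int i)) T = int i \<and>
      eval (EIf (eeq (EV ''u'') (EV ''v'')) (EN 1) (ER ''sol'' (EP (emul (EV ''u'') (sc ''K'')) (EV ''k'')))) (\<rho>(''u'' := int i)) T
      = (if i = v then 1 else S ''sol'' (int i * int K + int k))"
      unfolding eval.simps(7) eval.simps(3) e by (simp add: v T)
  qed simp
  have cs: "cset S1 ''c'' = insert v (sset S k)"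
    unfolding cset_def sset_def using w v by auto
  have g1: "good S1" using a1 by (simp add: advances_def)
  note chk = check_advances[where \<rho> = \<rho>, OF spec g1 v(2,1)]
  have eq: "sem (try_sum mu) \<rho> S = (if 0 < S ''reach'' (int k) then sem (check mu) \<rho> S1 else S)"
    by (simp add: try_sum_def c1_def[symmetric] S1_def k)
  show "advances check_writes S (sem (try_sum mu) \<rho> S)"
  proof (cases "0 < S ''reach'' (int k)")
    case True
    then have "sem (try_sum mu) \<rho> S = sem (check mu) \<rho> S1" by (simp only: eq if_True)
    moreover have "advances check_writes S1 (sem (check mu) \<rho> S1)" using chk(1) cs by simp
    ultimately show ?thesis using advances_trans[OF a1] by metis
  next
    case False
    then show ?thesis using advances_refl[OF good] by (simp only: eq if_False)
  qed
  show "solved (sem (try_sum mu) \<rho> S) v" if "0 < S ''reach'' (int k)" "valid v (insert v (sset S k))"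
    using that chk(2) cs by (simp add: eq)
qed

lemma try_sums_correct:
  assumes spec: mu_spec and good: "good S" and v: "v < n" "\<rho> ''v'' = int v"
  shows "advances check_writes S (sem (try_sums mu) \<rho> S)"
    and "k < K \<Longrightarrow> 0 < S ''reach'' (int k) \<Longrightarrow> valid v (insert v (sset S k)) \<Longrightarrow> solved (sem (try_sums mu) \<rho> S) v"
proof -
  have eq: "sem (try_sums mu) \<rho> S = loop (\<lambda>k. sem (try_sum mu) (\<rho>(''k'' := int k))) K S"
    unfolding try_sums_def sem.simps(4) base_K'[OF good_base[OF good]] ..
  have step: "advances check_writes T (sem (try_sum mu) (\<rho>(''k'' := int k)) T)" if "k < K" "advances check_writes S T" for k T
    by (rule try_sums_step(1)[OF spec _ v(1) _ that(1)]) (use that v in \<open>auto simp: advances_def\<close>)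
  show "advances check_writes S (sem (try_sums mu) \<rho> S)"
    unfolding eq by (rule loop_advances(1)[OF good step])
  assume k: "k < K" "0 < S ''reach'' (int k)" "valid v (insert v (sset S k))"
  show "solved (sem (try_sums mu) \<rho> S) v"
    unfolding eq
  proof (rule loop_advances(2)[OF good step k(1)])
    fix T assume T: "advances check_writes S T"
    then have "T ''reach'' = S ''reach''" "T ''sol'' = S ''sol''" by (simp_all add: advances_def)
    then show "solved (sem (try_sum mu) (\<rho>(''k'' := int k)) T) v"
      using T k v
      by (intro try_sums_step(2)[OF spec _ v(1) _ k(1)]) (auto simp: advances_def sset_def)
  qed
qed

definition small_suits :: "nat \<Rightarrow> (nat \<Rightarrow> bool) \<Rightarrow> nat set \<Rightarrow> bool" where
  "small_suits v col C \<longleftrightarrow> C \<subseteq> {..<n} \<and> valid v C \<and> (\<forall>x\<in>C - {v}. col x) \<and>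
     (\<forall>x\<in>C - {v}. \<forall>y<n. y \<notin> C \<longrightarrow> E x y \<longrightarrow> \<not> col y)"

text \<open>The minimum degree of the graph induced by a nonempty \<open>C\<close>, in view of
  \<open>miss_plus_deg\<close>.\<close>

definition threshold :: "nat set \<Rightarrow> nat" where
  "threshold C = card C - 1 - Max (miss C ` C)"

text \<open>The key sum \<open>k\<close> of \<open>C\<close> is reached at the threshold of
  \<open>C\<close>, but the stored column may stem from another family \<open>J'\<close>. By
  \<open>exchange\<close> that column together with \<open>v\<close> is again a cluster, though
  possibly not \<open>C\<close>.\<close>

lemma small_correct:
  assumes spec: mu_spec and ml: "measure_like \<mu>" and good: "good S" and vn: "v < n" "\<rho> ''v'' = int v"
    and lab: "label_spec S v" and C: "small_suits v (colour S) C"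
  shows "threshold C < n"
    and "\<rho> ''h'' = int (threshold C) \<Longrightarrow> solved (sem (CSeq subset_sums (try_sums mu)) \<rho> S) v"
proof -
  interpret coloured_graph n E v "colour S" "labels S" by unfold_locales (rule vn(1))
  have CL: component_labelling by (rule label_spec_component_labelling[OF lab vn(1)])
  have Cv: "v \<in> C" "C \<subseteq> {..<n}" using C by (auto simp: small_suits_def valid_def)
  have finC: "finite C" using Cv(2) finite_subset by blast
  obtain J where J: "J \<subseteq> {..<n}" "C = insert v (\<Union>l\<in>J. cls l)"
    by (rule union_of_classes[OF CL Cv(2,1)]) (use C in \<open>auto simp: small_suits_def\<close>)
  define d where "d = Max (miss C ` C)"
  have d: "miss C x \<le> d" if "x \<in> C" for x unfolding d_def using finC that by auto
  define h where "h = card C - 1 - d"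
  have th: "threshold C = h" by (simp add: threshold_def h_def d_def)
  have "card C \<le> n" using card_mono[OF _ Cv(2)] by simp
  then have hn: "h < n" using vn(1) by (simp add: h_def)
  define k where "k = (\<Sum>l\<in>J. key M v (cls l))"
  have "finite J" using J(1) finite_subset by blast
  then have "k = key M v (\<Union>l\<in>J. cls l)" using key_UN[OF CL] by (simp add: k_def)
  also have "\<dots> < K" by (rule key_less[OF _ vn(1) refl]) (use cls_subset in blast)
  finally have k: "k < K" .
  have "J \<in> families (heavy h) n"
    using J(1) heavy_class[OF CL J(1) _ J(2) d] by (auto simp: families_def h_def)
  then have ex: "\<exists>J\<in>families (heavy h) n. (\<Sum>l\<in>J. key M v (cls l)) = k" using k_def by blast
  show "threshold C < n" using hn th by simp
  show "solved (sem (CSeq subset_sums (try_sums mu)) \<rho> S) v" if "\<rho> ''h'' = int (threshold C)"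
  proof -
    have h: "\<rho> ''h'' = int h" using that th by simp
    let ?S = "sem subset_sums \<rho> S"
    have "status ?S cls (\<lambda>j. key M v (cls j)) (families (heavy h) n) k"
      by (rule subset_sums_correct[OF good_base[OF good] vn h lab k])
    then obtain J' where reach: "0 < ?S ''reach'' (int k)" and J': "J' \<in> families (heavy h) n"
        "(\<Sum>l\<in>J'. key M v (cls l)) = k" "sset ?S k = (\<Union>j\<in>J'. cls j)"
      using ex unfolding status_def by blast
    let ?C = "insert v (\<Union>j\<in>J'. cls j)"
    have J'n: "J' \<subseteq> {..<n}" using J'(1) by (simp add: families_def)
    have hv: "heavy (card C - 1 - d) l" if "l \<in> J'" for l
      using J'(1) that by (simp add: families_def h_def)
    note ex = exchange[OF CL J(1) J'n refl J(2) refl _ d hv, unfolded J'(2) k_def[symmetric], OF refl]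
    have C'n: "?C \<subseteq> {..<n}" using cls_subset vn(1) by blast
    \<comment> \<open>Any bound on the misses of \<open>C\<close> is at least their maximum
      \<open>d\<close>, and \<open>exchange\<close> bounds the misses of the new set by
      \<open>d\<close>.\<close>
    have "\<mu> ?C \<le> \<mu> C"
    proof -
      have "\<forall>x\<in>?C. miss ?C x \<le> e" if "\<forall>x\<in>C. miss C x \<le> e" for e
      proof -
        have "d \<le> e" unfolding d_def using that finC Cv by (intro Max.boundedI) auto
        then show ?thesis using ex(4) le_trans by blast
      qed
      then show ?thesis using ml C'n Cv(2) ex(2,3) unfolding measure_like_def by metis
    qed
    then have "valid v ?C" using C ex(1) by (auto simp: small_suits_def valid_def)
    moreover have "good ?S"
      by (rule good_sem[OF _ good]) (auto simp: subset_sums_def add_class_def copy_solution_def input_names_def)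
    ultimately show "solved (sem (CSeq subset_sums (try_sums mu)) \<rho> S) v"
      using try_sums_correct(2)[where \<rho> = \<rho> and S = ?S and v = v and k = k, OF spec _ vn k reach] by (simp add: J'(3))
  qed
qed

text \<open>\<open>hub\<close> and \<open>rim\<close> are the sets \<open>B\<close> and
  \<open>Q\<close> of \<open>large_cluster\<close>, here as functions of \<open>v\<close> and
  \<open>u\<close>.\<close>

definition hub :: "nat \<Rightarrow> nat \<Rightarrow> nat set" where
  "hub v u = {x. x < n \<and> (x = v \<or> x = u \<or> E u x)}"

definition rim :: "nat \<Rightarrow> nat \<Rightarrow> nat set" where
  "rim v u = {x. x < n \<and> x \<notin> hub v u \<and> card (hub v u) \<le> deg (hub v u) x + nat p}"

lemma try_big_step:
  assumes spec: mu_spec and good: "good S" and v: "v < n" "\<rho> ''v'' = int v" and u: "u < n" "\<rho> ''u'' = int u"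
  shows "advances check_writes S (sem (try_hub mu) \<rho> S)"
    and "0 \<le> p \<Longrightarrow> valid v (hub v u \<union> {x \<in> rim v u. colour S x}) \<Longrightarrow> solved (sem (try_hub mu) \<rho> S) v"
proof -
  have base: "base S" using good by (rule good_base)
  define e where "e = EIf (ebig ''x'') (EN 1) (ecount_if (eand (ER ''r'' (EV ''x''))
         (ele (ESum ''y'' ''n'' (ecount_if (ebig ''y'')))
           (EP (ESum ''y'' ''n'' (ecount_if (eand (ebig ''y'') (eadj ''x'' ''y'')))) (sc ''p'')))))"
  define c1 where "c1 = CFor ''x'' ''n'' (CAssign ''c'' (EV ''x'') e)"
  define S1 where "S1 = sem c1 \<rho> S"
  have a1: "advances check_writes S S1"
    unfolding S1_def by (rule advances_sem[OF _ _ good]) (auto simp: c1_def input_names_def)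
  have hn: "hub v u \<subseteq> {..<n}" by (auto simp: hub_def)
  let ?w = "\<lambda>x. if x \<in> hub v u then 1 else if colour S x \<and> int (card (hub v u)) \<le> int (deg (hub v u) x) + p then 1 else 0"
  have w: "S1 ''c'' (int x) = ?w x" if x: "x < n" for x
    unfolding S1_def c1_def
  proof (rule for_fill(2)[where g = int and m = n and k = "''n''" and S = S and w = ?w, OF _ _ _ x])
    show "nat (S ''n'' 0) = n" using base by (simp add: base_n)
    fix i T assume i: "i < n" and T: "\<And>x. x \<noteq> ''c'' \<Longrightarrow> T x = S x"
    have bT: "base T" using base by (rule base_frame) (auto simp: T input_names_def)
    have big: "0 < eval (ebig y) r T \<longleftrightarrow> nat (r y) \<in> hub v u"
      if "r ''v'' = int v" "r ''u'' = int u" "0 \<le> r y" "r y < int n" for r y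
      using that u v by (auto simp: ebig_def eval_eadj[OF bT] hub_def nat_less_iff)
    have c1: "eval (ESum ''y'' ''n'' (ecount_if (ebig ''y''))) (\<rho>(''x'' := int i)) T = int (card (hub v u))"
    proof -
      have "eval (ESum ''y'' ''n'' (ecount_if (ebig ''y''))) (\<rho>(''x'' := int i)) T = (\<Sum>y<n. if y \<in> hub v u then 1 else 0)"
        by (simp only: eval.simps(8) base_n[OF bT] nat_int, intro sum.cong refl) (simp add: big u v)
      then show ?thesis using hn by (simp add: sum.If_cases Int_absorb1)
    qed
    have c2: "eval (ESum ''y'' ''n'' (ecount_if (eand (ebig ''y'') (eadj ''x'' ''y'')))) (\<rho>(''x'' := int i)) T = int (deg (hub v u) i)"
    proof -
      have "eval (ESum ''y'' ''n'' (ecount_if (eand (ebig ''y'') (eadj ''x'' ''y'')))) (\<rho>(''x'' := int i)) T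
        = (\<Sum>y<n. if y \<in> hub v u \<and> E i y then 1 else 0)"
        by (simp only: eval.simps(8) base_n[OF bT] nat_int, intro sum.cong refl) (simp add: big u v i eval_eadj[OF bT])
      then show ?thesis by (simp only: int_deg[OF hn])
    qed
    have p: "T ''p'' 0 = p" using bT by (simp add: base_def)
    show "eval (EV ''x'') (\<rho>(''x'' := int i)) T = int i \<and> eval e (\<rho>(''x'' := int i)) T = ?w i"
    proof -
      have x: "0 < eval (ebig ''x'') (\<rho>(''x'' := int i)) T \<longleftrightarrow> i \<in> hub v u"
        using i u v by (simp add: big)
      have r: "T ''r'' = S ''r''" by (simp add: T)
      have "eval e (\<rho>(''x'' := int i)) T = ?w i"
        by (simp only: e_def eval.simps(1,2,3,4,7) truth x c1 c2 p r fun_upd_same colour_def)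
      then show ?thesis by simp
    qed
  qed simp
  have vh: "v \<in> hub v u" using v by (simp add: hub_def)
  have cs: "cset S1 ''c'' = hub v u \<union> {x. x < n \<and> colour S x \<and> int (card (hub v u)) \<le> int (deg (hub v u) x) + p}"
    unfolding cset_def using w hn by auto
  have g1: "good S1" using a1 by (simp add: advances_def)
  have vc: "v \<in> cset S1 ''c''" using vh cs by simp
  note chk = check_advances[where \<rho> = \<rho>, OF spec g1 v(2,1) vc]
  have eq: "sem (try_hub mu) \<rho> S = sem (check mu) \<rho> S1"
    by (simp add: try_hub_def c1_def[symmetric] S1_def e_def[symmetric])
  show "advances check_writes S (sem (try_hub mu) \<rho> S)"
    using chk(1) a1 advances_trans by (auto simp: eq)
  assume p: "0 \<le> p" and val: "valid v (hub v u \<union> {x \<in> rim v u. colour S x})"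
  have "cset S1 ''c'' = hub v u \<union> {x \<in> rim v u. colour S x}"
    using p unfolding cs rim_def by auto
  then show "solved (sem (try_hub mu) \<rho> S) v" using chk(2) val by (simp add: eq)
qed

lemma try_big_correct:
  assumes spec: mu_spec and good: "good S" and v: "v < n" "\<rho> ''v'' = int v"
  shows "advances check_writes S (sem (try_big mu) \<rho> S)"
    and "u < n \<Longrightarrow> 0 \<le> p \<Longrightarrow> valid v (hub v u \<union> {x \<in> rim v u. colour S x}) \<Longrightarrow> solved (sem (try_big mu) \<rho> S) v"
proof -
  have eq: "sem (try_big mu) \<rho> S = loop (\<lambda>u. sem (try_hub mu) (\<rho>(''u'' := int u))) n S"
    unfolding try_big_def sem.simps(4) base_n[OF good_base[OF good]] nat_int ..
  have step: "advances check_writes T (sem (try_hub mu) (\<rho>(''u'' := int u)) T)" if "u < n" "advances check_writes S T" for u T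
    by (rule try_big_step(1)[OF spec _ v(1) _ that(1)]) (use that v in \<open>auto simp: advances_def\<close>)
  show "advances check_writes S (sem (try_big mu) \<rho> S)"
    unfolding eq by (rule loop_advances(1)[OF good step])
  assume u: "u < n" "0 \<le> p" "valid v (hub v u \<union> {x \<in> rim v u. colour S x})"
  show "solved (sem (try_big mu) \<rho> S) v"
    unfolding eq
  proof (rule loop_advances(2)[OF good step u(1)])
    fix T assume T: "advances check_writes S T"
    then have "colour T = colour S" by (simp add: advances_def colour_def fun_eq_iff)
    then show "solved (sem (try_hub mu) (\<rho>(''u'' := int u)) T) v"
      using T u v
      by (intro try_big_step(2)[OF spec _ v(1) _ u(1)]) (auto simp: advances_def)
  qed
qed

definition suits :: "nat \<Rightarrow> (nat \<Rightarrow> bool) \<Rightarrow> bool" where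
  "suits v col \<longleftrightarrow> (\<exists>C. small_suits v col C) \<or>
     (0 \<le> p \<and> (\<exists>u<n. valid v (hub v u \<union> {x \<in> rim v u. col x})))"

abbreviation vertex_writes :: "vname set" where
  "vertex_writes \<equiv> temps \<union> {''c'', ''ok'', ''X'', ''lab'', ''old'', ''new''}"

lemma vertex_correct:
  assumes spec: mu_spec and ml: "measure_like \<mu>" and good: "good S" and v: "v < n" "\<rho> ''v'' = int v"
  shows "advances vertex_writes S (sem (vertex mu) \<rho> S)"
    and "suits v (colour S) \<Longrightarrow> solved (sem (vertex mu) \<rho> S) v"
proof -
  define S1 where "S1 = sem label \<rho> S"
  define c where "c = CSeq subset_sums (try_sums mu)"
  define S2 where "S2 = sem (CFor ''h'' ''n'' c) \<rho> S1"
  let ?W = "temps \<union> check_writes"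
  have a1: "advances {''lab'', ''old'', ''new''} S S1"
    unfolding S1_def by (rule advances_sem[OF _ _ good]) (auto simp: label_def relabel_def input_names_def)
  have g1: "good S1" using a1 by (simp add: advances_def)
  have col1: "colour S1 = colour S" using a1 by (simp add: advances_def colour_def fun_eq_iff)
  have lab1: "label_spec S1 v" unfolding S1_def by (rule label_correct[where \<rho> = \<rho>, OF good_base[OF good] v])
  have keep: "label_spec T v \<and> colour T = colour S" if "advances ?W S1 T" for T
  proof -
    have "T ''r'' = S1 ''r''" "T ''lab'' = S1 ''lab''" using that by (simp_all add: advances_def temps_def)
    note r = this
    then have c: "colour T = colour S1" by (simp add: colour_def fun_eq_iff)
    have "label_spec T v" using lab1 unfolding label_spec_def c r .
    then show ?thesis using col1 c by simp
  qed
  have step: "advances ?W T (sem c (\<rho>(''h'' := int h)) T)" if "h < n" "advances ?W S1 T" for h T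
  proof -
    let ?r = "\<rho>(''h'' := int h)"
    have gT: "good T" using that by (simp add: advances_def)
    have "advances temps T (sem subset_sums ?r T)"
      by (rule advances_sem[OF _ _ gT]) (auto simp: subset_sums_def add_class_def copy_solution_def input_names_def temps_def)
    then have b: "advances ?W T (sem subset_sums ?r T)" by (rule advances_mono) blast
    then have "good (sem subset_sums ?r T)" by (simp add: advances_def)
    then have "advances check_writes (sem subset_sums ?r T) (sem (try_sums mu) ?r (sem subset_sums ?r T))"
      by (rule try_sums_correct(1)[OF spec _ v(1)]) (use v in simp)
    then have "advances ?W (sem subset_sums ?r T) (sem (try_sums mu) ?r (sem subset_sums ?r T))"
      by (rule advances_mono) blast
    with b show ?thesis unfolding c_def sem.simps(2) by (rule advances_trans)
  qed
  have S2: "S2 = loop (\<lambda>h. sem c (\<rho>(''h'' := int h))) n S1"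
    unfolding S2_def sem.simps(4) base_n[OF good_base[OF g1]] nat_int ..
  have a2: "advances ?W S1 S2" unfolding S2 by (rule loop_advances(1)[OF g1 step])
  have g2: "good S2" using a2 by (simp add: advances_def)
  note big = try_big_correct[where \<rho> = \<rho>, OF spec g2 v]
  have S': "sem (vertex mu) \<rho> S = sem (try_big mu) \<rho> S2"
    unfolding vertex_def sem.simps(2) S1_def[symmetric] c_def[symmetric] S2_def[symmetric] ..
  show "advances vertex_writes S (sem (vertex mu) \<rho> S)"
    unfolding S'
  proof (rule advances_trans[OF advances_mono[OF a1] advances_trans[OF advances_mono[OF a2] advances_mono[OF big(1)]]])
  qed auto
  assume "suits v (colour S)"
  then consider C where "small_suits v (colour S) C" |
    u where "0 \<le> p" "u < n" "valid v (hub v u \<union> {x \<in> rim v u. colour S x})"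
    unfolding suits_def by blast
  then show "solved (sem (vertex mu) \<rho> S) v"
  proof cases
    case 1
    have "\<exists>h<n. \<forall>T. advances ?W S1 T \<longrightarrow> solved (sem c (\<rho>(''h'' := int h)) T) v"
    proof (intro exI conjI allI impI)
      show "threshold C < n" using small_correct(1)[where \<rho> = \<rho>, OF spec ml g1 v lab1] 1 col1 by simp
      fix T assume T: "advances ?W S1 T"
      then have "good T" "label_spec T v" "small_suits v (colour T) C"
        using keep[OF T] 1 by (simp_all add: advances_def)
      then show "solved (sem c (\<rho>(''h'' := int (threshold C))) T) v"
        unfolding c_def using v by (intro small_correct(2)[OF spec ml]) simp_all
    qed
    then obtain h where "h < n" and h: "\<And>T. advances ?W S1 T \<Longrightarrow> solved (sem c (\<rho>(''h'' := int h)) T) v" by blast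
    then have "solved S2 v" unfolding S2 by (intro loop_advances(2)[OF g1 step, where i = h])
    then show ?thesis using big(1) by (simp add: S' advances_def progress_def)
  next
    case 2
    have "colour S2 = colour S" using keep[OF a2] by simp
    then show ?thesis using big(2)[OF 2(2,1)] 2(3) by (simp add: S')
  qed
qed

end

section \<open>Enumerating the colourings\<close>

text \<open>A linear feedback shift register. Cells \<open>0\<close> to \<open>t - 1\<close> of
  \<open>b\<close> are the initial values and the next \<open>t\<close> cells the feedback
  coefficients; the sum modulo 2 is formed by flipping the new cell once per contributing
  term.\<close>

definition lfsr :: cmd where
  "lfsr = CSeq (CFor ''i'' ''t'' (CAssign ''r'' (EV ''i'') (ER ''b'' (EV ''i''))))
     (CFor ''i'' ''n'' (CSeq (CAssign ''r'' (EP (EV ''i'') (sc ''t'')) (EN 0))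
       (CFor ''j'' ''t'' (CIf (eand (ER ''b'' (EP (sc ''t'') (EV ''j''))) (ER ''r'' (EP (EV ''i'') (EV ''j''))))
         (CAssign ''r'' (EP (EV ''i'') (sc ''t'')) (EM (EN 1) (ER ''r'' (EP (EV ''i'') (sc ''t''))))) CSkip))))"

text \<open>A binary counter, least significant bit first. \<open>bits\<close> records the counter
  modulo \<open>2 ^ D\<close>, so the overflow after the last seed needs no special
  treatment.\<close>

definition increment :: cmd where
  "increment = CSeq (CAssign ''carry'' (EN 0) (EN 1))
     (CFor ''j'' ''tt'' (CIf (sc ''carry'')
       (CIf (ER ''b'' (EV ''j'')) (CAssign ''b'' (EV ''j'') (EN 0))
         (CSeq (CAssign ''b'' (EV ''j'') (EN 1)) (CAssign ''carry'' (EN 0) (EN 0)))) CSkip))"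

definition search :: "ex \<Rightarrow> cmd" where
  "search mu = CFor ''s'' ''N'' (CSeq lfsr (CSeq (CFor ''v'' ''n'' (vertex mu)) increment))"

definition bits :: "nat \<Rightarrow> nat \<Rightarrow> state \<Rightarrow> bool" where
  "bits D s S \<longleftrightarrow> (\<forall>j<D. S ''b'' (int j) = int (s div 2 ^ j mod 2))"

text \<open>A carry arrives at position \<open>j\<close> exactly when \<open>Suc s\<close> is
  divisible by \<open>2 ^ j\<close>, that is, when all lower bits of \<open>s\<close> are ones; it
  moves on if bit \<open>j\<close> is a one as well.\<close>

lemma bit_Suc_carry:
  "Suc s div 2 ^ j mod 2 = (if Suc s mod 2 ^ j = 0 then 1 - s div 2 ^ j mod 2 else s div 2 ^ j mod (2::nat))"
  "Suc s mod 2 ^ Suc j = 0 \<longleftrightarrow> Suc s mod 2 ^ j = 0 \<and> s div 2 ^ j mod 2 = 1"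
proof -
  define m where "m = (2::nat) ^ j"
  have m: "m > 0" by (simp add: m_def)
  have d: "Suc s div m = (if Suc s mod m = 0 then Suc (s div m) else s div m)"
    using div_Suc[of s m] by simp
  show "Suc s div 2 ^ j mod 2 = (if Suc s mod 2 ^ j = 0 then 1 - s div 2 ^ j mod 2 else s div 2 ^ j mod (2::nat))"
    unfolding m_def[symmetric] d by (simp add: mod_Suc)
  have "Suc s mod (m * 2) = m * (Suc s div m mod 2) + Suc s mod m"
    by (rule mod_mult2_eq)
  then have "Suc s mod (m * 2) = 0 \<longleftrightarrow> Suc s div m mod 2 = 0 \<and> Suc s mod m = 0"
    using m by auto
  also have "\<dots> \<longleftrightarrow> Suc s mod m = 0 \<and> s div m mod 2 = 1"
    unfolding d by (auto simp: mod_Suc split: if_splits)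
  finally show "Suc s mod 2 ^ Suc j = 0 \<longleftrightarrow> Suc s mod 2 ^ j = 0 \<and> s div 2 ^ j mod 2 = 1"
    by (simp add: m_def mult.commute)
qed

lemma ex_bits: "\<exists>s<2 ^ D. \<forall>j<D. s div 2 ^ j mod 2 = (if \<beta> j then 1 else (0::nat))"
proof (induction D)
  case (Suc D)
  then obtain s where s: "s < 2 ^ D" "\<forall>j<D. s div 2 ^ j mod 2 = (if \<beta> j then 1 else (0::nat))" by blast
  define c where "c = (if \<beta> D then 1 else (0::nat))"
  have c: "c \<le> 1" by (simp add: c_def)
  define s' where "s' = s + 2 ^ D * c"
  have "s' < 2 ^ Suc D" using s(1) c by (cases c) (auto simp: s'_def)
  moreover have "s' div 2 ^ j mod 2 = (if \<beta> j then 1 else 0)" if "j < Suc D" for j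
  proof (cases "j = D")
    case True
    then show ?thesis using s(1) c by (simp add: s'_def) (simp add: c_def)
  next
    case False
    then have "j < D" using that by simp
    then obtain e where e: "D = Suc (j + e)" using less_imp_Suc_add by blast
    have "s' = s + 2 ^ j * (2 * (2 ^ e * c))" by (simp add: s'_def e power_add)
    then have "s' div 2 ^ j = s div 2 ^ j + 2 * (2 ^ e * c)"
      by (simp only: div_mult_self2[OF power_not_zero[OF zero_neq_numeral[symmetric]]])
    then have "s' div 2 ^ j mod 2 = s div 2 ^ j mod 2" by (simp only: mod_mult_self2)
    then show ?thesis using s(2) e by (simp del: power_Suc)
  qed
  ultimately show ?case by blast
qed simp

lemma increment_correct:
  assumes tt: "S ''tt'' 0 = int D" and b: "bits D s S"
  shows "bits D (Suc s) (sem increment \<rho> S)"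
proof -
  define S1 where "S1 = S(''carry'' := (S ''carry'')(0 := 1))"
  define c where "c = CIf (sc ''carry'')
       (CIf (ER ''b'' (EV ''j'')) (CAssign ''b'' (EV ''j'') (EN 0))
         (CSeq (CAssign ''b'' (EV ''j'') (EN 1)) (CAssign ''carry'' (EN 0) (EN 0)))) CSkip"
  have eq: "sem increment \<rho> S = loop (\<lambda>j. sem c (\<rho>(''j'' := int j))) D S1"
    using tt by (simp add: increment_def S1_def c_def)
  define I where "I j T \<longleftrightarrow> (\<forall>i<D. T ''b'' (int i) = int ((if i < j then Suc s else s) div 2 ^ i mod 2)) \<and>
    (0 < T ''carry'' 0 \<longleftrightarrow> Suc s mod 2 ^ j = 0)" for j and T :: state
  have "I D (loop (\<lambda>j. sem c (\<rho>(''j'' := int j))) D S1)"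
  proof (rule loop_invariant)
    show "I 0 S1" using b by (simp add: I_def S1_def bits_def)
    fix j T assume j: "j < D" and T: "I j T"
    have old: "T ''b'' (int j) = int (s div 2 ^ j mod 2)" using T j by (simp add: I_def)
    have cy: "0 < T ''carry'' 0 \<longleftrightarrow> Suc s mod 2 ^ j = 0" using T by (simp add: I_def)
    have oth: "T ''b'' (int i) = int ((if i < Suc j then Suc s else s) div 2 ^ i mod 2)" if "i < D" "i \<noteq> j" for i
      using T that by (simp add: I_def less_Suc_eq)
    note B = bit_Suc_carry[of s j]
    let ?r = "\<rho>(''j'' := int j)"
    consider "Suc s mod 2 ^ j \<noteq> 0" | "Suc s mod 2 ^ j = 0" "s div 2 ^ j mod 2 = 1" | "Suc s mod 2 ^ j = 0" "s div 2 ^ j mod 2 = 0"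
      by fastforce
    then show "I (Suc j) (sem c ?r T)"
    proof cases
      case 1
      then have "sem c ?r T = T" using cy by (simp add: c_def)
      moreover have "T ''b'' (int i) = int ((if i < Suc j then Suc s else s) div 2 ^ i mod 2)" if "i < D" for i
        using oth[OF that] old 1 B(1) by (cases "i = j") (simp_all del: power_Suc)
      ultimately show ?thesis using 1 B(2) cy by (simp add: I_def del: power_Suc)
    next
      case 2
      then have "sem c ?r T = T(''b'' := (T ''b'')(int j := 0))" using cy old by (simp add: c_def)
      moreover have "((T ''b'')(int j := 0)) (int i) = int ((if i < Suc j then Suc s else s) div 2 ^ i mod 2)" if "i < D" for i
        using oth[OF that] 2 B(1) by (cases "i = j") (simp_all del: power_Suc)
      ultimately show ?thesis using 2 B(2) cy by (simp add: I_def del: power_Suc)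
    next
      case 3
      then have "sem c ?r T = T(''b'' := (T ''b'')(int j := 1), ''carry'' := (T ''carry'')(0 := 0))"
        using cy old by (simp add: c_def)
      moreover have "((T ''b'')(int j := 1)) (int i) = int ((if i < Suc j then Suc s else s) div 2 ^ i mod 2)" if "i < D" for i
        using oth[OF that] 3 B(1) by (cases "i = j") (simp_all del: power_Suc)
      ultimately show ?thesis using 3 B(2) cy by (simp add: I_def del: power_Suc)
    qed
  qed
  then show ?thesis unfolding eq by (simp add: I_def bits_def)
qed

lemma lfsr_correct:
  fixes f r :: "nat \<Rightarrow> bit"
  assumes n: "S ''n'' 0 = int n" and t: "S ''t'' 0 = int t"
    and rec: "\<And>i. r (i + t) = (\<Sum>j<t. f j * r (i + j))"
    and start: "\<And>j. j < t \<Longrightarrow> 0 < S ''b'' (int j) \<longleftrightarrow> r j = 1"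
    and feedback: "\<And>j. j < t \<Longrightarrow> 0 < S ''b'' (int (t + j)) \<longleftrightarrow> f j = 1"
    and i: "i < n"
  shows "0 < sem lfsr \<rho> S ''r'' (int i) \<longleftrightarrow> r i = 1"
proof -
  define S1 where "S1 = sem (CFor ''i'' ''t'' (CAssign ''r'' (EV ''i'') (ER ''b'' (EV ''i'')))) \<rho> S"
  define c where "c = CIf (eand (ER ''b'' (EP (sc ''t'') (EV ''j''))) (ER ''r'' (EP (EV ''i'') (EV ''j''))))
         (CAssign ''r'' (EP (EV ''i'') (sc ''t'')) (EM (EN 1) (ER ''r'' (EP (EV ''i'') (sc ''t''))))) CSkip"
  have S1r: "S1 ''r'' (int j) = S ''b'' (int j)" if "j < t" for j
    unfolding S1_def
    by (rule for_fill(2)[where g = int and m = t and k = "''t''" and S = S and w = "\<lambda>j. S ''b'' (int j)", OF _ _ _ that])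
      (simp_all add: t)
  have S1f: "S1 x = S x" if "x \<noteq> ''r''" for x
    unfolding S1_def by (rule sem_frame) (use that in simp)
  define I where "I i T \<longleftrightarrow> (\<forall>x. x \<noteq> ''r'' \<longrightarrow> T x = S x) \<and> (\<forall>j<t + i. 0 < T ''r'' (int j) \<longleftrightarrow> r j = 1)" for i and T :: state
  let ?body = "CSeq (CAssign ''r'' (EP (EV ''i'') (sc ''t'')) (EN 0)) (CFor ''j'' ''t'' c)"
  have eq: "sem lfsr \<rho> S = loop (\<lambda>i. sem ?body (\<rho>(''i'' := int i))) n S1"
    unfolding lfsr_def sem.simps(2)[of _ _ \<rho>] S1_def[symmetric] c_def[symmetric]
    by (subst sem.simps(4)) (simp add: S1f n)
  have "I n (loop (\<lambda>i. sem ?body (\<rho>(''i'' := int i))) n S1)"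
  proof (rule loop_invariant)
    show "I 0 S1" using S1f S1r start by (simp add: I_def)
    fix i T assume i: "i < n" and T: "I i T"
    have Tf: "T x = S x" if "x \<noteq> ''r''" for x using T that unfolding I_def by blast
    have Tr: "0 < T ''r'' (int j) \<longleftrightarrow> r j = 1" if "j < t + i" for j using T that unfolding I_def by blast
    let ?r = "\<rho>(''i'' := int i)"
    define T1 where "T1 = T(''r'' := (T ''r'')(int (i + t) := 0))"
    have b: "sem ?body ?r T = loop (\<lambda>j. sem c (?r(''j'' := int j))) t T1"
      by (simp add: T1_def Tf t add.commute)
    \<comment> \<open>The cell \<open>i + t\<close> under construction holds the partial feedback
      sum, coded as 0 or 1, while all earlier cells stay fixed.\<close>
    define J where "J j U \<longleftrightarrow> (\<forall>x. x \<noteq> ''r'' \<longrightarrow> U x = S x) \<and> (\<forall>j<t + i. U ''r'' (int j) = T ''r'' (int j)) \<and>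
      U ''r'' (int (i + t)) = (if (\<Sum>j'<j. f j' * r (i + j')) = 1 then 1 else 0)" for j and U :: state
    have "J t (loop (\<lambda>j. sem c (?r(''j'' := int j))) t T1)"
    proof (rule loop_invariant)
      show "J 0 T1" using Tf by (simp add: J_def T1_def)
      fix j U assume j: "j < t" and U: "J j U"
      have Uf: "U x = S x" if "x \<noteq> ''r''" for x using U that unfolding J_def by blast
      have Ur: "U ''r'' (int j) = T ''r'' (int j)" if "j < t + i" for j using U that unfolding J_def by blast
      have Us: "U ''r'' (int (i + t)) = (if (\<Sum>j'<j. f j' * r (i + j')) = 1 then 1 else 0)" using U unfolding J_def by blast
      have cond: "0 < eval (eand (ER ''b'' (EP (sc ''t'') (EV ''j''))) (ER ''r'' (EP (EV ''i'') (EV ''j'')))) (?r(''j'' := int j)) U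
        \<longleftrightarrow> f j = 1 \<and> r (i + j) = 1"
        using feedback[OF j] Tr[of "i + j"] Ur[of "i + j"] j by (simp add: Uf t)
      let ?U = "sem c (?r(''j'' := int j)) U"
      have ev: "eval (EP (EV ''i'') (sc ''t'')) (?r(''j'' := int j)) U = int (i + t)" by (simp add: Uf t)
      have U': "?U = (if f j = 1 \<and> r (i + j) = 1 then U(''r'' := (U ''r'')(int (i + t) := 1 - U ''r'' (int (i + t)))) else U)"
        unfolding c_def sem.simps cond ev eval.simps(5) eval.simps(3) eval.simps(1) by simp
      show "J (Suc j) ?U"
      proof (cases "f j = 1 \<and> r (i + j) = 1")
        case True
        then have U2: "?U = U(''r'' := (U ''r'')(int (i + t) := 1 - U ''r'' (int (i + t))))" by (subst U') (use True in simp)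
        have "(\<Sum>j'<Suc j. f j' * r (i + j')) = (\<Sum>j'<j. f j' * r (i + j')) + 1" using True by simp
        then show ?thesis unfolding J_def U2 using Uf Ur Us
          by (cases "\<Sum>j'<j. f j' * r (i + j')") auto
      next
        case False
        then have U2: "?U = U" by (simp only: U' if_False)
        have "f j * r (i + j) = 0" using False by (cases "f j"; cases "r (i + j)") auto
        then show ?thesis unfolding U2 using U by (simp add: J_def)
      qed
    qed
    then have J: "J t (sem ?body ?r T)" unfolding b .
    show "I (Suc i) (sem ?body ?r T)"
      unfolding I_def
    proof (intro conjI allI impI)
      show "sem ?body ?r T x = S x" if "x \<noteq> ''r''" for x using J that unfolding J_def by blast
      show "0 < sem ?body ?r T ''r'' (int j) \<longleftrightarrow> r j = 1" if "j < t + Suc i" for j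
      proof (cases "j < t + i")
        case True
        then show ?thesis using J Tr[OF True] unfolding J_def by simp
      next
        case False
        then have j: "j = i + t" using that by simp
        have "sem ?body ?r T ''r'' (int (i + t)) = (if r (i + t) = 1 then 1 else 0)"
          using J unfolding J_def rec by blast
        then show ?thesis unfolding j by simp
      qed
    qed
  qed
  then show ?thesis using i unfolding eq I_def by simp
qed

context run
begin

abbreviation search_writes :: "vname set" where
  "search_writes \<equiv> vertex_writes \<union> {''r'', ''b'', ''carry''}"

lemma advances_frame: "advances W S T \<Longrightarrow> x \<notin> W \<Longrightarrow> T x = S x"
  by (simp add: advances_def)

lemma advances_solved: "advances W S T \<Longrightarrow> solved S v \<Longrightarrow> solved T v"
  by (simp add: advances_def progress_def)

text \<open>For the second claim it is enough that some seed agrees with \<open>P\<close> on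
  \<open>A\<close>. That seed occurs at an unknown round \<open>s\<close>; a vertex solved there
  remains solved.\<close>

lemma search_correct:
  assumes spec: mu_spec and ml: "measure_like \<mu>" and good: "good S"
    and t: "S ''t'' 0 = int t" "S ''tt'' 0 = int (2 * t)" "S ''N'' 0 = int (2 ^ (2 * t))" "0 < t"
    and b: "S ''b'' = (\<lambda>_. 0)"
  shows "advances search_writes S (sem (search mu) \<rho> S)"
    and "v < n \<Longrightarrow> A \<subseteq> {..<n} \<Longrightarrow> 2 ^ card A * n < 2 ^ t \<Longrightarrow>
      (\<And>col. (\<And>x. x \<in> A \<Longrightarrow> col x \<longleftrightarrow> x \<in> P) \<Longrightarrow> suits v col) \<Longrightarrow> solved (sem (search mu) \<rho> S) v"
proof -
  define c where "c = CSeq lfsr (CSeq (CFor ''v'' ''n'' (vertex mu)) increment)"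
  have N: "nat (S ''N'' 0) = 2 ^ (2 * t)" using t(3) by (simp only: nat_int)
  have eq: "sem (search mu) \<rho> S = loop (\<lambda>s. sem c (\<rho>(''s'' := int s))) (2 ^ (2 * t)) S"
    unfolding search_def c_def[symmetric] sem.simps(4) N ..
  have body: "advances search_writes T (sem c \<rho>' T) \<and> bits (2 * t) (Suc s) (sem c \<rho>' T) \<and>
      (v < n \<longrightarrow> suits v (colour (sem lfsr \<rho>' T)) \<longrightarrow> solved (sem c \<rho>' T) v)"
    if T: "advances search_writes S T" "bits (2 * t) s T" for s T v \<rho>'
  proof -
    have gT: "good T" using T by (simp add: advances_def)
    define T1 where "T1 = sem lfsr \<rho>' T"
    define T2 where "T2 = sem (CFor ''v'' ''n'' (vertex mu)) \<rho>' T1"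
    have eqc: "sem c \<rho>' T = sem increment \<rho>' T2" by (simp only: c_def sem.simps(2) T1_def T2_def)
    have a1: "advances {''r''} T T1"
      unfolding T1_def by (rule advances_sem[OF _ _ gT]) (auto simp: lfsr_def input_names_def)
    have g1: "good T1" using a1 by (simp add: advances_def)
    have T2: "T2 = loop (\<lambda>v. sem (vertex mu) (\<rho>'(''v'' := int v))) n T1"
      unfolding T2_def sem.simps(4) base_n[OF good_base[OF g1]] nat_int ..
    have step: "advances vertex_writes U (sem (vertex mu) (\<rho>'(''v'' := int v)) U)" if "v < n" "advances vertex_writes T1 U" for v U
      by (rule vertex_correct(1)[OF spec ml _ that(1)]) (use that in \<open>simp_all add: advances_def\<close>)
    have a2: "advances vertex_writes T1 T2" unfolding T2 by (rule loop_advances(1)[OF g1 step])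
    have g2: "good T2" using a2 by (simp add: advances_def)
    have a3: "advances {''b'', ''carry''} T2 (sem increment \<rho>' T2)"
      by (rule advances_sem[OF _ _ g2]) (auto simp: increment_def input_names_def)
    have a12: "advances (vertex_writes \<union> {''r''}) T T2"
      by (rule advances_trans[OF advances_mono[OF a1] advances_mono[OF a2]]) blast+
    have same: "T2 x = T x" if "x \<notin> vertex_writes \<union> {''r''}" for x by (rule advances_frame[OF a12 that])
    have "T2 ''b'' = T ''b''" by (rule same) (simp add: temps_def)
    then have bT2: "bits (2 * t) s T2" using T(2) by (simp add: bits_def)
    have "T2 ''tt'' = T ''tt''" by (rule same) (simp add: temps_def)
    also have "T ''tt'' = S ''tt''" using T(1) by (simp add: advances_def temps_def)
    finally have "T2 ''tt'' 0 = int (2 * t)" using t(2) by simp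
    then have "bits (2 * t) (Suc s) (sem c \<rho>' T)" unfolding eqc by (rule increment_correct[OF _ bT2])
    moreover have "advances search_writes T (sem c \<rho>' T)"
      unfolding eqc by (rule advances_trans[OF advances_mono[OF a12] advances_mono[OF a3]]) auto
    moreover have "solved (sem c \<rho>' T) v" if v: "v < n" "suits v (colour T1)"
    proof -
      have "solved T2 v"
        unfolding T2
      proof (rule loop_advances(2)[OF g1 step v(1)])
        fix U assume U: "advances vertex_writes T1 U"
        then have "U ''r'' = T1 ''r''" by (simp add: advances_def temps_def)
        then have "colour U = colour T1" by (simp add: colour_def fun_eq_iff)
        then show "solved (sem (vertex mu) (\<rho>'(''v'' := int v)) U) v"
          using U v by (intro vertex_correct(2)[OF spec ml]) (simp_all add: advances_def)
      qed
      then show ?thesis unfolding eqc by (rule advances_solved[OF a3])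
    qed
    ultimately show ?thesis by (simp add: T1_def)
  qed
  have b0: "bits (2 * t) 0 S" using b by (simp add: bits_def)
  have "advances search_writes S (loop (\<lambda>s. sem c (\<rho>(''s'' := int s))) (2 ^ (2 * t)) S) \<and>
    bits (2 * t) (2 ^ (2 * t)) (loop (\<lambda>s. sem c (\<rho>(''s'' := int s))) (2 ^ (2 * t)) S)"
  proof (rule loop_invariant[where P = "\<lambda>s T. advances search_writes S T \<and> bits (2 * t) s T"])
    show "advances search_writes S S \<and> bits (2 * t) 0 S" using advances_refl[OF good] b0 by simp
    fix i T assume T: "advances search_writes S T \<and> bits (2 * t) i T"
    note B = body[OF conjunct1[OF T] conjunct2[OF T], of "\<rho>(''s'' := int i)"]
    show "advances search_writes S (sem c (\<rho>(''s'' := int i)) T) \<and> bits (2 * t) (Suc i) (sem c (\<rho>(''s'' := int i)) T)"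
      using advances_trans[OF conjunct1[OF T] conjunct1[OF B]] B by simp
  qed
  then show "advances search_writes S (sem (search mu) \<rho> S)" unfolding eq by blast
  assume v: "v < n" and A: "A \<subseteq> {..<n}" "2 ^ card A * n < 2 ^ t"
    and P: "\<And>col. (\<And>x. x \<in> A \<Longrightarrow> col x \<longleftrightarrow> x \<in> P) \<Longrightarrow> suits v col"
  obtain f r :: "nat \<Rightarrow> bit" where fr: "\<And>i. r (i + t) = (\<Sum>j<t. f j * r (i + j))"
      "\<And>i. i \<in> A \<Longrightarrow> r i = (if i \<in> P then 1 else 0)"
    by (rule linear_recurrence_universal[OF A(1) t(4) A(2), where \<pi> = "\<lambda>i. if i \<in> P then 1 else 0"]) (rule that)
  \<comment> \<open>The seed in question: the first \<open>t\<close> terms of \<open>r\<close>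
    followed by the feedback coefficients \<open>f\<close>.\<close>
  obtain s where s: "s < 2 ^ (2 * t)" "\<forall>j<2 * t. s div 2 ^ j mod 2 = (if (if j < t then r j = 1 else f (j - t) = 1) then 1 else (0::nat))"
    using ex_bits[of "2 * t" "\<lambda>j. if j < t then r j = 1 else f (j - t) = 1"] by blast
  have hit: "solved (sem c (\<rho>(''s'' := int s)) T) v" if T: "advances search_writes S T" "bits (2 * t) s T" for T
  proof -
    have nt: "T ''n'' 0 = int n" "T ''t'' 0 = int t"
      using T(1) t(1) base_n[OF good_base[OF good]] by (simp_all add: advances_def temps_def)
    have B: "0 < T ''b'' (int j) \<longleftrightarrow> (if j < t then r j = 1 else f (j - t) = 1)" if "j < 2 * t" for j
      using T(2) s(2) that by (simp add: bits_def)
    have "colour (sem lfsr (\<rho>(''s'' := int s)) T) x \<longleftrightarrow> x \<in> P" if "x \<in> A" for x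
    proof -
      have "x < n" using that A(1) by auto
      then have "0 < sem lfsr (\<rho>(''s'' := int s)) T ''r'' (int x) \<longleftrightarrow> r x = 1"
      proof (intro lfsr_correct[where S = T and n = n and t = t and f = f and r = r, OF nt fr(1)])
        show "0 < T ''b'' (int j) \<longleftrightarrow> r j = 1" "0 < T ''b'' (int (t + j)) \<longleftrightarrow> f j = 1" if "j < t" for j
          using B[of j] B[of "t + j"] that by simp_all
      qed
      then show ?thesis using fr(2)[OF that] by (simp add: colour_def)
    qed
    then have "suits v (colour (sem lfsr (\<rho>(''s'' := int s)) T))" by (rule P)
    then show ?thesis using body[OF T, of "\<rho>(''s'' := int s)" v] v by simp
  qed
  have "(advances search_writes S (loop (\<lambda>s. sem c (\<rho>(''s'' := int s))) (2 ^ (2 * t)) S) \<and>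
    bits (2 * t) (2 ^ (2 * t)) (loop (\<lambda>s. sem c (\<rho>(''s'' := int s))) (2 ^ (2 * t)) S)) \<and>
    (s < 2 ^ (2 * t) \<longrightarrow> solved (loop (\<lambda>s. sem c (\<rho>(''s'' := int s))) (2 ^ (2 * t)) S) v)"
  proof (rule loop_invariant[where P = "\<lambda>i T. (advances search_writes S T \<and> bits (2 * t) i T) \<and> (s < i \<longrightarrow> solved T v)"])
    show "(advances search_writes S S \<and> bits (2 * t) 0 S) \<and> (s < 0 \<longrightarrow> solved S v)"
      using advances_refl[OF good] b0 by simp
    fix i T assume T: "(advances search_writes S T \<and> bits (2 * t) i T) \<and> (s < i \<longrightarrow> solved T v)"
    let ?T = "sem c (\<rho>(''s'' := int i)) T"
    have T1: "advances search_writes S T" "bits (2 * t) i T" using T by simp_all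
    have 1: "advances search_writes T ?T" "bits (2 * t) (Suc i) ?T"
      using body[OF T1, of "\<rho>(''s'' := int i)"] by simp_all
    have "solved ?T v" if "s < Suc i"
    proof (cases "s = i")
      case True
      then show ?thesis using hit[of T] T1 by simp
    next
      case False
      then have "solved T v" using T that by simp
      then show ?thesis by (rule advances_solved[OF 1(1)])
    qed
    then show "(advances search_writes S ?T \<and> bits (2 * t) (Suc i) ?T) \<and> (s < Suc i \<longrightarrow> solved ?T v)"
      using 1 advances_trans[OF T1(1) 1(1)] by simp
  qed
  then show "solved (sem (search mu) \<rho> S) v" unfolding eq using s(1) by blast
qed

text \<open>For a small cluster the relevant vertices are \<open>C - {v}\<close> and at most equally
  many outer neighbours, \<open>4 * p\<close> each. For a large one they form \<open>Q\<close>, with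
  at most \<open>p + 1\<close> vertices; the summand 2 takes care of this when
  \<open>p = 0\<close>.\<close>

lemma suitable_pattern:
  assumes ml: "measure_like \<mu>" and v: "v < n" and C: "C \<subseteq> {..<n}" "valid v C"
  obtains A P where "A \<subseteq> {..<n}" "card A \<le> 8 * nat p + 2"
    "\<And>col. (\<And>x. x \<in> A \<Longrightarrow> col x \<longleftrightarrow> x \<in> P) \<Longrightarrow> suits v col"
proof -
  note witness = that
  have p: "0 \<le> p" using C(2) by (simp add: valid_def)
  have vC: "v \<in> C" using C(2) by (simp add: valid_def)
  have finC: "finite C" using C(1) finite_subset by blast
  have small: ?thesis if D: "D \<subseteq> {..<n}" "valid v D" and
    few: "ecount (D - {v}) ({..<n} - D) \<le> card (D - {v})" and size: "card (D - {v}) \<le> 4 * nat p" for D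
  proof -
    let ?X = "{y \<in> {..<n} - D. \<exists>x\<in>D - {v}. E x y}"
    have fin: "finite (D - {v})" using D(1) finite_subset by blast
    show ?thesis
    proof (rule witness[of "(D - {v}) \<union> ?X" D])
      show "(D - {v}) \<union> ?X \<subseteq> {..<n}" using D by auto
      have "card ((D - {v}) \<union> ?X) \<le> card (D - {v}) + card ?X" by (rule card_Un_le)
      also have "card ?X \<le> card (D - {v})"
        using neighbour_count_le[OF fin, of "{..<n} - D"] few by simp
      finally show "card ((D - {v}) \<union> ?X) \<le> 8 * nat p + 2" using size by linarith
      fix col assume col: "\<And>x. x \<in> (D - {v}) \<union> ?X \<Longrightarrow> col x \<longleftrightarrow> x \<in> D"
      have "small_suits v col D"
        unfolding small_suits_def using D col by auto
      then show "suits v col" by (auto simp: suits_def)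
    qed
  qed
  show ?thesis
  \<comment> \<open>By monotonicity the measure of \<open>{v}\<close> is within \<open>p\<close>, so
    a singleton can fail only through its edges, and then it has more outgoing edges than
    \<open>C\<close>.\<close>
  proof (cases "int (out {v}) \<le> q")
    case True
    have "\<mu> {v} \<le> \<mu> C" using ml[unfolded measure_like_def, THEN conjunct1, rule_format, OF C(1), of "{v}"] vC by simp
    then have "valid v {v}" using C(2) True by (simp add: valid_def)
    then show ?thesis using small[of "{v}"] v by simp
  next
    case False
    then have "out C < out {v}" using C(2) by (simp add: valid_def)
    note few = few_outgoing_edges[OF C(1) vC this]
    show ?thesis
    proof (cases "4 * nat p < card C")
      case False
      have "card (C - {v}) \<le> card C" using finC by (intro card_mono) auto
      then show ?thesis using small[OF C] few False by linarith
    next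
      case True
      have "miss C x \<le> nat p" if "x \<in> C" for x
      proof -
        have "miss C x \<le> \<mu> C" by (rule ml[unfolded measure_like_def, THEN conjunct2, THEN conjunct1, rule_format, OF C(1) that])
        then show ?thesis using C(2) p by (simp add: valid_def le_nat_iff)
      qed
      from large_cluster[OF C(1) vC few this True]
      obtain u B Q where u: "u < n" and B: "B = {x. x < n \<and> (x = v \<or> x = u \<or> E u x)}"
        and Q: "Q = {x. x < n \<and> x \<notin> B \<and> card B \<le> deg B x + nat p}" and CB: "C = B \<union> (Q \<inter> C)"
        and cQ: "card Q \<le> nat p + 1" by blast
      have BQ: "B = hub v u" "Q = rim v u" by (simp_all add: B Q hub_def rim_def)
      show ?thesis
      proof (rule witness[of Q C])
        show "Q \<subseteq> {..<n}" by (auto simp: Q)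
        show "card Q \<le> 8 * nat p + 2" using cQ by simp
        fix col assume "\<And>x. x \<in> Q \<Longrightarrow> col x \<longleftrightarrow> x \<in> C"
        then have "{x \<in> rim v u. col x} = Q \<inter> C" unfolding BQ by auto
        then have "hub v u \<union> {x \<in> rim v u. col x} = C" using CB unfolding BQ by simp
        then show "suits v col" using C(2) u p unfolding suits_def by metis
      qed
    qed
  qed
qed

end

section \<open>Uncrossing the clusters\<close>

text \<open>If the first difference has too many outgoing edges, \<open>out_posimodular\<close>
  guarantees the bound for the second. The common vertices remain in the row that is not trimmed, so
  no vertex loses its cover.\<close>

definition separate :: cmd where
  "separate = CSeq (CFor ''u'' ''n'' (CAssign ''c'' (EV ''u'')
       (ecount_if (eand (ER ''X'' (eidx ''i'' ''u'')) (enot (ER ''X'' (eidx ''j'' ''u'')))))))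
     (CIf (ele eout (sc ''q''))
       (CFor ''u'' ''n'' (CAssign ''X'' (eidx ''i'' ''u'') (ER ''c'' (EV ''u''))))
       (CFor ''u'' ''n'' (CAssign ''X'' (eidx ''j'' ''u'')
         (EIf (ER ''X'' (eidx ''i'' ''u'')) (EN 0) (ER ''X'' (eidx ''j'' ''u''))))))"

text \<open>One pass over the pairs is enough: rows only shrink, so disjoint rows stay
  disjoint.\<close>

definition uncross :: cmd where
  "uncross = CFor ''i'' ''n'' (CFor ''j'' ''n'' (CIf (ELt (EV ''i'') (EV ''j'')) separate CSkip))"

text \<open>After uncrossing, each vertex lies in exactly one row when all vertices are solved, so
  the sum in the last loop reads off the index of that row. Otherwise \<open>found\<close> is 0 and
  the labels are irrelevant.\<close>

definition finish :: cmd where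
  "finish = CSeq (CAssign ''found'' (EN 0)
       (EIf (ELt (ESum ''v'' ''n'' (ecount_if (ER ''ok'' (EV ''v'')))) (sc ''n'')) (EN 0) (EN 1)))
     (CSeq uncross (CFor ''u'' ''n'' (CAssign ''cluster'' (EV ''u'')
       (ESum ''i'' ''n'' (EIf (ER ''X'' (eidx ''i'' ''u'')) (EV ''i'') (EN 0))))))"

context run
begin

text \<open>In contrast to \<open>valid\<close>, a row need not contain the vertex it was found for,
  which trimming may remove.\<close>

definition fits :: "nat set \<Rightarrow> bool" where
  "fits R \<longleftrightarrow> int (\<mu> R) \<le> p \<and> int (out R) \<le> q"

definition shrinks :: "state \<Rightarrow> state \<Rightarrow> bool" where
  "shrinks S S' \<longleftrightarrow> base S' \<and> (\<forall>x. x \<notin> {''c'', ''X''} \<longrightarrow> S' x = S x) \<and>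
     ((\<forall>w<n. fits (row S w)) \<longrightarrow> (\<forall>w<n. fits (row S' w))) \<and> (\<forall>w<n. row S' w \<subseteq> row S w) \<and>
     (\<Union>w<n. row S' w) = (\<Union>w<n. row S w)"

lemma shrinks_refl: "base S \<Longrightarrow> shrinks S S"
  by (simp add: shrinks_def)

lemma shrinks_trans: "shrinks S T \<Longrightarrow> shrinks T U \<Longrightarrow> shrinks S U"
proof -
  assume S: "shrinks S T" and T: "shrinks T U"
  have "row U w \<subseteq> row S w" if "w < n" for w
    using S T that unfolding shrinks_def by (meson subset_trans)
  moreover have "(\<forall>w<n. fits (row S w)) \<Longrightarrow> (\<forall>w<n. fits (row U w))"
    using S T by (simp add: shrinks_def)
  ultimately show "shrinks S U" using S T by (simp add: shrinks_def)
qed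

lemma separate_correct:
  assumes ml: "measure_like \<mu>" and base: "base S" and i: "\<rho> ''i'' = int i" "i < n" and j: "\<rho> ''j'' = int j" "j < n"
    and ij: "i \<noteq> j" and ft: "\<forall>w<n. fits (row S w)"
  shows "shrinks S (sem separate \<rho> S)" "row (sem separate \<rho> S) i \<inter> row (sem separate \<rho> S) j = {}"
proof -
  define S1 where "S1 = sem (CFor ''u'' ''n'' (CAssign ''c'' (EV ''u'')
       (ecount_if (eand (ER ''X'' (eidx ''i'' ''u'')) (enot (ER ''X'' (eidx ''j'' ''u''))))))) \<rho> S"
  define S' where "S' = sem separate \<rho> S"
  let ?Xi = "row S i" and ?Xj = "row S j"
  have c: "S1 ''c'' (int u) = (if u \<in> ?Xi - ?Xj then 1 else 0)" if u: "u < n" for u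
    unfolding S1_def
  proof (rule for_fill(2)[where g = int and m = n and k = "''n''" and S = S and w = "\<lambda>u. if u \<in> ?Xi - ?Xj then 1 else 0", OF _ _ _ u])
    show "nat (S ''n'' 0) = n" using base by (simp add: base_n)
    fix u T assume u: "u < n" and T: "\<And>x. x \<noteq> ''c'' \<Longrightarrow> T x = S x"
    have bT: "base T" using base by (rule base_frame) (auto simp: T input_names_def)
    show "eval (EV ''u'') (\<rho>(''u'' := int u)) T = int u \<and>
      eval (ecount_if (eand (ER ''X'' (eidx ''i'' ''u'')) (enot (ER ''X'' (eidx ''j'' ''u''))))) (\<rho>(''u'' := int u)) T
      = (if u \<in> ?Xi - ?Xj then 1 else 0)"
      using u i j by (simp add: eval_eidx[OF bT] T row_def)
  qed simp
  have S1f: "S1 x = S x" if "x \<noteq> ''c''" for x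
    unfolding S1_def by (rule sem_frame) (use that in simp)
  have b1: "base S1" using base by (rule base_frame) (auto simp: S1f input_names_def)
  have r1: "row S1 w = row S w" for w by (simp add: row_def S1f)
  have cs: "cset S1 ''c'' = ?Xi - ?Xj"
    unfolding cset_def using c row_subset[of S i] by auto
  have cond: "0 < eval (ele eout (sc ''q'')) \<rho> S1 \<longleftrightarrow> int (out (?Xi - ?Xj)) \<le> q"
    using eval_eout[OF b1] b1 by (simp add: cs) (simp add: base_def)
  have mono: "\<mu> (A - B) \<le> \<mu> A" if "A \<subseteq> {..<n}" for A B
    by (rule ml[unfolded measure_like_def, THEN conjunct1, rule_format, OF that Diff_subset])
  \<comment> \<open>Both outcomes have the same shape: one of the two rows loses its intersection
    with the other and still fits.\<close>
  have key: "\<exists>v R. v \<in> {i, j} \<and> row_updated S1 S' v R \<and> fits R \<and> R = row S v - row S (if v = i then j else i)"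
  proof (cases "int (out (?Xi - ?Xj)) \<le> q")
    case True
    then have eq: "S' = sem (CFor ''u'' ''n'' (CAssign ''X'' (eidx ''i'' ''u'') (ER ''c'' (EV ''u'')))) \<rho> S1"
      by (simp only: S'_def separate_def sem.simps(2,3) S1_def[symmetric] cond if_True)
    have "row_updated S1 S' i (?Xi - ?Xj)"
      unfolding eq
    proof (rule row_update)
      show "0 < eval (ER ''c'' (EV ''u'')) (\<rho>(''u'' := int u)) T \<longleftrightarrow> u \<in> ?Xi - ?Xj"
        if "u < n" "\<And>y. y \<noteq> ''X'' \<Longrightarrow> T y = S1 y" for u T
        using that c by simp
    qed (use b1 i row_subset[of S i] in auto)
    moreover have "fits (?Xi - ?Xj)"
      using mono[OF row_subset[of S i], of ?Xj] ft i True by (fastforce simp: fits_def)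
    ultimately show ?thesis by (intro exI[of _ i] exI[of _ "?Xi - ?Xj"]) simp
  next
    case False
    then have eq: "S' = sem (CFor ''u'' ''n'' (CAssign ''X'' (eidx ''j'' ''u'')
         (EIf (ER ''X'' (eidx ''i'' ''u'')) (EN 0) (ER ''X'' (eidx ''j'' ''u''))))) \<rho> S1"
      by (simp only: S'_def separate_def sem.simps(2,3) S1_def[symmetric] cond if_False)
    have "row_updated S1 S' j (?Xj - ?Xi)"
      unfolding eq
    proof (rule row_update)
      show "0 < eval (EIf (ER ''X'' (eidx ''i'' ''u'')) (EN 0) (ER ''X'' (eidx ''j'' ''u''))) (\<rho>(''u'' := int u)) T \<longleftrightarrow> u \<in> ?Xj - ?Xi"
        if u: "u < n" and bT: "base T" and other: "\<And>w. w < n \<Longrightarrow> w \<noteq> j \<Longrightarrow> row T w = row S1 w"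
          and same: "u \<in> row T j \<longleftrightarrow> u \<in> row S1 j" for u T
      proof -
        have "0 < T ''X'' (int i * int n + int u) \<longleftrightarrow> u \<in> ?Xi"
          using other[OF i(2) ij] r1 u unfolding row_def by blast
        moreover have "0 < T ''X'' (int j * int n + int u) \<longleftrightarrow> u \<in> ?Xj"
          using same r1 u unfolding row_def by blast
        ultimately show ?thesis using i j u by (simp add: eval_eidx[OF bT])
      qed
    qed (use b1 j row_subset[of S j] in auto)
    moreover have "fits (?Xj - ?Xi)"
    proof -
      have "out (?Xi - ?Xj) + out (?Xj - ?Xi) \<le> out ?Xi + out ?Xj"
        by (rule out_posimodular[OF row_subset row_subset])
      moreover have "int (out ?Xi) \<le> q" "int (out ?Xj) \<le> q" "int (\<mu> ?Xj) \<le> p" using ft i j by (auto simp: fits_def)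
      ultimately show ?thesis using mono[OF row_subset[of S j], of ?Xi] False by (simp add: fits_def)
    qed
    ultimately show ?thesis using ij by (intro exI[of _ j] exI[of _ "?Xj - ?Xi"]) simp
  qed
  then obtain v where v: "v \<in> {i, j}" and up: "row_updated S1 S' v (row S v - row S (if v = i then j else i))"
    and fit: "fits (row S v - row S (if v = i then j else i))" by blast
  define w' where "w' = (if v = i then j else i)"
  have w': "w' < n" "w' \<noteq> v" "{v, w'} = {i, j}" using v i j ij by (auto simp: w'_def)
  have vn: "v < n" using v i j by auto
  have rv: "row S' v = row S v - row S w'" using up by (simp add: row_updated_def w'_def)
  have rw: "row S' w = row S w" if "w < n" "w \<noteq> v" for w
    using up that by (simp add: row_updated_def r1)
  have "(\<Union>w<n. row S' w) = (\<Union>w<n. row S w)"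
  proof
    show "(\<Union>w<n. row S' w) \<subseteq> (\<Union>w<n. row S w)" using rv rw by (metis (no_types, lifting) Diff_subset SUP_mono' SUP_subset_mono lessThan_iff subset_refl)
    show "(\<Union>w<n. row S w) \<subseteq> (\<Union>w<n. row S' w)"
    proof
      fix x assume "x \<in> (\<Union>w<n. row S w)"
      then obtain w where w: "w < n" "x \<in> row S w" by auto
      show "x \<in> (\<Union>w<n. row S' w)"
      proof (cases "x \<in> row S w'")
        case True
        then show ?thesis using w' rw[of w'] by auto
      next
        case False
        then show ?thesis using w rv rw[of w] vn by (cases "w = v") auto
      qed
    qed
  qed
  moreover have "base S'" by (rule row_updated_base[OF up b1])
  moreover have "S' x = S x" if "x \<notin> {''c'', ''X''}" for x
    using up that S1f[of x] by (auto simp: row_updated_def)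
  moreover have "\<forall>w<n. fits (row S' w)"
    using ft fit rv rw unfolding w'_def[symmetric] by metis
  moreover have "\<forall>w<n. row S' w \<subseteq> row S w" using rv rw by (metis Diff_subset subset_refl)
  ultimately show "shrinks S (sem separate \<rho> S)" unfolding S'_def[symmetric] shrinks_def by blast
  have "row S' v \<inter> row S' w' = {}" using rv rw[OF w'(1,2)] by auto
  then show "row (sem separate \<rho> S) i \<inter> row (sem separate \<rho> S) j = {}"
    unfolding S'_def[symmetric] using w'(3) by (metis Int_commute doubleton_eq_iff)
qed

lemma uncross_correct:
  assumes ml: "measure_like \<mu>" and base: "base S" and ft: "\<forall>w<n. fits (row S w)"
  shows "shrinks S (sem uncross \<rho> S)"
    and "a < b \<Longrightarrow> b < n \<Longrightarrow> row (sem uncross \<rho> S) a \<inter> row (sem uncross \<rho> S) b = {}"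
proof -
  define c where "c = CIf (ELt (EV ''i'') (EV ''j'')) separate CSkip"
  define I where "I D T \<longleftrightarrow> shrinks S T \<and> (\<forall>a b. D a b \<longrightarrow> a < b \<longrightarrow> b < n \<longrightarrow> row T a \<inter> row T b = {})" for D T
  have IS: "shrinks S T" if "I D T" for D T using that by (simp add: I_def)
  have ID: "row T a \<inter> row T b = {}" if "I D T" "D a b" "a < b" "b < n" for D T a b using that by (simp add: I_def)
  have bT: "base T" if "shrinks S T" for T using that by (simp add: shrinks_def)
  have step: "I (\<lambda>a b. a < i \<or> a = i \<and> b < Suc j) (sem c (\<rho>(''i'' := int i, ''j'' := int j)) T)"
    if T: "I (\<lambda>a b. a < i \<or> a = i \<and> b < j) T" and i: "i < n" and j: "j < n" for i j T
  proof (cases "i < j")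
    case True
    let ?r = "\<rho>(''i'' := int i, ''j'' := int j)"
    have eq: "sem c ?r T = sem separate ?r T" using True by (simp add: c_def)
    have "\<forall>w<n. fits (row T w)" using IS[OF T] ft by (simp add: shrinks_def)
    note sep = separate_correct[where \<rho> = ?r and i = i and j = j, OF ml bT[OF IS[OF T]] _ i _ j _ this, simplified]
    have s1: "shrinks T (sem separate ?r T)" and s2: "row (sem separate ?r T) i \<inter> row (sem separate ?r T) j = {}"
      using sep True by auto
    have sub: "row (sem separate ?r T) w \<subseteq> row T w" if "w < n" for w using s1 that by (simp add: shrinks_def)
    have "row (sem separate ?r T) a \<inter> row (sem separate ?r T) b = {}"
      if "a < i \<or> a = i \<and> b < Suc j" "a < b" "b < n" for a b
    proof (cases "a = i \<and> b = j")
      case False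
      then have "row T a \<inter> row T b = {}" using ID[OF T, of a b] that by auto
      then show ?thesis using sub[of a] sub[of b] that by fastforce
    qed (use s2 in simp)
    then show ?thesis using shrinks_trans[OF IS[OF T] s1] unfolding eq I_def by blast
  next
    case False
    then have eq: "sem c (\<rho>(''i'' := int i, ''j'' := int j)) T = T" by (simp add: c_def)
    show ?thesis unfolding eq I_def using IS[OF T] ID[OF T] False by (auto simp: less_Suc_eq)
  qed
  have n: "nat (T ''n'' 0) = n" if "shrinks S T" for T using bT[OF that] by (simp add: base_n)
  have "I (\<lambda>a b. a < n) (loop (\<lambda>i. sem (CFor ''j'' ''n'' c) (\<rho>(''i'' := int i))) n S)"
  proof (rule loop_invariant[where P = "\<lambda>i. I (\<lambda>a b. a < i)"])
    show "I (\<lambda>a b. a < 0) S" using shrinks_refl[OF base] by (simp add: I_def)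
    fix i T assume i: "i < n" and T: "I (\<lambda>a b. a < i) T"
    have "I (\<lambda>a b. a < i \<or> a = i \<and> b < n) (loop (\<lambda>j. sem c (\<rho>(''i'' := int i, ''j'' := int j))) n T)"
    proof (rule loop_invariant[where P = "\<lambda>j. I (\<lambda>a b. a < i \<or> a = i \<and> b < j)"])
      show "I (\<lambda>a b. a < i \<or> a = i \<and> b < 0) T" using T by simp
    qed (rule step[OF _ i])
    then show "I (\<lambda>a b. a < Suc i) (sem (CFor ''j'' ''n'' c) (\<rho>(''i'' := int i)) T)"
      unfolding sem.simps(4) n[OF IS[OF T]] I_def by (simp add: less_Suc_eq)
  qed
  moreover have "sem uncross \<rho> S = loop (\<lambda>i. sem (CFor ''j'' ''n'' c) (\<rho>(''i'' := int i))) n S"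
    unfolding uncross_def c_def[symmetric] sem.simps(4)[of "''i''"] n[OF shrinks_refl[OF base]] ..
  ultimately have fin: "I (\<lambda>a b. a < n) (sem uncross \<rho> S)" by simp
  show "shrinks S (sem uncross \<rho> S)" by (rule IS[OF fin])
  show "row (sem uncross \<rho> S) a \<inter> row (sem uncross \<rho> S) b = {}" if "a < b" "b < n"
    using ID[OF fin, of a b] that by simp
qed

text \<open>Trimmed rows may be empty, so the sets \<open>R i\<close> are only claimed to cover the
  vertices with the right labels; the output partition is formed from the labels.\<close>

lemma finish_correct:
  assumes ml: "measure_like \<mu>" and good: "good S"
  shows "\<not> (\<forall>v<n. solved S v) \<Longrightarrow> sem finish \<rho> S ''found'' 0 = 0"
    and "\<forall>v<n. solved S v \<Longrightarrow> sem finish \<rho> S ''found'' 0 = 1 \<and>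
      (\<exists>R. (\<forall>i<n. fits (R i)) \<and> (\<Union>i<n. R i) = {..<n} \<and> (\<forall>i<n. \<forall>u\<in>R i. sem finish \<rho> S ''cluster'' (int u) = int i))"
proof -
  have base: "base S" using good by (rule good_base)
  define S1 where "S1 = sem (CAssign ''found'' (EN 0)
       (EIf (ELt (ESum ''v'' ''n'' (ecount_if (ER ''ok'' (EV ''v'')))) (sc ''n'')) (EN 0) (EN 1))) \<rho> S"
  define S2 where "S2 = sem uncross \<rho> S1"
  define e where "e = ESum ''i'' ''n'' (EIf (ER ''X'' (eidx ''i'' ''u'')) (EV ''i'') (EN 0))"
  have S': "sem finish \<rho> S = sem (CFor ''u'' ''n'' (CAssign ''cluster'' (EV ''u'') e)) \<rho> S2"
    by (simp only: finish_def sem.simps(2) S1_def S2_def e_def)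
  have fr: "sem finish \<rho> S ''found'' = S1 ''found''"
    unfolding S' S2_def by (simp add: sem_frame uncross_def separate_def del: sem.simps)
  have "eval (ESum ''v'' ''n'' (ecount_if (ER ''ok'' (EV ''v'')))) \<rho> S = (\<Sum>v<n. if solved S v then 1 else 0)"
    using base by (simp add: base_n solved_def)
  also have "\<dots> = int (card {v \<in> {..<n}. solved S v})" by (simp add: sum.If_cases Int_def)
  finally have sum: "eval (ESum ''v'' ''n'' (ecount_if (ER ''ok'' (EV ''v'')))) \<rho> S = int (card {v \<in> {..<n}. solved S v})" .
  have "card {v \<in> {..<n}. solved S v} < n \<longleftrightarrow> \<not> (\<forall>v<n. solved S v)"
  proof
    assume "\<not> (\<forall>v<n. solved S v)"
    then have "{v \<in> {..<n}. solved S v} \<subset> {..<n}" by auto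
    then show "card {v \<in> {..<n}. solved S v} < n" using psubset_card_mono[of "{..<n}"] by simp
  next
    assume *: "card {v \<in> {..<n}. solved S v} < n"
    show "\<not> (\<forall>v<n. solved S v)"
    proof
      assume "\<forall>v<n. solved S v"
      then have "{v \<in> {..<n}. solved S v} = {..<n}" by auto
      then show False using * by simp
    qed
  qed
  then have found: "S1 ''found'' 0 = (if \<forall>v<n. solved S v then 1 else 0)"
    unfolding S1_def sem.simps eval.simps(7) truth sum using base by (auto simp: base_n)
  then show "\<not> (\<forall>v<n. solved S v) \<Longrightarrow> sem finish \<rho> S ''found'' 0 = 0" using fr by simp
  assume all: "\<forall>v<n. solved S v"
  have S1f: "S1 x = S x" if "x \<noteq> ''found''" for x using that by (simp add: S1_def)
  have b1: "base S1" using base by (rule base_frame) (auto simp: S1f input_names_def)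
  have r1: "row S1 w = row S w" for w by (simp add: row_def S1f)
  have val: "valid w (row S w)" if "w < n" for w using good all that by (simp add: good_def)
  have ft: "\<forall>w<n. fits (row S1 w)" using val r1 by (simp add: valid_def fits_def)
  have sh: "shrinks S1 S2" unfolding S2_def by (rule uncross_correct(1)[OF ml b1 ft])
  have b2: "base S2" using sh by (simp add: shrinks_def)
  have disj: "row S2 a \<inter> row S2 b = {}" if "a < n" "b < n" "a \<noteq> b" for a b
  proof (cases "a < b")
    case True
    then show ?thesis using uncross_correct(2)[OF ml b1 ft] that by (simp add: S2_def)
  next
    case False
    then have "row S2 b \<inter> row S2 a = {}" using uncross_correct(2)[OF ml b1 ft, of b a] that by (simp add: S2_def)
    then show ?thesis by blast
  qed
  have "w \<in> row S w" if "w < n" for w using val[OF that] by (simp add: valid_def)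
  then have "(\<Union>w<n. row S w) = {..<n}" using row_subset by blast
  then have un: "(\<Union>w<n. row S2 w) = {..<n}" using sh r1 by (simp add: shrinks_def)
  have cl: "sem finish \<rho> S ''cluster'' (int u) = int i" if i: "i < n" "u \<in> row S2 i" for i u
  proof -
    have u: "u < n" using i(2) row_subset by blast
    have ev: "eval e (\<rho>(''u'' := int w)) T = (\<Sum>j<n. if w \<in> row S2 j then int j else 0)"
      if w: "w < n" and T: "\<And>x. x \<noteq> ''cluster'' \<Longrightarrow> T x = S2 x" for w T
    proof -
      have bT: "base T" using b2 by (rule base_frame) (auto simp: T input_names_def)
      show ?thesis unfolding e_def
        by (simp only: eval.simps(8) base_n[OF bT] nat_int, intro sum.cong refl)
          (use w in \<open>simp add: eval_eidx[OF bT] T row_def\<close>)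
    qed
    have "sem finish \<rho> S ''cluster'' (int u) = (\<Sum>j<n. if u \<in> row S2 j then int j else 0)"
      unfolding S'
      by (rule for_fill(2)[where g = int and m = n and k = "''n''" and S = S2 and
            w = "\<lambda>u. \<Sum>j<n. if u \<in> row S2 j then int j else 0", OF _ _ _ u])
        (use b2 ev in \<open>simp_all add: base_n\<close>)
    also have "\<dots> = (\<Sum>j<n. if j = i then int j else 0)"
      using disj i by (intro sum.cong refl) (metis IntI empty_iff lessThan_iff)
    also have "\<dots> = int i" using i by simp
    finally show ?thesis .
  qed
  show "sem finish \<rho> S ''found'' 0 = 1 \<and>
      (\<exists>R. (\<forall>i<n. fits (R i)) \<and> (\<Union>i<n. R i) = {..<n} \<and> (\<forall>i<n. \<forall>u\<in>R i. sem finish \<rho> S ''cluster'' (int u) = int i))"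
  proof (intro conjI exI[of _ "row S2"])
    show "sem finish \<rho> S ''found'' 0 = 1" using fr found all by simp
    show "\<forall>i<n. fits (row S2 i)" using sh ft by (simp add: shrinks_def)
    show "\<forall>i<n. \<forall>u\<in>row S2 i. sem finish \<rho> S ''cluster'' (int u) = int i" using cl by blast
  qed (rule un)
qed

end

section \<open>The three measures\<close>

definition esize :: ex where
  "esize = ele (ESum ''x'' ''n'' (ecount_if (ER ''c'' (EV ''x'')))) (sc ''p'')"

definition enonedge :: ex where
  "enonedge = ele (ESum ''x'' ''n'' (ESum ''y'' ''n'' (ecount_if (eand (ELt (EV ''x'') (EV ''y''))
     (eand (ER ''c'' (EV ''x'')) (eand (ER ''c'' (EV ''y'')) (enot (eadj ''x'' ''y'')))))))) (sc ''p'')"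

text \<open>Instead of computing a maximum, the vertices violating the bound are counted. The test
  \<open>0 \<le> p\<close> matches the value 0 inserted into the maximum.\<close>

definition enondeg :: ex where
  "enondeg = eand (ele (EN 0) (sc ''p'')) (ele (ESum ''x'' ''n'' (ecount_if (eand (ER ''c'' (EV ''x''))
     (ELt (sc ''p'') (ESum ''y'' ''n'' (ecount_if (eand (ER ''c'' (EV ''y''))
       (eand (enot (eeq (EV ''y'') (EV ''x''))) (enot (eadj ''x'' ''y'')))))))))) (EN 0))"

context ugraph
begin

definition nonedges :: "nat set \<Rightarrow> nat" where
  "nonedges Z = card {(x, y). x \<in> Z \<and> y \<in> Z \<and> x < y \<and> \<not> E x y}"

definition max_miss :: "nat set \<Rightarrow> nat" where
  "max_miss Z = Max (insert 0 (miss Z ` Z))"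

lemma miss_mono: "Y \<subseteq> {..<n} \<Longrightarrow> Z \<subseteq> Y \<Longrightarrow> miss Z x \<le> miss Y x"
  unfolding miss_def by (rule card_mono) (auto intro: finite_subset)

lemma measure_like_card: "measure_like card"
  unfolding measure_like_def
proof (intro conjI allI impI)
  fix Z Y :: "nat set" assume "Y \<subseteq> {..<n}" "Z \<subseteq> Y"
  then show "card Z \<le> card Y" by (meson card_mono finite_lessThan finite_subset)
next
  fix Z :: "nat set" and x assume "Z \<subseteq> {..<n}"
  then have "finite Z" using finite_subset by blast
  then show "miss Z x \<le> card Z" unfolding miss_def by (intro card_mono) auto
qed simp

lemma finite_pairs: "Z \<subseteq> {..<n} \<Longrightarrow> finite {(x, y). x \<in> Z \<and> y \<in> Z \<and> P x y}"
  by (rule finite_subset[of _ "{..<n} \<times> {..<n}"]) auto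

lemma nonadj_eq_nonedges:
  assumes "Z \<subseteq> {..<n}"
  shows "nonadj Z = 2 * nonedges Z"
proof -
  have fin: "finite Z" using assms finite_subset by blast
  let ?L = "{(x, y). x \<in> Z \<and> y \<in> Z \<and> x < y \<and> \<not> E x y}" and ?G = "{(x, y). x \<in> Z \<and> y \<in> Z \<and> y < x \<and> \<not> E x y}"
  have "nonadj Z = card (SIGMA x:Z. {y \<in> Z - {x}. \<not> E x y})"
    unfolding nonadj_def miss_def using fin by (intro card_SigmaI[symmetric]) auto
  also have "(SIGMA x:Z. {y \<in> Z - {x}. \<not> E x y}) = ?L \<union> ?G" by auto
  also have "card (?L \<union> ?G) = card ?L + card ?G"
    using assms by (intro card_Un_disjoint finite_pairs) auto
  also have "?G = prod.swap ` ?L" using sym by (auto simp: image_iff)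
  also have "card (prod.swap ` ?L) = card ?L" by (intro card_image) simp
  finally show ?thesis by (simp add: nonedges_def)
qed

lemma measure_like_nonedges: "measure_like nonedges"
  unfolding measure_like_def
proof (intro conjI allI impI)
  fix Z Y assume "Y \<subseteq> {..<n}" "Z \<subseteq> Y"
  then show "nonedges Z \<le> nonedges Y"
    unfolding nonedges_def by (intro card_mono finite_pairs) auto
next
  fix Z x assume Z: "Z \<subseteq> {..<n}" "x \<in> Z"
  \<comment> \<open>Each vertex missed by \<open>x\<close> yields its own nonadjacent pair with
    \<open>x\<close>, written in increasing order.\<close>
  let ?f = "\<lambda>y. (min x y, max x y)"
  have "inj_on ?f {y \<in> Z - {x}. \<not> E x y}" by (auto simp: inj_on_def min_def max_def split: if_splits)
  moreover have "?f ` {y \<in> Z - {x}. \<not> E x y} \<subseteq> {(x, y). x \<in> Z \<and> y \<in> Z \<and> x < y \<and> \<not> E x y}"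
    using Z sym by (auto simp: min_def max_def split: if_splits)
  ultimately show "miss Z x \<le> nonedges Z"
    unfolding miss_def nonedges_def using finite_pairs[OF Z(1)] by (rule card_inj_on_le)
next
  fix Z Y assume "Z \<subseteq> {..<n}" "Y \<subseteq> {..<n}" "nonadj Z = nonadj Y"
  then show "nonedges Y \<le> nonedges Z" by (simp add: nonadj_eq_nonedges)
qed

lemma max_miss_le: "Z \<subseteq> {..<n} \<Longrightarrow> max_miss Z \<le> d \<longleftrightarrow> (\<forall>x\<in>Z. miss Z x \<le> d)"
proof -
  assume "Z \<subseteq> {..<n}"
  then have "finite Z" using finite_subset by blast
  then show ?thesis by (simp add: max_miss_def)
qed

lemma measure_like_max_miss: "measure_like max_miss"
  unfolding measure_like_def
proof (intro conjI allI impI)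
  fix Z Y assume XY: "Y \<subseteq> {..<n}" "Z \<subseteq> Y"
  then have "miss Z x \<le> max_miss Y" if "x \<in> Z" for x
    using max_miss_le[OF XY(1), of "max_miss Y"] miss_mono[OF XY, of x] that by fastforce
  then show "max_miss Z \<le> max_miss Y" using max_miss_le[of Z] XY by auto
next
  fix Z x assume "Z \<subseteq> {..<n}" "x \<in> Z"
  then show "miss Z x \<le> max_miss Z" using max_miss_le by blast
next
  fix Z Y assume "Z \<subseteq> {..<n}" "Y \<subseteq> {..<n}" "\<forall>d. (\<forall>x\<in>Z. miss Z x \<le> d) \<longrightarrow> (\<forall>x\<in>Y. miss Y x \<le> d)"
  then show "max_miss Y \<le> max_miss Z" using max_miss_le by blast
qed

end

lemma (in run) mu_spec_size: "mu = esize \<Longrightarrow> \<mu> = card \<Longrightarrow> mu_spec"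
  unfolding mu_spec_def
proof (intro allI impI)
  fix \<rho> S assume mu: "mu = esize" "\<mu> = card" and base: "base S"
  have "eval (ESum ''x'' ''n'' (ecount_if (ER ''c'' (EV ''x'')))) \<rho> S = (\<Sum>x<n. if x \<in> cset S ''c'' then 1 else 0)"
    by (simp only: eval.simps(8) base_n[OF base] nat_int, intro sum.cong refl) (simp add: cset_def)
  also have "\<dots> = int (card (cset S ''c''))"
    using cset_subset[of S "''c''"] by (simp add: sum.If_cases Int_absorb1)
  finally show "0 < eval mu \<rho> S \<longleftrightarrow> int (\<mu> (cset S ''c'')) \<le> p"
    unfolding mu esize_def truth using base by (simp add: base_def)
qed

lemma (in run) mu_spec_nonedge: "mu = enonedge \<Longrightarrow> \<mu> = nonedges \<Longrightarrow> mu_spec"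
  unfolding mu_spec_def
proof (intro allI impI)
  fix \<rho> S assume mu: "mu = enonedge" "\<mu> = nonedges" and base: "base S"
  let ?C = "cset S ''c''" and ?e = "ecount_if (eand (ELt (EV ''x'') (EV ''y''))
     (eand (ER ''c'' (EV ''x'')) (eand (ER ''c'' (EV ''y'')) (enot (eadj ''x'' ''y'')))))"
  have "eval (ESum ''x'' ''n'' (ESum ''y'' ''n'' ?e)) \<rho> S =
    (\<Sum>x<n. \<Sum>y<n. if x \<in> ?C \<and> y \<in> ?C \<and> x < y \<and> \<not> E x y then 1 else 0)"
    by (simp only: eval.simps(8) base_n[OF base] nat_int, intro sum.cong refl) (auto simp: cset_def eval_eadj[OF base])
  also have "\<dots> = (\<Sum>z\<in>{..<n} \<times> {..<n}. if z \<in> {(x, y). x \<in> ?C \<and> y \<in> ?C \<and> x < y \<and> \<not> E x y} then 1 else 0)"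
    by (simp add: sum.cartesian_product) (intro sum.cong refl, auto split: if_splits)
  also have "\<dots> = int (card {(x, y). x \<in> ?C \<and> y \<in> ?C \<and> x < y \<and> \<not> E x y})"
  proof -
    have "{(x, y). x \<in> ?C \<and> y \<in> ?C \<and> x < y \<and> \<not> E x y} \<subseteq> {..<n} \<times> {..<n}" using cset_subset by auto
    then show ?thesis by (simp add: sum.If_cases Int_absorb1)
  qed
  finally show "0 < eval mu \<rho> S \<longleftrightarrow> int (\<mu> (cset S ''c'')) \<le> p"
    unfolding mu enonedge_def truth nonedges_def using base by (simp add: base_def)
qed

lemma (in run) mu_spec_nondeg: "mu = enondeg \<Longrightarrow> \<mu> = max_miss \<Longrightarrow> mu_spec"
  unfolding mu_spec_def
proof (intro allI impI)
  fix \<rho> S assume mu: "mu = enondeg" "\<mu> = max_miss" and base: "base S"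
  let ?C = "cset S ''c''"
  let ?i = "ESum ''y'' ''n'' (ecount_if (eand (ER ''c'' (EV ''y''))
       (eand (enot (eeq (EV ''y'') (EV ''x''))) (enot (eadj ''x'' ''y'')))))"
  have inner: "eval ?i (\<rho>(''x'' := int x)) S = int (miss ?C x)" if x: "x < n" for x
  proof -
    have "eval ?i (\<rho>(''x'' := int x)) S = (\<Sum>y<n. if y \<in> {y \<in> ?C - {x}. \<not> E x y} then 1 else 0)"
      by (simp only: eval.simps(8) base_n[OF base] nat_int, intro sum.cong refl) (use x in \<open>auto simp: cset_def eval_eadj[OF base]\<close>)
    also have "\<dots> = int (card {y \<in> ?C - {x}. \<not> E x y})"
    proof -
      have "{y \<in> ?C - {x}. \<not> E x y} \<subseteq> {..<n}" using cset_subset by auto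
      then show ?thesis by (simp only: sum.If_cases finite_lessThan Collect_mem_eq Int_absorb1) simp
    qed
    finally show ?thesis by (simp add: miss_def)
  qed
  have pS: "S ''p'' 0 = p" using base by (simp add: base_def)
  have "eval (ESum ''x'' ''n'' (ecount_if (eand (ER ''c'' (EV ''x'')) (ELt (sc ''p'') ?i)))) \<rho> S =
     (\<Sum>x<n. if x \<in> {x \<in> ?C. p < int (miss ?C x)} then 1 else 0)"
    by (simp only: eval.simps(8)[of "''x''"] base_n[OF base] nat_int, intro sum.cong refl)
      (simp add: inner pS cset_def del: eval.simps(8))
  also have "\<dots> = int (card {x \<in> ?C. p < int (miss ?C x)})"
  proof -
    have "{x \<in> ?C. p < int (miss ?C x)} \<subseteq> {..<n}" using cset_subset by auto
    then show ?thesis by (simp only: sum.If_cases finite_lessThan Collect_mem_eq Int_absorb1) simp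
  qed
  finally have sum: "eval (ESum ''x'' ''n'' (ecount_if (eand (ER ''c'' (EV ''x'')) (ELt (sc ''p'') ?i)))) \<rho> S =
    int (card {x \<in> ?C. p < int (miss ?C x)})" .
  have fin: "finite ?C" using cset_subset finite_subset by blast
  have "0 < eval mu \<rho> S \<longleftrightarrow> 0 \<le> p \<and> {x \<in> ?C. p < int (miss ?C x)} = {}"
    unfolding mu(1) enondeg_def truth sum using fin pS by simp
  also have "\<dots> \<longleftrightarrow> int (max_miss ?C) \<le> p"
  proof (cases "0 \<le> p")
    case True
    then have "int (max_miss ?C) \<le> p \<longleftrightarrow> max_miss ?C \<le> nat p" by (simp add: le_nat_iff)
    then show ?thesis using True by (auto simp: max_miss_le[OF cset_subset] le_nat_iff not_less)
  qed auto
  finally show "0 < eval mu \<rho> S \<longleftrightarrow> int (\<mu> (cset S ''c'')) \<le> p" unfolding mu(2) .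
qed

section \<open>Correctness and running time of the complete program\<close>

lemma (in run) algorithm_correct:
  fixes S :: state and \<rho> :: "vname \<Rightarrow> int"
  assumes spec: mu_spec and ml: "measure_like \<mu>"
    and input: "S ''n'' 0 = int n" "S ''p'' 0 = p" "S ''q'' 0 = q"
      "\<And>u v. u < n \<Longrightarrow> v < n \<Longrightarrow> S ''adj'' (int u * int n + int v) = of_bool (E u v)"
      "S ''ok'' = (\<lambda>_. 0)" "S ''b'' = (\<lambda>_. 0)"
  defines "S' \<equiv> sem finish \<rho> (sem (search mu) \<rho> (sem prepare_seeds \<rho> (sem prepare \<rho> S)))"
  shows "\<not> (\<forall>v<n. \<exists>C\<subseteq>{..<n}. valid v C) \<Longrightarrow> S' ''found'' 0 = 0"
    and "\<forall>v<n. \<exists>C\<subseteq>{..<n}. valid v C \<Longrightarrow> S' ''found'' 0 = 1 \<and>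
      (\<exists>R. (\<forall>i<n. fits (R i)) \<and> (\<Union>i<n. R i) = {..<n} \<and> (\<forall>i<n. \<forall>u\<in>R i. S' ''cluster'' (int u) = int i))"
proof -
  define P where "P = sem prepare_seeds \<rho> (sem prepare \<rho> S)"
  obtain l where l: "n < 2 ^ l"
    and cst: "P ''M'' 0 = int M" "P ''M2'' 0 = int (M ^ 2)" "P ''M3'' 0 = int (M ^ 3)" "P ''K'' 0 = int K"
    and t: "P ''t'' 0 = int (8 * nat p + 2 + l)" "P ''tt'' 0 = int (2 * (8 * nat p + 2 + l))"
      "P ''N'' 0 = int (2 ^ (2 * (8 * nat p + 2 + l)))"
    and fr: "\<And>x. x \<notin> {''M'', ''M2'', ''M3'', ''K'', ''t'', ''w'', ''tt'', ''N''} \<Longrightarrow> P x = S x"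
    using prepare_correct[where S = S and n = n and p = p and \<rho> = \<rho> and S' = P, OF input(1,2)] unfolding P_def by metis
  let ?t = "8 * nat p + 2 + l"
  have "base P" unfolding base_def using input fr cst by simp
  then have gP: "good P" using fr input(5) by (simp add: good_def solved_def)
  have b: "P ''b'' = (\<lambda>_. 0)" using fr input(6) by simp
  define Q where "Q = sem (search mu) \<rho> P"
  note search = search_correct[where S = P and t = ?t and \<rho> = \<rho>, OF spec ml gP t _ b, folded Q_def]
  have gQ: "good Q" using search(1) by (simp add: advances_def)
  have solved: "solved Q v \<longleftrightarrow> (\<exists>C\<subseteq>{..<n}. valid v C)" if v: "v < n" for v
  proof
    assume "solved Q v"
    then show "\<exists>C\<subseteq>{..<n}. valid v C" 
      using gQ v row_subset[of Q v] unfolding good_def by blast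
  next
    assume "\<exists>C\<subseteq>{..<n}. valid v C"
    then obtain C where C: "C \<subseteq> {..<n}" "valid v C" by blast
    obtain A R where A: "A \<subseteq> {..<n}" "card A \<le> 8 * nat p + 2"
      "\<And>col. (\<And>x. x \<in> A \<Longrightarrow> col x \<longleftrightarrow> x \<in> R) \<Longrightarrow> suits v col"
    proof (rule suitable_pattern[OF ml v C])
      fix A P assume "A \<subseteq> {..<n}" "card A \<le> 8 * nat p + 2"
        "\<And>col. (\<And>x. x \<in> A \<Longrightarrow> col x \<longleftrightarrow> x \<in> P) \<Longrightarrow> suits v col"
      then show thesis by (rule that)
    qed
    \<comment> \<open>Together with \<open>n < 2 ^ l\<close> the bound on \<open>card A\<close>
      becomes the condition under which the recurrences of order \<open>8 * p + 2 + l\<close> are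
      universal.\<close>
    have "2 ^ card A * n < 2 ^ (8 * nat p + 2) * (2::nat) ^ l"
      using A(2) l by (intro mult_le_less_imp_less power_increasing) auto
    then have "2 ^ card A * n < 2 ^ ?t" by (simp add: power_add)
    then show "solved Q v" using search(2)[OF _ v A(1) _ A(3)] by simp
  qed
  have S': "S' = sem finish \<rho> Q" by (simp add: S'_def Q_def P_def)
  show "\<not> (\<forall>v<n. \<exists>C\<subseteq>{..<n}. valid v C) \<Longrightarrow> S' ''found'' 0 = 0"
    using finish_correct(1)[OF ml gQ] solved unfolding S' by blast
  assume "\<forall>v<n. \<exists>C\<subseteq>{..<n}. valid v C"
  then have "\<forall>v<n. solved Q v" using solved by simp
  then show "S' ''found'' 0 = 1 \<and>
      (\<exists>R. (\<forall>i<n. fits (R i)) \<and> (\<Union>i<n. R i) = {..<n} \<and> (\<forall>i<n. \<forall>u\<in>R i. S' ''cluster'' (int u) = int i))"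
    unfolding S' by (rule finish_correct(2)[OF ml gQ])
qed

text \<open>The phases are compiled separately because each loop bound is an input or is computed in
  an earlier phase.\<close>

definition program :: "ex \<Rightarrow> com" where
  "program mu = Seq (comp_cmd prepare 0) (Seq (comp_cmd prepare_seeds 0)
     (Seq (comp_cmd (search mu) 0) (comp_cmd finish 0)))"

text \<open>The bounds of the loops, as functions of \<open>n\<close> and \<open>p\<close>; they use \<open>2 ^ l \<le> 2 * n + 1\<close> for the number \<open>l\<close>
  of doublings in \<open>prepare\<close>.\<close>

definition seed_bits :: "nat \<Rightarrow> int \<Rightarrow> nat" where
  "seed_bits n p = 8 * nat p + 2 + n"

definition loop_bound :: "nat \<Rightarrow> int \<Rightarrow> vname \<Rightarrow> nat" where
  "loop_bound n p k =
     (if k = ''n'' then n else if k = ''K'' then (n * n + 1) ^ 4 else if k = ''t'' then seed_bits n p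
      else if k = ''tt'' then 2 * seed_bits n p else ((2 ^ nat p) ^ 8 * 4 * (2 * n + 1)) ^ 2)"

lemma poly_exp_if: "poly_exp T \<Longrightarrow> poly_exp U \<Longrightarrow> poly_exp (\<lambda>n p. if P then T n p else U n p)"
  by (cases P) simp_all

lemma poly_exp_loop_bound: "poly_exp (\<lambda>n p. loop_bound n p k)"
  unfolding loop_bound_def seed_bits_def
  by (intro poly_exp_if poly_exp_add poly_exp_mult poly_exp_power poly_exp_const poly_exp_size
      poly_exp_parameter poly_exp_two_power)

definition running_time :: "ex \<Rightarrow> nat \<Rightarrow> int \<Rightarrow> nat" where
  "running_time mu n p = time_cmd prepare (loop_bound n p) + (time_cmd prepare_seeds (loop_bound n p) +
     (time_cmd (search mu) (loop_bound n p) + time_cmd finish (loop_bound n p)))"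

lemma poly_exp_running_time: "poly_exp (running_time mu)"
  unfolding running_time_def by (intro poly_exp_add poly_exp_time_cmd poly_exp_loop_bound)

lemma plain_iff: "plain [] \<longleftrightarrow> True" "plain (c # s) \<longleftrightarrow> c \<noteq> CHR ''%'' \<and> c \<noteq> CHR ''$''"
  by (simp_all add: plain_def)

lemmas program_defs = search_def lfsr_def vertex_def label_def relabel_def eact_def subset_sums_def add_class_def copy_solution_def
  elight_def ekey_def ecls_v_def ecls_def try_sums_def try_sum_def try_big_def try_hub_def ebig_def check_def eout_def eidx_def increment_def

lemma plain_prepare: "plain_cmd prepare" "plain_cmd prepare_seeds" "plain_cmd finish"
  by (simp_all add: prepare_def doublings_def prepare_seeds_def finish_def uncross_def separate_def eout_def eidx_def
      mulM_def macro_defs plain_iff)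

lemma plain_search: "plain_ex mu \<Longrightarrow> plain_cmd (search mu)"
  by (simp add: program_defs macro_defs plain_iff)

lemma bounds_prepare: "bounds prepare = {''n''}" "bounds prepare_seeds = {''tt''}" "bounds finish = {''n''}"
  by (auto simp: prepare_def doublings_def prepare_seeds_def finish_def uncross_def separate_def eout_def eidx_def
      mulM_def macro_defs)

lemma bounds_search: "bounds_ex mu \<subseteq> {''n''} \<Longrightarrow> bounds (search mu) \<subseteq> {''n'', ''K'', ''t'', ''tt'', ''N''}"
  by (auto simp: program_defs macro_defs)

lemma writes_prepare: "''n'' \<notin> writes prepare" "''tt'' \<notin> writes prepare_seeds" "''n'' \<notin> writes finish"
  by (auto simp: prepare_def doublings_def prepare_seeds_def finish_def uncross_def separate_def)

lemma writes_search: "writes (search mu) \<inter> {''n'', ''K'', ''t'', ''tt'', ''N''} = {}"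
  by (auto simp: search_def lfsr_def vertex_def label_def relabel_def subset_sums_def add_class_def copy_solution_def
      try_sums_def try_sum_def try_big_def try_hub_def check_def increment_def)

lemma program_runs:
  fixes S \<rho>
  assumes mu: "plain_ex mu" "bounds_ex mu \<subseteq> {''n''}" and sim: "simulates \<rho> S S"
    and input: "S ''n'' 0 = int n" "S ''p'' 0 = p"
  defines "U \<equiv> sem finish \<rho> (sem (search mu) \<rho> (sem prepare_seeds \<rho> (sem prepare \<rho> S)))"
  shows "runs (program mu) S (running_time mu n p) (simulates \<rho> U)"
proof -
  define S1 where "S1 = sem prepare \<rho> S"
  define S2 where "S2 = sem prepare_seeds \<rho> S1"
  define S3 where "S3 = sem (search mu) \<rho> S2"
  let ?B = "loop_bound n p"
  obtain l where l: "l \<le> n" "2 ^ l \<le> 2 * n + 1" and S1: "S1 ''n'' 0 = int n" "S1 ''tt'' 0 = int (2 * (8 * nat p + 2 + l))"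
    and S2: "S2 ''K'' 0 = int ((n * n + 1) ^ 4)" "S2 ''t'' 0 = int (8 * nat p + 2 + l)"
      "S2 ''tt'' 0 = int (2 * (8 * nat p + 2 + l))" "S2 ''N'' 0 = int (2 ^ (2 * (8 * nat p + 2 + l)))"
    and fr: "\<And>x. x \<notin> {''M'', ''M2'', ''M3'', ''K'', ''t'', ''w'', ''tt'', ''N''} \<Longrightarrow> S2 x = S x"
    using prepare_correct[where S = S and n = n and p = p and \<rho> = \<rho> and S' = S2, OF input] unfolding S2_def S1_def by metis
  have nb: "?B ''n'' = n" "?B ''K'' = (n * n + 1) ^ 4" "?B ''t'' = seed_bits n p" "?B ''tt'' = 2 * seed_bits n p"
    "?B ''N'' = ((2 ^ nat p) ^ 8 * 4 * (2 * n + 1)) ^ 2"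
    by (simp_all add: loop_bound_def)
  have tl: "8 * nat p + 2 + l \<le> seed_bits n p" using l by (simp add: seed_bits_def)
  \<comment> \<open>For the number of seeds the estimate \<open>l \<le> n\<close> would be too weak,
    as it would enter the exponent; \<open>2 ^ l \<le> 2 * n + 1\<close> turns this factor into a
    polynomial in \<open>n\<close>.\<close>
  have "(2::nat) ^ (2 * (8 * nat p + 2 + l)) = ((2 ^ nat p) ^ 8 * 4 * 2 ^ l) ^ 2"
    by (simp add: power_add power_mult_distrib flip: power_mult)
  also have "\<dots> \<le> ?B ''N''" unfolding nb using l by (intro power_mono mult_left_mono) auto
  finally have N: "(2::nat) ^ (2 * (8 * nat p + 2 + l)) \<le> ?B ''N''" .
  have n2: "S2 ''n'' 0 = int n" using fr[of "''n''"] input by simp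
  have b3: "S2 k 0 \<le> int (?B k)" if "k \<in> bounds (search mu)" for k
  proof -
    have "k \<in> {''n'', ''K'', ''t'', ''tt'', ''N''}" by (rule subsetD[OF bounds_search[OF mu(2)] that])
    then consider "k = ''n''" | "k = ''K''" | "k = ''t''" | "k = ''tt''" | "k = ''N''"
      unfolding insert_iff by blast
    then show ?thesis
    proof cases
      case 5
      then show ?thesis unfolding 5 S2(4) using N by (simp only: of_nat_le_iff)
    qed (use S2(1-3) n2 nb tl in \<open>simp_all only: of_nat_le_iff, simp_all\<close>)
  qed
  have n3: "S3 ''n'' 0 = int n"
    unfolding S3_def using sem_frame[of "''n''" "search mu"] writes_search[of mu] n2 by auto
  show ?thesis
    unfolding program_def running_time_def
  proof (rule runs_Seq[OF comp_cmd_correct[where \<rho> = \<rho> and S = S and B = ?B, OF plain_prepare(1) sim] runs_Seq[OF comp_cmd_correct[where \<rho> = \<rho> and S = S1 and B = ?B, OF plain_prepare(2)]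
        runs_Seq[OF comp_cmd_correct[where \<rho> = \<rho> and S = S2 and B = ?B, OF plain_search[OF mu(1)]] runs_weaken[OF comp_cmd_correct[where \<rho> = \<rho> and S = S3 and B = ?B, OF plain_prepare(3)]]]]])
    show "bounds (search mu) \<inter> writes (search mu) = {}" using bounds_search[OF mu(2)] writes_search[of mu] by blast
  qed (use input S1 n3 b3 nb tl writes_prepare in \<open>auto simp: bounds_prepare S1_def S2_def S3_def U_def\<close>)
qed

context ugraph
begin

lemma card_edges:
  assumes "finite A" "finite B"
  shows "card {(x, y). x \<in> A \<and> y \<in> B \<and> E x y} = ecount A B"
proof -
  have "{(x, y). x \<in> A \<and> y \<in> B \<and> E x y} = (SIGMA x:A. {y \<in> B. E x y})" by auto
  then show ?thesis using assms by (simp add: ecount_def deg_def)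
qed

end

section \<open>Transfer to the graphs and measures of the problem\<close>

locale graph_instance =
  fixes G :: "nat pair_pre_digraph" and n :: nat
  assumes graph: "pair_graph G" and verts: "pverts G = {..<n}"
begin

abbreviation E :: "nat \<Rightarrow> nat \<Rightarrow> bool" where
  "E x y \<equiv> (x, y) \<in> parcs G"

sublocale ugraph n E
proof
  interpret pair_graph G by (rule graph)
  show "(x, y) \<in> parcs G \<Longrightarrow> (y, x) \<in> parcs G" for x y
    using pair_sym_arcs unfolding symmetric_def by (auto dest: symD)
  show "(x, x) \<notin> parcs G" for x using pair_no_loops by force
qed

text \<open>An edge leaving \<open>Z\<close> has exactly one end in \<open>Z\<close>, so orienting
  it from that end identifies unordered edges with ordered pairs.\<close>

lemma boundary_eq: "Z \<subseteq> {..<n} \<Longrightarrow> boundary G Z = out Z"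
proof -
  assume Z: "Z \<subseteq> {..<n}"
  let ?P = "{(x, y). x \<in> Z \<and> y \<in> {..<n} - Z \<and> E x y}"
  have "inj_on (\<lambda>(x, y). {x, y}) ?P" by (auto simp: inj_on_def doubleton_eq_iff)
  moreover have "{{x, y} | x y. x \<in> Z \<and> y \<in> pverts G - Z \<and> E x y} = (\<lambda>(x, y). {x, y}) ` ?P"
    unfolding verts by auto
  ultimately have "boundary G Z = card ?P" by (simp add: boundary_def card_image)
  then show ?thesis using card_edges[of Z "{..<n} - Z"] Z finite_subset by auto
qed

lemma nonedge_eq: "nonedge G Z = nonedges Z"
proof -
  let ?P = "{(x, y). x \<in> Z \<and> y \<in> Z \<and> x < y \<and> \<not> E x y}"
  have "inj_on (\<lambda>(x, y). {x, y}) ?P" by (auto simp: inj_on_def doubleton_eq_iff)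
  moreover have "{{x, y} | x y. x \<in> Z \<and> y \<in> Z \<and> x \<noteq> y \<and> \<not> E x y} = (\<lambda>(x, y). {x, y}) ` ?P" (is "?L = ?R")
  proof
    show "?L \<subseteq> ?R"
    proof
      fix e assume "e \<in> ?L"
      then obtain x y where e: "e = {x, y}" "x \<in> Z" "y \<in> Z" "x \<noteq> y" "\<not> E x y" by blast
      show "e \<in> ?R"
      proof (cases "x < y")
        case True
        then show ?thesis using e by (intro image_eqI[of _ _ "(x, y)"]) auto
      next
        case False
        then show ?thesis using e sym by (intro image_eqI[of _ _ "(y, x)"]) auto
      qed
    qed
  qed auto
  ultimately show ?thesis by (simp add: nonedge_def nonedges_def card_image)
qed

lemma nondeg_eq: "nondeg G Z = max_miss Z"
  by (simp add: nondeg_def max_miss_def miss_def)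

lemma solves:
  assumes mu: "plain_ex mu" "bounds_ex mu \<subseteq> {''n''}" and spec: "run.mu_spec n E p q \<nu> mu"
    and ml: "measure_like \<nu>" and \<nu>: "\<And>Z. Z \<subseteq> {..<n} \<Longrightarrow> \<mu> G Z = \<nu> Z"
  shows "\<exists>t s. exec (program mu) (input_state G p q) t s \<and> t \<le> running_time mu n p \<and> correct_output \<mu> p q G s"
proof -
  interpret run n E p q \<nu> mu by unfold_locales
  define S where "S = input_state G p q"
  define \<rho> where "\<rho> = (\<lambda>_::vname. 0::int)"
  have inp: "S ''n'' 0 = int n" "S ''p'' 0 = p" "S ''q'' 0 = q" "S ''ok'' = (\<lambda>_. 0)" "S ''b'' = (\<lambda>_. 0)"
    by (simp_all add: S_def input_state_def verts)
  have adj: "S ''adj'' (int u * int n + int v) = of_bool (E u v)" if "v < n" for u v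
    using input_state_adj[OF verts that, of p q u] by (simp add: S_def)
  have "S (lvar x) 0 = 0" for x by (simp add: S_def input_state_def Let_def)
  then have sim: "simulates \<rho> S S" by (simp add: simulates_def \<rho>_def)
  define U where "U = sem finish \<rho> (sem (search mu) \<rho> (sem prepare_seeds \<rho> (sem prepare \<rho> S)))"
  obtain t s where ts: "exec (program mu) S t s" "t \<le> running_time mu n p" "simulates \<rho> U s"
    using program_runs[OF mu sim inp(1,2)] unfolding runs_def U_def by blast
  have out: "s ''found'' = U ''found''" "s ''cluster'' = U ''cluster''"
    using ts(3) by (simp_all add: simulates_def plain_iff)
  have cluster: "is_cluster \<mu> p q G C \<longleftrightarrow> C \<subseteq> {..<n} \<and> fits C" for C
    using \<nu>[of C] boundary_eq[of C] by (auto simp: is_cluster_def verts fits_def)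
  note alg = algorithm_correct[where S = S and \<rho> = \<rho>, OF spec ml inp(1-3) adj inp(4,5), folded U_def]
  have "correct_output \<mu> p q G s"
  proof (cases "\<forall>v<n. \<exists>C\<subseteq>{..<n}. valid v C")
    case True
    obtain R where R: "\<forall>i<n. fits (R i)" "(\<Union>i<n. R i) = {..<n}" "\<forall>i<n. \<forall>u\<in>R i. U ''cluster'' (int u) = int i"
      and found: "U ''found'' 0 = 1" using alg(2)[OF _ True] by blast
    \<comment> \<open>Every vertex of \<open>R i\<close> is labelled \<open>i\<close> and the sets
      cover all vertices, so the vertices labelled \<open>i\<close> are precisely
      \<open>R i\<close>.\<close>
    have blk: "{u \<in> pverts G. s ''cluster'' (int u) = s ''cluster'' (int v)} = R i" if "i < n" "v \<in> R i" for i v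
    proof (rule Set.set_eqI)
      fix u
      have "u \<in> R i" if "u < n" "U ''cluster'' (int u) = int i"
      proof -
        obtain j where "j < n" "u \<in> R j" using R(2) \<open>u < n\<close> by blast
        then show ?thesis using R(3) that(2) by (metis of_nat_eq_iff)
      qed
      then show "u \<in> {u \<in> pverts G. s ''cluster'' (int u) = s ''cluster'' (int v)} \<longleftrightarrow> u \<in> R i"
        using R that unfolding verts out by fastforce
    qed
    have "is_cluster_partition \<mu> p q G (output_partition G s)"
      unfolding is_cluster_partition_def
    proof (intro conjI ballI)
      show "partition_on (pverts G) (output_partition G s)"
        by (rule partition_onI) (auto simp: output_partition_def disjnt_def)
      fix C assume "C \<in> output_partition G s"
      then obtain v where v: "v < n" "C = {u \<in> pverts G. s ''cluster'' (int u) = s ''cluster'' (int v)}"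
        by (auto simp: output_partition_def verts)
      obtain i where i: "i < n" "v \<in> R i" using R(2) v(1) by blast
      then show "is_cluster \<mu> p q G C" unfolding v(2) blk[OF i] cluster using R by blast
    qed
    then show ?thesis using found by (auto simp: correct_output_def out)
  next
    case False
    \<comment> \<open>The easy direction: the block of a partition containing \<open>v\<close> is
      already a cluster around \<open>v\<close>.\<close>
    have "\<not> (\<exists>P. is_cluster_partition \<mu> p q G P)"
    proof
      assume "\<exists>P. is_cluster_partition \<mu> p q G P"
      then obtain P where P: "partition_on {..<n} P" "\<forall>C\<in>P. C \<subseteq> {..<n} \<and> fits C"
        by (auto simp: is_cluster_partition_def verts cluster)
      have "\<exists>C\<subseteq>{..<n}. valid v C" if "v < n" for v
      proof -
        obtain C where "C \<in> P" "v \<in> C" using P(1) \<open>v < n\<close> by (auto simp: partition_on_def)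
        then show ?thesis using P(2) by (auto simp: valid_def fits_def)
      qed
      then show False using \<open>\<not> (\<forall>v<n. \<exists>C\<subseteq>{..<n}. valid v C)\<close> by blast
    qed
    then show ?thesis using alg(1)[OF _ False] by (simp add: correct_output_def out)
  qed
  then show ?thesis using ts unfolding S_def by blast
qed

end

text \<open>The expression \<open>mu\<close> is fixed before the instance, so one program and one
  constant serve all graphs and parameters; only the set function \<open>\<nu>\<close> used in the
  analysis may vary with the instance.\<close>

lemma solves_partition:
  assumes "plain_ex mu" "bounds_ex mu \<subseteq> {''n''}"
    and "\<And>G n p q. graph_instance G n \<Longrightarrow> \<exists>\<nu>. run.mu_spec n (\<lambda>x y. (x, y) \<in> parcs G) p q \<nu> mu \<and>
      ugraph.measure_like n (\<lambda>x y. (x, y) \<in> parcs G) \<nu> \<and> (\<forall>Z\<subseteq>{..<n}. \<mu> G Z = \<nu> Z)"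
  shows "\<exists>c k. solves_partition_in_time \<mu> c (single_exp_bound k)"
proof -
  obtain k where k: "\<And>n p. running_time mu n p \<le> single_exp_bound k n p"
    using poly_exp_running_time[of mu] by (auto simp: poly_exp_def)
  have "solves_partition_in_time \<mu> (program mu) (single_exp_bound k)"
    unfolding solves_partition_in_time_def
  proof (intro allI impI)
    fix G :: "nat pair_pre_digraph" and n :: nat and p q :: int
    assume G: "pair_graph G \<and> pverts G = {..<n}"
    have "graph_instance G n" using G by (simp add: graph_instance_def)
    then interpret graph_instance G n .
    obtain \<nu> where "run.mu_spec n E p q \<nu> mu" "measure_like \<nu>" "\<forall>Z\<subseteq>{..<n}. \<mu> G Z = \<nu> Z"
      using assms(3)[OF graph_instance_axioms, of p q] by blast
    then obtain t s where "exec (program mu) (input_state G p q) t s" "t \<le> running_time mu n p" "correct_output \<mu> p q G s"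
      using solves[where \<nu> = \<nu> and \<mu> = \<mu>, OF assms(1,2)] by blast
    then show "\<exists>t s. exec (program mu) (input_state G p q) t s \<and> t \<le> single_exp_bound k n p \<and> correct_output \<mu> p q G s"
      using k le_trans by blast
  qed
  then show ?thesis by blast
qed

theorem theorem17:
  shows "(\<exists>c k. solves_partition_in_time size_of c (single_exp_bound k)) \<and>
         (\<exists>c k. solves_partition_in_time nonedge c (single_exp_bound k)) \<and>
         (\<exists>c k. solves_partition_in_time nondeg c (single_exp_bound k))"
proof (intro conjI)
  show "\<exists>c k. solves_partition_in_time size_of c (single_exp_bound k)"
  proof (rule solves_partition[where mu = esize])
    fix G :: "nat pair_pre_digraph" and n p q assume "graph_instance G n"
    then interpret graph_instance G n .
    interpret run n E p q card esize by unfold_locales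
    show "\<exists>\<nu>. run.mu_spec n E p q \<nu> esize \<and> measure_like \<nu> \<and> (\<forall>Z\<subseteq>{..<n}. size_of G Z = \<nu> Z)"
      using mu_spec_size measure_like_card by (intro exI[of _ card]) (simp add: size_of_def)
  qed (auto simp: esize_def macro_defs plain_iff)
  show "\<exists>c k. solves_partition_in_time nonedge c (single_exp_bound k)"
  proof (rule solves_partition[where mu = enonedge])
    fix G :: "nat pair_pre_digraph" and n p q assume "graph_instance G n"
    then interpret graph_instance G n .
    interpret run n E p q nonedges enonedge by unfold_locales
    show "\<exists>\<nu>. run.mu_spec n E p q \<nu> enonedge \<and> measure_like \<nu> \<and> (\<forall>Z\<subseteq>{..<n}. nonedge G Z = \<nu> Z)"
      using mu_spec_nonedge measure_like_nonedges by (intro exI[of _ nonedges]) (simp add: nonedge_eq)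
  qed (auto simp: enonedge_def macro_defs plain_iff)
  show "\<exists>c k. solves_partition_in_time nondeg c (single_exp_bound k)"
  proof (rule solves_partition[where mu = enondeg])
    fix G :: "nat pair_pre_digraph" and n p q assume "graph_instance G n"
    then interpret graph_instance G n .
    interpret run n E p q max_miss enondeg by unfold_locales
    show "\<exists>\<nu>. run.mu_spec n E p q \<nu> enondeg \<and> measure_like \<nu> \<and> (\<forall>Z\<subseteq>{..<n}. nondeg G Z = \<nu> Z)"
      using mu_spec_nondeg measure_like_max_miss by (intro exI[of _ max_miss]) (simp add: nondeg_eq)
  qed (auto simp: enondeg_def macro_defs plain_iff)
qed

end
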